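(* Assume propositional resizing. A type $D:\mathcal{T}$ is algebraically $\mathcal{T},\mathcal{T}$-injective if and only if $D$ is a retract of (the underlying type of) a monad algebra of the lifting $\mathcal{L}_{\mathcal{T}}$. (This is a logical equivalence: constructions in both directions.)
   Context: Foundation: intensional Martin-Löf type theory with $\mathbb{0},\mathbb{1},\mathbb{N},+,\Pi,\Sigma,\mathrm{Id}$ and universes $\mathcal{U},\mathcal{V},\mathcal{W},\mathcal{T}$ (not assumed cumulative), with successor $\mathcal{U}^+$ and least upper bound $\mathcal{U}\sqcup\mathcal{V}$; if $X:\mathcal{U}$ and $A:X\to\mathcal{V}$ then $\Pi A,\Sigma A:\mathcal{U}\sqcup\mathcal{V}$. Univalence (hence function and propositional extensionality) and existence of propositional truncations are assumed. Excluded middle is neither assumed nor rejected. A proposition (subsingleton) is a type any two of whose elements are equal. A map $j:X\to Y$ is an embedding if each fiber $j^{-1}(y):=\Sigma(x:X),\,j\,x=y$ is a subsingleton; $X\hookrightarrow Y$ is the type of embeddings. $f\sim g$ means pointwise equality. "$A$ is a retract of $B$" means there are designated $s:A\to B$, $r:B\to A$ and $r\circ s\sim\mathrm{id}$. A type $D$ (in any universe) is algebraically $\mathcal{U},\mathcal{V}$-injective if it is equipped with an element of $$\Pi(X:\mathcal{U})\,\Pi(Y:\mathcal{V})\,\Pi(j:X\hookrightarrow Y)\,\Pi(f:X\to D),\ \Sigma(g:Y\to D),\ g\circ j\sim f.$$ Propositional resizing: for any two universes $\mathcal{U},\mathcal{V}$, every proposition in $\mathcal{U}$ has an equivalent copy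 in $\mathcal{V}$. Lifting (partial-map classifier): for a type $X:\mathcal{U}$ in any universe, $$\mathcal{L}_{\mathcal{T}}X := \Sigma(P:\mathcal{T}),\ (P\to X)\times (P\text{ is a subsingleton})\ :\ \mathcal{T}^+\sqcup\mathcal{U}.$$ It is a monad "across universes" (no higher coherence data is required): on functions $\mathcal{L}_{\mathcal{T}}f(P,\varphi,i)=(P,f\circ\varphi,i)$; the unit is $\eta_X\,x=(\mathbb{1},(p\mapsto x),i)$ with $i$ the proof that $\mathbb{1}$ is a proposition; the multiplication $\mu_X:\mathcal{L}_{\mathcal{T}}(\mathcal{L}_{\mathcal{T}}X)\to\mathcal{L}_{\mathcal{T}}X$ sends $(P,\varphi,i)$ to the triple with domain $\Sigma(p:P),\,\mathrm{pr}_1(\varphi\,p)$, with value function $(p,q)\mapsto (\text{value function of }\varphi\,p)\,q$, and with the proof that subsingletons are closed under sums. A monad algebra of $\mathcal{L}_{\mathcal{T}}$ is a type $X$ in some universe with a map $\alpha:\mathcal{L}_{\mathcal{T}}X\to X$ satisfying the unit law $\alpha\circ\eta_X\sim\mathrm{id}$ and the associativity law $\alpha\circ\mu_X\sim\alpha\circ\mathcal{L}_{\mathcal{T}}\alpha$. Equivalently, it is a family of functions $\bigsqcup_P:(P\to X)\to X$, with $P:\mathcal{T}$ ranging over subsingletons, such that $\bigsqcup_{p:\mathbb{1}}x=x$ for all $x:X$ and $\bigsqcup_{t:\Sigma Q}\varphi\,t=\bigsqcup_{p:P}\bigsqcup_{q:Q\,p}\varphi(p,q)$ for every subsingleton $P:\mathcal{T}$,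 family $Q:P\to\mathcal{T}$ of subsingletons and $\varphi:\Sigma Q\to X$. *)

theory Defs
  imports Main
begin

text \<open>
  Intensional Martin-Loef type theory is embedded deeply, by raw terms with de Bruijn indices,
  their conversion and an inductive typing judgement.  A shallow embedding into HOL would validate
  excluded middle and choice, which are not available here.
\<close>


section \<open>Universe levels\<close>

text \<open>
  Universes are indexed by an arbitrary structure of this class.  The equations between levels
  (idempotence, associativity and commutativity of \<open>\<squnion>\<close>, absorption of the least level,
  \<open>u \<squnion> u\<^sup>+ = u\<^sup>+\<close>, distributivity of the successor) hold definitionally in the type theory,
  because levels are compared by equality in HOL.  A statement for all structures covers in
  particular the free one, whose elements are the level expressions in universe variables.
\<close>

unbundle lattice_syntax

class universe_level = bounded_semilattice_sup_bot +
  fixes next_level :: "'a \<Rightarrow> 'a"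
  assumes less_next_level: "u < next_level u"
    and next_level_sup: "next_level (u \<squnion> v) = next_level u \<squnion> next_level v"

instantiation nat :: universe_level
begin

definition next_level_nat :: "nat \<Rightarrow> nat" where
  "next_level_nat = Suc"

instance
  by standard (auto simp: next_level_nat_def sup_nat_def max_def)

end


section \<open>Raw terms\<close>

datatype 'l axiom_name =
    Univalence 'l
  | Trunc 'l
  | Trunc_is_prop 'l
  | Trunc_intro 'l
  | Trunc_rec 'l 'l
  | Resizing 'l 'l

text \<open>
  Only the second argument of \<open>TPi\<close>, \<open>TLam\<close> and \<open>TSig\<close> is under a binder; eliminators take their
  motive and their cases as functions of the theory.  The empty type and the one-element type have
  a copy in every universe.
\<close>

datatype 'l tm =
    TVar nat
  | TAx "'l axiom_name"
  | TUniv 'l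
  | TPi "'l tm" "'l tm"
  | TLam "'l tm" "'l tm"
  | TApp "'l tm" "'l tm"
  | TSig "'l tm" "'l tm"
  | TPair "'l tm" "'l tm"
  | TSigInd "'l tm" "'l tm" "'l tm"
  | TPlus "'l tm" "'l tm"
  | TInl "'l tm"
  | TInr "'l tm"
  | TPlusInd "'l tm" "'l tm" "'l tm" "'l tm"
  | TEmpty 'l
  | TEmptyInd "'l tm" "'l tm"
  | TUnit 'l
  | TStar 'l
  | TUnitInd "'l tm" "'l tm" "'l tm"
  | TNat
  | TZero
  | TSucc "'l tm"
  | TNatInd "'l tm" "'l tm" "'l tm" "'l tm"
  | TId "'l tm" "'l tm" "'l tm"
  | TRefl "'l tm"
  | TIdInd "'l tm" "'l tm" "'l tm" "'l tm" "'l tm"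

text \<open>\<open>shift k t\<close> increments the free variables of \<open>t\<close> with index at least \<open>k\<close>.\<close>

primrec shift :: "nat \<Rightarrow> 'l tm \<Rightarrow> 'l tm" where
  "shift k (TVar i) = TVar (if i < k then i else Suc i)"
| "shift k (TAx c) = TAx c"
| "shift k (TUniv u) = TUniv u"
| "shift k (TPi A B) = TPi (shift k A) (shift (Suc k) B)"
| "shift k (TLam A b) = TLam (shift k A) (shift (Suc k) b)"
| "shift k (TApp f a) = TApp (shift k f) (shift k a)"
| "shift k (TSig A B) = TSig (shift k A) (shift (Suc k) B)"
| "shift k (TPair a b) = TPair (shift k a) (shift k b)"
| "shift k (TSigInd C d p) = TSigInd (shift k C) (shift k d) (shift k p)"
| "shift k (TPlus A B) = TPlus (shift k A) (shift k B)"
| "shift k (TInl a) = TInl (shift k a)"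
| "shift k (TInr b) = TInr (shift k b)"
| "shift k (TPlusInd C l r s) = TPlusInd (shift k C) (shift k l) (shift k r) (shift k s)"
| "shift k (TEmpty u) = TEmpty u"
| "shift k (TEmptyInd C e) = TEmptyInd (shift k C) (shift k e)"
| "shift k (TUnit u) = TUnit u"
| "shift k (TStar u) = TStar u"
| "shift k (TUnitInd C d p) = TUnitInd (shift k C) (shift k d) (shift k p)"
| "shift k TNat = TNat"
| "shift k TZero = TZero"
| "shift k (TSucc n) = TSucc (shift k n)"
| "shift k (TNatInd C z s n) = TNatInd (shift k C) (shift k z) (shift k s) (shift k n)"
| "shift k (TId A a b) = TId (shift k A) (shift k a) (shift k b)"
| "shift k (TRefl a) = TRefl (shift k a)"
| "shift k (TIdInd C d a b p) =
    TIdInd (shift k C) (shift k d) (shift k a) (shift k b) (shift k p)"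

abbreviation up :: "'l tm \<Rightarrow> 'l tm" ("\<up>_" [1000] 999) where
  "\<up>t \<equiv> shift 0 t"

text \<open>\<open>subst k s t\<close> replaces variable \<open>k\<close> of \<open>t\<close> by \<open>s\<close> and decrements the larger ones.\<close>

primrec subst :: "nat \<Rightarrow> 'l tm \<Rightarrow> 'l tm \<Rightarrow> 'l tm" where
  "subst k s (TVar i) = (if i < k then TVar i else if i = k then s else TVar (i - 1))"
| "subst k s (TAx c) = TAx c"
| "subst k s (TUniv u) = TUniv u"
| "subst k s (TPi A B) = TPi (subst k s A) (subst (Suc k) (\<up>s) B)"
| "subst k s (TLam A b) = TLam (subst k s A) (subst (Suc k) (\<up>s) b)"
| "subst k s (TApp f a) = TApp (subst k s f) (subst k s a)"
| "subst k s (TSig A B) = TSig (subst k s A) (subst (Suc k) (\<up>s) B)"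
| "subst k s (TPair a b) = TPair (subst k s a) (subst k s b)"
| "subst k s (TSigInd C d p) = TSigInd (subst k s C) (subst k s d) (subst k s p)"
| "subst k s (TPlus A B) = TPlus (subst k s A) (subst k s B)"
| "subst k s (TInl a) = TInl (subst k s a)"
| "subst k s (TInr b) = TInr (subst k s b)"
| "subst k s (TPlusInd C l r x) =
    TPlusInd (subst k s C) (subst k s l) (subst k s r) (subst k s x)"
| "subst k s (TEmpty u) = TEmpty u"
| "subst k s (TEmptyInd C e) = TEmptyInd (subst k s C) (subst k s e)"
| "subst k s (TUnit u) = TUnit u"
| "subst k s (TStar u) = TStar u"
| "subst k s (TUnitInd C d p) = TUnitInd (subst k s C) (subst k s d) (subst k s p)"
| "subst k s TNat = TNat"
| "subst k s TZero = TZero"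
| "subst k s (TSucc n) = TSucc (subst k s n)"
| "subst k s (TNatInd C z f n) =
    TNatInd (subst k s C) (subst k s z) (subst k s f) (subst k s n)"
| "subst k s (TId A a b) = TId (subst k s A) (subst k s a) (subst k s b)"
| "subst k s (TRefl a) = TRefl (subst k s a)"
| "subst k s (TIdInd C d a b p) =
    TIdInd (subst k s C) (subst k s d) (subst k s a) (subst k s b) (subst k s p)"


section \<open>Conversion\<close>

text \<open>
  Definitional equality: the congruence generated by the computation rules and \<open>\<eta>\<close> for \<open>\<Pi>\<close>.
  There is no \<open>\<eta>\<close> for the other type formers, and the axioms do not compute.
\<close>

inductive conv :: "'l tm \<Rightarrow> 'l tm \<Rightarrow> bool" (infix "\<equiv>\<^sub>\<beta>\<^sub>\<eta>" 50) where
  conv_refl: "t \<equiv>\<^sub>\<beta>\<^sub>\<eta> t"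
| conv_sym: "s \<equiv>\<^sub>\<beta>\<^sub>\<eta> t \<Longrightarrow> t \<equiv>\<^sub>\<beta>\<^sub>\<eta> s"
| conv_trans: "s \<equiv>\<^sub>\<beta>\<^sub>\<eta> t \<Longrightarrow> t \<equiv>\<^sub>\<beta>\<^sub>\<eta> w \<Longrightarrow> s \<equiv>\<^sub>\<beta>\<^sub>\<eta> w"
| beta_Pi: "TApp (TLam A b) a \<equiv>\<^sub>\<beta>\<^sub>\<eta> subst 0 a b"
| eta_Pi: "TLam A (TApp (\<up>f) (TVar 0)) \<equiv>\<^sub>\<beta>\<^sub>\<eta> f"
| beta_Sig: "TSigInd C d (TPair a b) \<equiv>\<^sub>\<beta>\<^sub>\<eta> TApp (TApp d a) b"
| beta_Inl: "TPlusInd C l r (TInl a) \<equiv>\<^sub>\<beta>\<^sub>\<eta> TApp l a"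
| beta_Inr: "TPlusInd C l r (TInr b) \<equiv>\<^sub>\<beta>\<^sub>\<eta> TApp r b"
| beta_Unit: "TUnitInd C d (TStar u) \<equiv>\<^sub>\<beta>\<^sub>\<eta> d"
| beta_Zero: "TNatInd C z s TZero \<equiv>\<^sub>\<beta>\<^sub>\<eta> z"
| beta_Succ: "TNatInd C z s (TSucc n) \<equiv>\<^sub>\<beta>\<^sub>\<eta> TApp (TApp s n) (TNatInd C z s n)"
| beta_Id: "TIdInd C d a a (TRefl a) \<equiv>\<^sub>\<beta>\<^sub>\<eta> TApp d a"
| cong_Pi: "A \<equiv>\<^sub>\<beta>\<^sub>\<eta> A' \<Longrightarrow> B \<equiv>\<^sub>\<beta>\<^sub>\<eta> B' \<Longrightarrow> TPi A B \<equiv>\<^sub>\<beta>\<^sub>\<eta> TPi A' B'"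
| cong_Lam: "A \<equiv>\<^sub>\<beta>\<^sub>\<eta> A' \<Longrightarrow> b \<equiv>\<^sub>\<beta>\<^sub>\<eta> b' \<Longrightarrow> TLam A b \<equiv>\<^sub>\<beta>\<^sub>\<eta> TLam A' b'"
| cong_App: "f \<equiv>\<^sub>\<beta>\<^sub>\<eta> f' \<Longrightarrow> a \<equiv>\<^sub>\<beta>\<^sub>\<eta> a' \<Longrightarrow> TApp f a \<equiv>\<^sub>\<beta>\<^sub>\<eta> TApp f' a'"
| cong_Sig: "A \<equiv>\<^sub>\<beta>\<^sub>\<eta> A' \<Longrightarrow> B \<equiv>\<^sub>\<beta>\<^sub>\<eta> B' \<Longrightarrow> TSig A B \<equiv>\<^sub>\<beta>\<^sub>\<eta> TSig A' B'"
| cong_Pair: "a \<equiv>\<^sub>\<beta>\<^sub>\<eta> a' \<Longrightarrow> b \<equiv>\<^sub>\<beta>\<^sub>\<eta> b' \<Longrightarrow> TPair a b \<equiv>\<^sub>\<beta>\<^sub>\<eta> TPair a' b'"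
| cong_SigInd:
    "C \<equiv>\<^sub>\<beta>\<^sub>\<eta> C' \<Longrightarrow> d \<equiv>\<^sub>\<beta>\<^sub>\<eta> d' \<Longrightarrow> p \<equiv>\<^sub>\<beta>\<^sub>\<eta> p' \<Longrightarrow> TSigInd C d p \<equiv>\<^sub>\<beta>\<^sub>\<eta> TSigInd C' d' p'"
| cong_Plus: "A \<equiv>\<^sub>\<beta>\<^sub>\<eta> A' \<Longrightarrow> B \<equiv>\<^sub>\<beta>\<^sub>\<eta> B' \<Longrightarrow> TPlus A B \<equiv>\<^sub>\<beta>\<^sub>\<eta> TPlus A' B'"
| cong_Inl: "a \<equiv>\<^sub>\<beta>\<^sub>\<eta> a' \<Longrightarrow> TInl a \<equiv>\<^sub>\<beta>\<^sub>\<eta> TInl a'"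
| cong_Inr: "b \<equiv>\<^sub>\<beta>\<^sub>\<eta> b' \<Longrightarrow> TInr b \<equiv>\<^sub>\<beta>\<^sub>\<eta> TInr b'"
| cong_PlusInd:
    "C \<equiv>\<^sub>\<beta>\<^sub>\<eta> C' \<Longrightarrow> l \<equiv>\<^sub>\<beta>\<^sub>\<eta> l' \<Longrightarrow> r \<equiv>\<^sub>\<beta>\<^sub>\<eta> r' \<Longrightarrow> s \<equiv>\<^sub>\<beta>\<^sub>\<eta> s' \<Longrightarrow>
      TPlusInd C l r s \<equiv>\<^sub>\<beta>\<^sub>\<eta> TPlusInd C' l' r' s'"
| cong_EmptyInd: "C \<equiv>\<^sub>\<beta>\<^sub>\<eta> C' \<Longrightarrow> e \<equiv>\<^sub>\<beta>\<^sub>\<eta> e' \<Longrightarrow> TEmptyInd C e \<equiv>\<^sub>\<beta>\<^sub>\<eta> TEmptyInd C' e'"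
| cong_UnitInd:
    "C \<equiv>\<^sub>\<beta>\<^sub>\<eta> C' \<Longrightarrow> d \<equiv>\<^sub>\<beta>\<^sub>\<eta> d' \<Longrightarrow> p \<equiv>\<^sub>\<beta>\<^sub>\<eta> p' \<Longrightarrow> TUnitInd C d p \<equiv>\<^sub>\<beta>\<^sub>\<eta> TUnitInd C' d' p'"
| cong_Succ: "n \<equiv>\<^sub>\<beta>\<^sub>\<eta> n' \<Longrightarrow> TSucc n \<equiv>\<^sub>\<beta>\<^sub>\<eta> TSucc n'"
| cong_NatInd:
    "C \<equiv>\<^sub>\<beta>\<^sub>\<eta> C' \<Longrightarrow> z \<equiv>\<^sub>\<beta>\<^sub>\<eta> z' \<Longrightarrow> s \<equiv>\<^sub>\<beta>\<^sub>\<eta> s' \<Longrightarrow> n \<equiv>\<^sub>\<beta>\<^sub>\<eta> n' \<Longrightarrow>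
      TNatInd C z s n \<equiv>\<^sub>\<beta>\<^sub>\<eta> TNatInd C' z' s' n'"
| cong_Id: "A \<equiv>\<^sub>\<beta>\<^sub>\<eta> A' \<Longrightarrow> a \<equiv>\<^sub>\<beta>\<^sub>\<eta> a' \<Longrightarrow> b \<equiv>\<^sub>\<beta>\<^sub>\<eta> b' \<Longrightarrow> TId A a b \<equiv>\<^sub>\<beta>\<^sub>\<eta> TId A' a' b'"
| cong_Refl: "a \<equiv>\<^sub>\<beta>\<^sub>\<eta> a' \<Longrightarrow> TRefl a \<equiv>\<^sub>\<beta>\<^sub>\<eta> TRefl a'"
| cong_IdInd:
    "C \<equiv>\<^sub>\<beta>\<^sub>\<eta> C' \<Longrightarrow> d \<equiv>\<^sub>\<beta>\<^sub>\<eta> d' \<Longrightarrow> a \<equiv>\<^sub>\<beta>\<^sub>\<eta> a' \<Longrightarrow> b \<equiv>\<^sub>\<beta>\<^sub>\<eta> b' \<Longrightarrow> p \<equiv>\<^sub>\<beta>\<^sub>\<eta> p' \<Longrightarrow>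
      TIdInd C d a b p \<equiv>\<^sub>\<beta>\<^sub>\<eta> TIdInd C' d' a' b' p'"


section \<open>Notation with named variables\<close>

text \<open>
  To avoid explicit indices, types and terms of the theory are written as functions from the number
  of enclosing binders to raw terms.  The variable bound at depth \<open>n\<close> becomes the index
  \<open>m - Suc n\<close> at depth \<open>m\<close>, and an expression used under further binders is weakened
  automatically because it is evaluated at the larger depth.  A closed expression \<open>A\<close> denotes the
  raw term \<open>A 0\<close>.
\<close>

type_synonym 'l expr = "nat \<Rightarrow> 'l tm"

definition bound_var :: "nat \<Rightarrow> 'l expr" where
  "bound_var n = (\<lambda>m. TVar (m - Suc n))"

definition axm :: "'l axiom_name \<Rightarrow> 'l expr" where
  "axm c = (\<lambda>n. TAx c)"

definition universe :: "'l \<Rightarrow> 'l expr" where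
  "universe u = (\<lambda>n. TUniv u)"

definition pi_type :: "'l expr \<Rightarrow> ('l expr \<Rightarrow> 'l expr) \<Rightarrow> 'l expr" where
  "pi_type A B = (\<lambda>n. TPi (A n) (B (bound_var n) (Suc n)))"

definition lam :: "'l expr \<Rightarrow> ('l expr \<Rightarrow> 'l expr) \<Rightarrow> 'l expr" where
  "lam A b = (\<lambda>n. TLam (A n) (b (bound_var n) (Suc n)))"

definition app :: "'l expr \<Rightarrow> 'l expr \<Rightarrow> 'l expr" (infixl "\<cdot>" 80) where
  "f \<cdot> a = (\<lambda>n. TApp (f n) (a n))"

definition sig_type :: "'l expr \<Rightarrow> ('l expr \<Rightarrow> 'l expr) \<Rightarrow> 'l expr" where
  "sig_type A B = (\<lambda>n. TSig (A n) (B (bound_var n) (Suc n)))"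

definition pair_of :: "'l expr \<Rightarrow> 'l expr \<Rightarrow> 'l expr" ("\<langle>_,/ _\<rangle>") where
  "\<langle>a, b\<rangle> = (\<lambda>n. TPair (a n) (b n))"

definition sig_ind :: "'l expr \<Rightarrow> 'l expr \<Rightarrow> 'l expr \<Rightarrow> 'l expr" where
  "sig_ind C d p = (\<lambda>n. TSigInd (C n) (d n) (p n))"

definition unit_type :: "'l \<Rightarrow> 'l expr" where
  "unit_type u = (\<lambda>n. TUnit u)"

definition star :: "'l \<Rightarrow> 'l expr" where
  "star u = (\<lambda>n. TStar u)"

definition unit_ind :: "'l expr \<Rightarrow> 'l expr \<Rightarrow> 'l expr \<Rightarrow> 'l expr" where
  "unit_ind C d p = (\<lambda>n. TUnitInd (C n) (d n) (p n))"

definition ident :: "'l expr \<Rightarrow> 'l expr \<Rightarrow> 'l expr \<Rightarrow> 'l expr" where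
  "ident A a b = (\<lambda>n. TId (A n) (a n) (b n))"

definition rfl :: "'l expr \<Rightarrow> 'l expr" where
  "rfl a = (\<lambda>n. TRefl (a n))"

definition id_ind ::
    "'l expr \<Rightarrow> 'l expr \<Rightarrow> 'l expr \<Rightarrow> 'l expr \<Rightarrow> 'l expr \<Rightarrow> 'l expr" where
  "id_ind C d a b p = (\<lambda>n. TIdInd (C n) (d n) (a n) (b n) (p n))"

syntax
  "_pi" :: "[pttrn, logic, logic] \<Rightarrow> logic" ("(3\<Prod> _ \<Colon> _./ _)" [0, 0, 10] 10)
  "_sig" :: "[pttrn, logic, logic] \<Rightarrow> logic" ("(3\<Sum> _ \<Colon> _./ _)" [0, 0, 10] 10)
  "_lam" :: "[pttrn, logic, logic] \<Rightarrow> logic" ("(3\<Lambda> _ \<Colon> _./ _)" [0, 0, 10] 10)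
translations
  "\<Prod> x \<Colon> A. B" \<rightleftharpoons> "CONST pi_type A (\<lambda>x. B)"
  "\<Sum> x \<Colon> A. B" \<rightleftharpoons> "CONST sig_type A (\<lambda>x. B)"
  "\<Lambda> x \<Colon> A. b" \<rightleftharpoons> "CONST lam A (\<lambda>x. b)"

definition arr :: "'l expr \<Rightarrow> 'l expr \<Rightarrow> 'l expr" (infixr "\<leadsto>" 60) where
  "A \<leadsto> B = (\<Prod> x \<Colon> A. B)"

definition prod_type :: "'l expr \<Rightarrow> 'l expr \<Rightarrow> 'l expr" (infixr "\<otimes>" 70) where
  "A \<otimes> B = (\<Sum> x \<Colon> A. B)"

definition proj1 :: "'l expr \<Rightarrow> ('l expr \<Rightarrow> 'l expr) \<Rightarrow> 'l expr \<Rightarrow> 'l expr" where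
  "proj1 A B p = sig_ind (\<Lambda> z \<Colon> sig_type A B. A) (\<Lambda> x \<Colon> A. \<Lambda> y \<Colon> B x. x) p"

definition proj2 :: "'l expr \<Rightarrow> ('l expr \<Rightarrow> 'l expr) \<Rightarrow> 'l expr \<Rightarrow> 'l expr" where
  "proj2 A B p =
    sig_ind (\<Lambda> z \<Colon> sig_type A B. B (proj1 A B z)) (\<Lambda> x \<Colon> A. \<Lambda> y \<Colon> B x. y) p"

definition id_fun :: "'l expr \<Rightarrow> 'l expr" where
  "id_fun A = (\<Lambda> x \<Colon> A. x)"

text \<open>\<open>fun_comp A g f\<close> is \<open>g \<circ> f\<close>, where \<open>A\<close> is the domain of \<open>f\<close>.\<close>

definition fun_comp :: "'l expr \<Rightarrow> 'l expr \<Rightarrow> 'l expr \<Rightarrow> 'l expr" where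
  "fun_comp A g f = (\<Lambda> x \<Colon> A. g \<cdot> (f \<cdot> x))"

text \<open>\<open>homotopy A B f g\<close> is \<open>f \<sim> g\<close> for \<open>f, g : A \<rightarrow> B\<close>.\<close>

definition homotopy :: "'l expr \<Rightarrow> 'l expr \<Rightarrow> 'l expr \<Rightarrow> 'l expr \<Rightarrow> 'l expr" where
  "homotopy A B f g = (\<Prod> x \<Colon> A. ident B (f \<cdot> x) (g \<cdot> x))"

definition is_prop :: "'l expr \<Rightarrow> 'l expr" where
  "is_prop A = (\<Prod> x \<Colon> A. \<Prod> y \<Colon> A. ident A x y)"


section \<open>Univalence, truncation and resizing\<close>

text \<open>An equivalence is a map with a section and a retraction.\<close>

definition is_equiv :: "'l expr \<Rightarrow> 'l expr \<Rightarrow> 'l expr \<Rightarrow> 'l expr" where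
  "is_equiv A B f =
    (\<Sum> s \<Colon> B \<leadsto> A. homotopy B B (fun_comp B f s) (id_fun B)) \<otimes>
    (\<Sum> r \<Colon> B \<leadsto> A. homotopy A A (fun_comp A r f) (id_fun A))"

definition equivalence :: "'l expr \<Rightarrow> 'l expr \<Rightarrow> 'l expr" where
  "equivalence A B = (\<Sum> f \<Colon> A \<leadsto> B. is_equiv A B f)"

definition id_equiv :: "'l expr \<Rightarrow> 'l expr" where
  "id_equiv A =
    \<langle>id_fun A, \<langle>\<langle>id_fun A, \<Lambda> x \<Colon> A. rfl x\<rangle>, \<langle>id_fun A, \<Lambda> x \<Colon> A. rfl x\<rangle>\<rangle>\<rangle>"

definition id_to_equiv :: "'l \<Rightarrow> 'l expr \<Rightarrow> 'l expr \<Rightarrow> 'l expr" where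
  "id_to_equiv u X Y =
    (\<Lambda> p \<Colon> ident (universe u) X Y.
      id_ind
        (\<Lambda> A \<Colon> universe u. \<Lambda> B \<Colon> universe u. \<Lambda> q \<Colon> ident (universe u) A B. equivalence A B)
        (\<Lambda> A \<Colon> universe u. id_equiv A) X Y p)"

definition univalence :: "'l \<Rightarrow> 'l expr" where
  "univalence u =
    (\<Prod> X \<Colon> universe u. \<Prod> Y \<Colon> universe u.
      is_equiv (ident (universe u) X Y) (equivalence X Y) (id_to_equiv u X Y))"

text \<open>Every proposition in the universe \<open>u\<close> has an equivalent copy in the universe \<open>v\<close>.\<close>

definition prop_resizing :: "'l \<Rightarrow> 'l \<Rightarrow> 'l expr" where
  "prop_resizing u v = (\<Prod> P \<Colon> universe u. is_prop P \<leadsto> (\<Sum> Q \<Colon> universe v. equivalence Q P))"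

text \<open>
  The recursion principle of the truncation \<open>Trunc u\<close> eliminates into propositions of any
  universe \<open>v\<close>.
\<close>

fun axiom_type :: "'l axiom_name \<Rightarrow> 'l expr" where
  "axiom_type (Univalence u) = univalence u"
| "axiom_type (Trunc u) = universe u \<leadsto> universe u"
| "axiom_type (Trunc_is_prop u) = (\<Prod> X \<Colon> universe u. is_prop (axm (Trunc u) \<cdot> X))"
| "axiom_type (Trunc_intro u) = (\<Prod> X \<Colon> universe u. X \<leadsto> axm (Trunc u) \<cdot> X)"
| "axiom_type (Trunc_rec u v) =
    (\<Prod> X \<Colon> universe u. \<Prod> P \<Colon> universe v.
      is_prop P \<leadsto> (X \<leadsto> P) \<leadsto> (axm (Trunc u) \<cdot> X \<leadsto> P))"
| "axiom_type (Resizing u v) = prop_resizing u v"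

definition foundation_axioms :: "'l axiom_name set" where
  "foundation_axioms =
    {Univalence u | u. True} \<union>
    {Trunc u | u. True} \<union> {Trunc_is_prop u | u. True} \<union> {Trunc_intro u | u. True} \<union>
    {Trunc_rec u v | u v. True}"

definition resizing_axioms :: "'l axiom_name set" where
  "resizing_axioms = {Resizing u v | u v. True}"


section \<open>Typing\<close>

text \<open>
  The judgement is relative to a set \<open>S\<close> of admitted axioms.  Contexts list the type of the
  variable \<open>0\<close> first.  Being a type means being a term of some universe, and universes are not
  cumulative.
\<close>

inductive
  ctx :: "'l::universe_level axiom_name set \<Rightarrow> 'l tm list \<Rightarrow> bool" and
  typing :: "'l axiom_name set \<Rightarrow> 'l tm list \<Rightarrow> 'l tm \<Rightarrow> 'l tm \<Rightarrow> bool"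
    ("_ \<parallel> _ \<turnstile> _ \<Colon> _" [51, 51, 51, 51] 50)
  for S where
  ctx_Nil: "ctx S []"
| ctx_Cons: "S \<parallel> \<Gamma> \<turnstile> A \<Colon> TUniv u \<Longrightarrow> ctx S (A # \<Gamma>)"
| ty_Var: "ctx S \<Gamma> \<Longrightarrow> i < length \<Gamma> \<Longrightarrow> S \<parallel> \<Gamma> \<turnstile> TVar i \<Colon> (shift 0 ^^ Suc i) (\<Gamma> ! i)"
| ty_Ax: "ctx S \<Gamma> \<Longrightarrow> c \<in> S \<Longrightarrow> S \<parallel> \<Gamma> \<turnstile> TAx c \<Colon> axiom_type c 0"
| ty_conv: "S \<parallel> \<Gamma> \<turnstile> t \<Colon> A \<Longrightarrow> S \<parallel> \<Gamma> \<turnstile> B \<Colon> TUniv u \<Longrightarrow> A \<equiv>\<^sub>\<beta>\<^sub>\<eta> B \<Longrightarrow> S \<parallel> \<Gamma> \<turnstile> t \<Colon> B"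
| ty_Univ: "ctx S \<Gamma> \<Longrightarrow> S \<parallel> \<Gamma> \<turnstile> TUniv u \<Colon> TUniv (next_level u)"
| ty_Pi: "S \<parallel> \<Gamma> \<turnstile> A \<Colon> TUniv u \<Longrightarrow> S \<parallel> A # \<Gamma> \<turnstile> B \<Colon> TUniv v \<Longrightarrow>
    S \<parallel> \<Gamma> \<turnstile> TPi A B \<Colon> TUniv (u \<squnion> v)"
| ty_Lam: "S \<parallel> A # \<Gamma> \<turnstile> b \<Colon> B \<Longrightarrow> S \<parallel> \<Gamma> \<turnstile> TLam A b \<Colon> TPi A B"
| ty_App: "S \<parallel> \<Gamma> \<turnstile> f \<Colon> TPi A B \<Longrightarrow> S \<parallel> \<Gamma> \<turnstile> a \<Colon> A \<Longrightarrow> S \<parallel> \<Gamma> \<turnstile> TApp f a \<Colon> subst 0 a B"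
| ty_Sig: "S \<parallel> \<Gamma> \<turnstile> A \<Colon> TUniv u \<Longrightarrow> S \<parallel> A # \<Gamma> \<turnstile> B \<Colon> TUniv v \<Longrightarrow>
    S \<parallel> \<Gamma> \<turnstile> TSig A B \<Colon> TUniv (u \<squnion> v)"
| ty_Pair: "S \<parallel> \<Gamma> \<turnstile> a \<Colon> A \<Longrightarrow> S \<parallel> A # \<Gamma> \<turnstile> B \<Colon> TUniv v \<Longrightarrow> S \<parallel> \<Gamma> \<turnstile> b \<Colon> subst 0 a B \<Longrightarrow>
    S \<parallel> \<Gamma> \<turnstile> TPair a b \<Colon> TSig A B"
| ty_SigInd: "S \<parallel> \<Gamma> \<turnstile> C \<Colon> TPi (TSig A B) (TUniv w) \<Longrightarrow>
    S \<parallel> \<Gamma> \<turnstile> d \<Colon> TPi A (TPi B (TApp (\<up>(\<up>C)) (TPair (TVar 1) (TVar 0)))) \<Longrightarrow>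
    S \<parallel> \<Gamma> \<turnstile> p \<Colon> TSig A B \<Longrightarrow> S \<parallel> \<Gamma> \<turnstile> TSigInd C d p \<Colon> TApp C p"
| ty_Plus: "S \<parallel> \<Gamma> \<turnstile> A \<Colon> TUniv u \<Longrightarrow> S \<parallel> \<Gamma> \<turnstile> B \<Colon> TUniv v \<Longrightarrow>
    S \<parallel> \<Gamma> \<turnstile> TPlus A B \<Colon> TUniv (u \<squnion> v)"
| ty_Inl: "S \<parallel> \<Gamma> \<turnstile> a \<Colon> A \<Longrightarrow> S \<parallel> \<Gamma> \<turnstile> B \<Colon> TUniv v \<Longrightarrow> S \<parallel> \<Gamma> \<turnstile> TInl a \<Colon> TPlus A B"
| ty_Inr: "S \<parallel> \<Gamma> \<turnstile> A \<Colon> TUniv u \<Longrightarrow> S \<parallel> \<Gamma> \<turnstile> b \<Colon> B \<Longrightarrow> S \<parallel> \<Gamma> \<turnstile> TInr b \<Colon> TPlus A B"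
| ty_PlusInd: "S \<parallel> \<Gamma> \<turnstile> C \<Colon> TPi (TPlus A B) (TUniv w) \<Longrightarrow>
    S \<parallel> \<Gamma> \<turnstile> l \<Colon> TPi A (TApp (\<up>C) (TInl (TVar 0))) \<Longrightarrow>
    S \<parallel> \<Gamma> \<turnstile> r \<Colon> TPi B (TApp (\<up>C) (TInr (TVar 0))) \<Longrightarrow>
    S \<parallel> \<Gamma> \<turnstile> s \<Colon> TPlus A B \<Longrightarrow> S \<parallel> \<Gamma> \<turnstile> TPlusInd C l r s \<Colon> TApp C s"
| ty_Empty: "ctx S \<Gamma> \<Longrightarrow> S \<parallel> \<Gamma> \<turnstile> TEmpty u \<Colon> TUniv u"
| ty_EmptyInd: "S \<parallel> \<Gamma> \<turnstile> C \<Colon> TPi (TEmpty u) (TUniv w) \<Longrightarrow> S \<parallel> \<Gamma> \<turnstile> e \<Colon> TEmpty u \<Longrightarrow>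
    S \<parallel> \<Gamma> \<turnstile> TEmptyInd C e \<Colon> TApp C e"
| ty_Unit: "ctx S \<Gamma> \<Longrightarrow> S \<parallel> \<Gamma> \<turnstile> TUnit u \<Colon> TUniv u"
| ty_Star: "ctx S \<Gamma> \<Longrightarrow> S \<parallel> \<Gamma> \<turnstile> TStar u \<Colon> TUnit u"
| ty_UnitInd: "S \<parallel> \<Gamma> \<turnstile> C \<Colon> TPi (TUnit u) (TUniv w) \<Longrightarrow>
    S \<parallel> \<Gamma> \<turnstile> d \<Colon> TApp C (TStar u) \<Longrightarrow> S \<parallel> \<Gamma> \<turnstile> p \<Colon> TUnit u \<Longrightarrow>
    S \<parallel> \<Gamma> \<turnstile> TUnitInd C d p \<Colon> TApp C p"
| ty_Nat: "ctx S \<Gamma> \<Longrightarrow> S \<parallel> \<Gamma> \<turnstile> TNat \<Colon> TUniv \<bottom>"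
| ty_Zero: "ctx S \<Gamma> \<Longrightarrow> S \<parallel> \<Gamma> \<turnstile> TZero \<Colon> TNat"
| ty_Succ: "S \<parallel> \<Gamma> \<turnstile> n \<Colon> TNat \<Longrightarrow> S \<parallel> \<Gamma> \<turnstile> TSucc n \<Colon> TNat"
| ty_NatInd: "S \<parallel> \<Gamma> \<turnstile> C \<Colon> TPi TNat (TUniv w) \<Longrightarrow> S \<parallel> \<Gamma> \<turnstile> z \<Colon> TApp C TZero \<Longrightarrow>
    S \<parallel> \<Gamma> \<turnstile> s \<Colon> TPi TNat (TPi (TApp (\<up>C) (TVar 0)) (TApp (\<up>(\<up>C)) (TSucc (TVar 1)))) \<Longrightarrow>
    S \<parallel> \<Gamma> \<turnstile> n \<Colon> TNat \<Longrightarrow> S \<parallel> \<Gamma> \<turnstile> TNatInd C z s n \<Colon> TApp C n"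
| ty_Id: "S \<parallel> \<Gamma> \<turnstile> A \<Colon> TUniv u \<Longrightarrow> S \<parallel> \<Gamma> \<turnstile> a \<Colon> A \<Longrightarrow> S \<parallel> \<Gamma> \<turnstile> b \<Colon> A \<Longrightarrow>
    S \<parallel> \<Gamma> \<turnstile> TId A a b \<Colon> TUniv u"
| ty_Refl: "S \<parallel> \<Gamma> \<turnstile> a \<Colon> A \<Longrightarrow> S \<parallel> \<Gamma> \<turnstile> TRefl a \<Colon> TId A a a"
| ty_IdInd:
   "S \<parallel> \<Gamma> \<turnstile> C \<Colon> TPi A (TPi (\<up>A) (TPi (TId (\<up>(\<up>A)) (TVar 1) (TVar 0)) (TUniv w))) \<Longrightarrow>
    S \<parallel> \<Gamma> \<turnstile> d \<Colon> TPi A (TApp (TApp (TApp (\<up>C) (TVar 0)) (TVar 0)) (TRefl (TVar 0))) \<Longrightarrow>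
    S \<parallel> \<Gamma> \<turnstile> a \<Colon> A \<Longrightarrow> S \<parallel> \<Gamma> \<turnstile> b \<Colon> A \<Longrightarrow> S \<parallel> \<Gamma> \<turnstile> p \<Colon> TId A a b \<Longrightarrow>
    S \<parallel> \<Gamma> \<turnstile> TIdInd C d a b p \<Colon> TApp (TApp (TApp C a) b) p"

text \<open>To assert a closed type of the theory is to exhibit a closed term of it.\<close>

definition holds :: "'l::universe_level axiom_name set \<Rightarrow> 'l expr \<Rightarrow> bool" (infix "\<tturnstile>" 40) where
  "S \<tturnstile> A \<longleftrightarrow> (\<exists>t. S \<parallel> [] \<turnstile> t \<Colon> A 0)"


section \<open>Injective types\<close>

definition fiber :: "'l expr \<Rightarrow> 'l expr \<Rightarrow> 'l expr \<Rightarrow> 'l expr \<Rightarrow> 'l expr" where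
  "fiber X Y j y = (\<Sum> x \<Colon> X. ident Y (j \<cdot> x) y)"

definition is_embedding :: "'l expr \<Rightarrow> 'l expr \<Rightarrow> 'l expr \<Rightarrow> 'l expr" where
  "is_embedding X Y j = (\<Prod> y \<Colon> Y. is_prop (fiber X Y j y))"

definition embedding :: "'l expr \<Rightarrow> 'l expr \<Rightarrow> 'l expr" (infix "\<hookrightarrow>" 60) where
  "X \<hookrightarrow> Y = (\<Sum> j \<Colon> X \<leadsto> Y. is_embedding X Y j)"

definition emb_fun :: "'l expr \<Rightarrow> 'l expr \<Rightarrow> 'l expr \<Rightarrow> 'l expr" where
  "emb_fun X Y j = proj1 (X \<leadsto> Y) (is_embedding X Y) j"

definition retract_of :: "'l expr \<Rightarrow> 'l expr \<Rightarrow> 'l expr" where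
  "retract_of A B =
    (\<Sum> s \<Colon> A \<leadsto> B. \<Sum> r \<Colon> B \<leadsto> A. homotopy A A (fun_comp A r s) (id_fun A))"

definition alg_injective :: "'l \<Rightarrow> 'l \<Rightarrow> 'l expr \<Rightarrow> 'l expr" where
  "alg_injective u v D =
    (\<Prod> X \<Colon> universe u. \<Prod> Y \<Colon> universe v. \<Prod> j \<Colon> X \<hookrightarrow> Y. \<Prod> f \<Colon> X \<leadsto> D.
      \<Sum> g \<Colon> Y \<leadsto> D. homotopy X D (fun_comp X g (emb_fun X Y j)) f)"


section \<open>The lifting monad\<close>

definition lifting :: "'l \<Rightarrow> 'l expr \<Rightarrow> 'l expr" where
  "lifting T X = (\<Sum> P \<Colon> universe T. (P \<leadsto> X) \<otimes> is_prop P)"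

definition lift_dom :: "'l \<Rightarrow> 'l expr \<Rightarrow> 'l expr \<Rightarrow> 'l expr" where
  "lift_dom T X l = proj1 (universe T) (\<lambda>P. (P \<leadsto> X) \<otimes> is_prop P) l"

definition lift_rest :: "'l \<Rightarrow> 'l expr \<Rightarrow> 'l expr \<Rightarrow> 'l expr" where
  "lift_rest T X l = proj2 (universe T) (\<lambda>P. (P \<leadsto> X) \<otimes> is_prop P) l"

definition lift_val :: "'l \<Rightarrow> 'l expr \<Rightarrow> 'l expr \<Rightarrow> 'l expr" where
  "lift_val T X l =
    proj1 (lift_dom T X l \<leadsto> X) (\<lambda>_. is_prop (lift_dom T X l)) (lift_rest T X l)"

definition lift_dom_is_prop :: "'l \<Rightarrow> 'l expr \<Rightarrow> 'l expr \<Rightarrow> 'l expr" where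
  "lift_dom_is_prop T X l =
    proj2 (lift_dom T X l \<leadsto> X) (\<lambda>_. is_prop (lift_dom T X l)) (lift_rest T X l)"

definition lift_map :: "'l \<Rightarrow> 'l expr \<Rightarrow> 'l expr \<Rightarrow> 'l expr" where
  "lift_map T X f =
    (\<Lambda> l \<Colon> lifting T X.
      \<langle>lift_dom T X l,
       \<langle>fun_comp (lift_dom T X l) f (lift_val T X l), lift_dom_is_prop T X l\<rangle>\<rangle>)"

definition unit_is_prop :: "'l \<Rightarrow> 'l expr" where
  "unit_is_prop T =
    (\<Lambda> x \<Colon> unit_type T.
      unit_ind (\<Lambda> x \<Colon> unit_type T. \<Prod> y \<Colon> unit_type T. ident (unit_type T) x y)
        (\<Lambda> y \<Colon> unit_type T.
          unit_ind (\<Lambda> y \<Colon> unit_type T. ident (unit_type T) (star T) y) (rfl (star T)) y) x)"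

definition lift_unit :: "'l \<Rightarrow> 'l expr \<Rightarrow> 'l expr" where
  "lift_unit T X = (\<Lambda> x \<Colon> X. \<langle>unit_type T, \<langle>\<Lambda> p \<Colon> unit_type T. x, unit_is_prop T\<rangle>\<rangle>)"

text \<open>
  Subsingletons are closed under sums.  For \<open>(x, y)\<close> and \<open>(x', y')\<close> in \<open>\<Sum> x \<Colon> P. Q x\<close>, induction
  on the identification \<open>i x x'\<close> in \<open>P\<close> reduces to the case where \<open>y\<close> and \<open>y'\<close> lie in the
  same \<open>Q x\<close>, and there one applies the function \<open>y \<mapsto> (x, y)\<close> to \<open>k x y y'\<close>.
\<close>

definition sum_is_prop ::
    "'l expr \<Rightarrow> ('l expr \<Rightarrow> 'l expr) \<Rightarrow> 'l expr \<Rightarrow> ('l expr \<Rightarrow> 'l expr) \<Rightarrow> 'l expr" where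
  "sum_is_prop P Q i k =
    (\<Lambda> s \<Colon> sig_type P Q. \<Lambda> t \<Colon> sig_type P Q.
      sig_ind (\<Lambda> s \<Colon> sig_type P Q. ident (sig_type P Q) s t)
        (\<Lambda> x \<Colon> P. \<Lambda> y \<Colon> Q x.
          sig_ind (\<Lambda> t \<Colon> sig_type P Q. ident (sig_type P Q) \<langle>x, y\<rangle> t)
            (\<Lambda> x' \<Colon> P. \<Lambda> y' \<Colon> Q x'.
              id_ind
                (\<Lambda> x \<Colon> P. \<Lambda> x' \<Colon> P. \<Lambda> e \<Colon> ident P x x'.
                  \<Prod> y \<Colon> Q x. \<Prod> y' \<Colon> Q x'. ident (sig_type P Q) \<langle>x, y\<rangle> \<langle>x', y'\<rangle>)
                (\<Lambda> x \<Colon> P. \<Lambda> y \<Colon> Q x. \<Lambda> y' \<Colon> Q x.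
                  id_ind
                    (\<Lambda> y \<Colon> Q x. \<Lambda> y' \<Colon> Q x. \<Lambda> e \<Colon> ident (Q x) y y'.
                      ident (sig_type P Q) \<langle>x, y\<rangle> \<langle>x, y'\<rangle>)
                    (\<Lambda> y \<Colon> Q x. rfl \<langle>x, y\<rangle>) y y' (k x \<cdot> y \<cdot> y'))
                x x' (i \<cdot> x \<cdot> x') \<cdot> y \<cdot> y')
            t)
        s)"

definition lift_mult :: "'l \<Rightarrow> 'l expr \<Rightarrow> 'l expr" where
  "lift_mult T X =
    (\<Lambda> l \<Colon> lifting T (lifting T X).
      let P = lift_dom T (lifting T X) l;
          \<phi> = lift_val T (lifting T X) l;
          i = lift_dom_is_prop T (lifting T X) l;
          Q = (\<lambda>p. lift_dom T X (\<phi> \<cdot> p))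
      in \<langle>sig_type P Q,
          \<langle>\<Lambda> s \<Colon> sig_type P Q. lift_val T X (\<phi> \<cdot> proj1 P Q s) \<cdot> proj2 P Q s,
           sum_is_prop P Q i (\<lambda>p. lift_dom_is_prop T X (\<phi> \<cdot> p))\<rangle>\<rangle>)"

definition lift_algebra :: "'l \<Rightarrow> 'l expr \<Rightarrow> 'l expr" where
  "lift_algebra T X =
    (\<Sum> \<alpha> \<Colon> lifting T X \<leadsto> X.
      homotopy X X (fun_comp X \<alpha> (lift_unit T X)) (id_fun X) \<otimes>
      homotopy (lifting T (lifting T X)) X
        (fun_comp (lifting T (lifting T X)) \<alpha> (lift_mult T X))
        (fun_comp (lifting T (lifting T X)) \<alpha> (lift_map T (lifting T X) \<alpha>)))"

text \<open>\<open>D\<close> is a retract of the underlying type of an algebra whose underlying type lies in the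
  universe \<open>v\<close>.\<close>

definition retract_of_algebra :: "'l \<Rightarrow> 'l \<Rightarrow> 'l expr \<Rightarrow> 'l expr" where
  "retract_of_algebra T v D = (\<Sum> X \<Colon> universe v. lift_algebra T X \<otimes> retract_of D X)"

end

theory Submission
  imports Defs
begin

text \<open>
  Let \<open>D\<close> be injective.  Extending a map \<open>f : P \<rightarrow> D\<close> on a proposition \<open>P\<close> along the embedding
  \<open>P \<rightarrow> \<one>\<close> yields an element of \<open>D\<close> that agrees with \<open>f\<close> wherever \<open>P\<close> is inhabited.  Applied to the
  partial elements \<open>(P, f, i)\<close> this gives a map from the lifting of \<open>D\<close> back to \<open>D\<close>, and it retracts
  the unit; the lifting of \<open>D\<close> is an algebra.  Conversely, let \<open>D\<close> be a retract of an algebra \<open>X\<close>.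
  A map \<open>f : A \<rightarrow> D\<close> is extended along an embedding \<open>j : A \<rightarrow> B\<close> by joining, for \<open>b : B\<close>, the values
  of \<open>f\<close> on the fiber of \<open>j\<close> over \<open>b\<close> in \<open>X\<close> and mapping the result to \<open>D\<close>; for \<open>b = j a\<close> the fiber
  is inhabited, and the join is the value at \<open>a\<close>.

  Both directions use that partial elements with equivalent domains and matching values are equal.
  By univalence it suffices to treat equal domains, where the claim follows from function
  extensionality and from the uniqueness of proofs that a type is a proposition.
\<close>

section \<open>Substitution calculus\<close>

no_notation up ("\<up>_" [1000] 999)
notation up ("\<up>_" [999] 999)

abbreviation "v0 \<equiv> TVar 0"
abbreviation "v1 \<equiv> TVar (Suc 0)"
abbreviation "v2 \<equiv> TVar (Suc (Suc 0))"
abbreviation "v3 \<equiv> TVar (Suc (Suc (Suc 0)))"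
abbreviation "v4 \<equiv> TVar (Suc (Suc (Suc (Suc 0))))"
abbreviation "v5 \<equiv> TVar (Suc (Suc (Suc (Suc (Suc 0)))))"
abbreviation "v6 \<equiv> TVar (Suc (Suc (Suc (Suc (Suc (Suc 0))))))"
abbreviation "v7 \<equiv> TVar (Suc (Suc (Suc (Suc (Suc (Suc (Suc 0)))))))"

lemma shift_shift: "j \<le> k \<Longrightarrow> shift (Suc k) (shift j t) = shift j (shift k t)"
  by (induction t arbitrary: j k) auto

lemma subst_shift_cancel [simp]: "subst k s (shift k t) = t"
  by (induction t arbitrary: k s) auto

lemma subst_Suc_shift: "j \<le> k \<Longrightarrow> subst (Suc k) (shift j s) (shift j t) = shift j (subst k s t)"
  by (induction t arbitrary: j k s) (auto simp: shift_shift[symmetric])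

lemma shift_subst: "j \<le> k \<Longrightarrow> shift k (subst j s t) = subst j (shift k s) (shift (Suc k) t)"
  by (induction t arbitrary: j k s) (auto simp: shift_shift)

lemma subst_subst:
  "j \<le> k \<Longrightarrow> subst k u (subst j s t) = subst j (subst k u s) (subst (Suc k) (shift j u) t)"
  by (induction t arbitrary: j k s u) (auto simp: subst_Suc_shift[symmetric] shift_shift)

lemma subst_var_shift_Suc [simp]: "subst k (TVar k) (shift (Suc k) t) = t"
  by (induction t arbitrary: k) auto

lemma shift_Suc_up [simp]: "shift (Suc k) (\<up>t) = \<up>(shift k t)"
  by (simp add: shift_shift)

lemma subst_Suc_up [simp]: "subst (Suc k) (\<up>s) (\<up>t) = \<up>(subst k s t)"
  by (simp add: subst_Suc_shift)

section \<open>Conversion is stable under shifting and substitution\<close>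

lemma conv_shift: "s \<equiv>\<^sub>\<beta>\<^sub>\<eta> t \<Longrightarrow> shift k s \<equiv>\<^sub>\<beta>\<^sub>\<eta> shift k t"
proof (induction arbitrary: k rule: conv.induct)
  case (beta_Pi A b a)
  then show ?case using conv.beta_Pi[of "shift k A" "shift (Suc k) b" "shift k a"]
    by (simp add: shift_subst)
next
  case (eta_Pi A f)
  then show ?case using conv.eta_Pi[of "shift k A" "shift k f"] by (simp add: shift_shift)
next
  case (conv_trans s t w)
  then show ?case by (blast intro: conv.conv_trans)
qed (auto intro: conv.intros)

lemma conv_subst_right: "t \<equiv>\<^sub>\<beta>\<^sub>\<eta> t' \<Longrightarrow> subst k s t \<equiv>\<^sub>\<beta>\<^sub>\<eta> subst k s t'"
proof (induction arbitrary: k s rule: conv.induct)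
  case (beta_Pi A b a)
  then show ?case using conv.beta_Pi[of "subst k s A" "subst (Suc k) (shift 0 s) b" "subst k s a"]
    by (simp add: subst_subst)
next
  case (eta_Pi A f)
  then show ?case using conv.eta_Pi[of "subst k s A" "subst k s f"] by (simp add: subst_Suc_shift)
next
  case (conv_trans s t w)
  then show ?case by (blast intro: conv.conv_trans)
qed (auto intro: conv.intros)

lemmas conv_congs =
  conv_refl cong_Pi cong_Lam cong_App cong_Sig cong_Pair cong_SigInd cong_Plus cong_Inl cong_Inr
  cong_PlusInd cong_EmptyInd cong_UnitInd cong_Succ cong_NatInd cong_Id cong_Refl cong_IdInd

lemma conv_subst_left: "s \<equiv>\<^sub>\<beta>\<^sub>\<eta> s' \<Longrightarrow> subst k s t \<equiv>\<^sub>\<beta>\<^sub>\<eta> subst k s' t"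
  by (induction t arbitrary: k s s') (auto intro!: conv_congs simp: conv_shift)

lemma conv_subst: "s \<equiv>\<^sub>\<beta>\<^sub>\<eta> s' \<Longrightarrow> t \<equiv>\<^sub>\<beta>\<^sub>\<eta> t' \<Longrightarrow> subst k s t \<equiv>\<^sub>\<beta>\<^sub>\<eta> subst k s' t'"
  by (blast intro: conv_trans conv_subst_left conv_subst_right)

text \<open>
  Conversion problems are solved by the simplifier in the quotient of raw terms by conversion,
  where the computation rules are equations that can be used for rewriting.
\<close>

quotient_type 'l ctm = "'l tm" / conv
  by (intro equivpI reflpI sympI transpI) (erule (1) conv_trans | erule conv_sym | rule conv_refl)+

lift_definition cvar :: "nat \<Rightarrow> 'l ctm" is TVar .
lift_definition cax :: "'l axiom_name \<Rightarrow> 'l ctm" is TAx .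
lift_definition cuniv :: "'l \<Rightarrow> 'l ctm" is TUniv .
lift_definition cpi :: "'l ctm \<Rightarrow> 'l ctm \<Rightarrow> 'l ctm" is TPi by (rule cong_Pi)
lift_definition clam :: "'l ctm \<Rightarrow> 'l ctm \<Rightarrow> 'l ctm" is TLam by (rule cong_Lam)
lift_definition capp :: "'l ctm \<Rightarrow> 'l ctm \<Rightarrow> 'l ctm" is TApp by (rule cong_App)
lift_definition csig :: "'l ctm \<Rightarrow> 'l ctm \<Rightarrow> 'l ctm" is TSig by (rule cong_Sig)
lift_definition cpair :: "'l ctm \<Rightarrow> 'l ctm \<Rightarrow> 'l ctm" is TPair by (rule cong_Pair)
lift_definition csig_ind :: "'l ctm \<Rightarrow> 'l ctm \<Rightarrow> 'l ctm \<Rightarrow> 'l ctm" is TSigInd by (rule cong_SigInd)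
lift_definition cunit :: "'l \<Rightarrow> 'l ctm" is TUnit .
lift_definition cstar :: "'l \<Rightarrow> 'l ctm" is TStar .
lift_definition cunit_ind :: "'l ctm \<Rightarrow> 'l ctm \<Rightarrow> 'l ctm \<Rightarrow> 'l ctm" is TUnitInd by (rule cong_UnitInd)
lift_definition cident :: "'l ctm \<Rightarrow> 'l ctm \<Rightarrow> 'l ctm \<Rightarrow> 'l ctm" is TId by (rule cong_Id)
lift_definition crefl :: "'l ctm \<Rightarrow> 'l ctm" is TRefl by (rule cong_Refl)
lift_definition cid_ind :: "'l ctm \<Rightarrow> 'l ctm \<Rightarrow> 'l ctm \<Rightarrow> 'l ctm \<Rightarrow> 'l ctm \<Rightarrow> 'l ctm" is TIdInd
  by (rule cong_IdInd)
lift_definition cshift :: "nat \<Rightarrow> 'l ctm \<Rightarrow> 'l ctm" is shift by (rule conv_shift)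
lift_definition csubst :: "nat \<Rightarrow> 'l ctm \<Rightarrow> 'l ctm \<Rightarrow> 'l ctm" is subst by (rule conv_subst)

lemma abs_ctm [simp]:
  "abs_ctm (TVar i) = cvar i"
  "abs_ctm (TAx ax) = cax ax"
  "abs_ctm (TUniv u) = cuniv u"
  "abs_ctm (TPi A B) = cpi (abs_ctm A) (abs_ctm B)"
  "abs_ctm (TLam A B) = clam (abs_ctm A) (abs_ctm B)"
  "abs_ctm (TApp A B) = capp (abs_ctm A) (abs_ctm B)"
  "abs_ctm (TSig A B) = csig (abs_ctm A) (abs_ctm B)"
  "abs_ctm (TPair A B) = cpair (abs_ctm A) (abs_ctm B)"
  "abs_ctm (TSigInd C d p) = csig_ind (abs_ctm C) (abs_ctm d) (abs_ctm p)"
  "abs_ctm (TUnit u) = cunit u"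
  "abs_ctm (TStar u) = cstar u"
  "abs_ctm (TUnitInd C d p) = cunit_ind (abs_ctm C) (abs_ctm d) (abs_ctm p)"
  "abs_ctm (TId A a b) = cident (abs_ctm A) (abs_ctm a) (abs_ctm b)"
  "abs_ctm (TRefl a) = crefl (abs_ctm a)"
  "abs_ctm (TIdInd C d a b p) =
    cid_ind (abs_ctm C) (abs_ctm d) (abs_ctm a) (abs_ctm b) (abs_ctm p)"
  "abs_ctm (shift k t) = cshift k (abs_ctm t)"
  "abs_ctm (subst k s t) = csubst k (abs_ctm s) (abs_ctm t)"
  by (simp_all add: cvar.abs_eq cax.abs_eq cuniv.abs_eq cpi.abs_eq clam.abs_eq capp.abs_eq
      csig.abs_eq cpair.abs_eq csig_ind.abs_eq cunit.abs_eq cstar.abs_eq cunit_ind.abs_eq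
      cident.abs_eq crefl.abs_eq cid_ind.abs_eq cshift.abs_eq csubst.abs_eq)

lemma conv_iff: "s \<equiv>\<^sub>\<beta>\<^sub>\<eta> t \<longleftrightarrow> abs_ctm s = abs_ctm t"
  by (simp add: ctm.abs_eq_iff)

lemma cshift_simps [simp]:
  "cshift k (cvar i) = cvar (if i < k then i else Suc i)"
  "cshift k (cax ax) = cax ax"
  "cshift k (cuniv u) = cuniv u"
  "cshift k (cpi A B) = cpi (cshift k A) (cshift (Suc k) B)"
  "cshift k (clam A B) = clam (cshift k A) (cshift (Suc k) B)"
  "cshift k (capp a b) = capp (cshift k a) (cshift k b)"
  "cshift k (csig A B) = csig (cshift k A) (cshift (Suc k) B)"
  "cshift k (cpair a b) = cpair (cshift k a) (cshift k b)"
  "cshift k (csig_ind a b c) = csig_ind (cshift k a) (cshift k b) (cshift k c)"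
  "cshift k (cunit u) = cunit u"
  "cshift k (cstar u) = cstar u"
  "cshift k (cunit_ind a b c) = cunit_ind (cshift k a) (cshift k b) (cshift k c)"
  "cshift k (cident a b c) = cident (cshift k a) (cshift k b) (cshift k c)"
  "cshift k (crefl a) = crefl (cshift k a)"
  "cshift k (cid_ind a b c d e) =
    cid_ind (cshift k a) (cshift k b) (cshift k c) (cshift k d) (cshift k e)"
  by (transfer; simp add: conv_refl)+

lemma csubst_simps [simp]:
  "csubst k s (cvar i) = (if i < k then cvar i else if i = k then s else cvar (i - 1))"
  "csubst k s (cax ax) = cax ax"
  "csubst k s (cuniv u) = cuniv u"
  "csubst k s (cpi A B) = cpi (csubst k s A) (csubst (Suc k) (cshift 0 s) B)"
  "csubst k s (clam A B) = clam (csubst k s A) (csubst (Suc k) (cshift 0 s) B)"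
  "csubst k s (capp a b) = capp (csubst k s a) (csubst k s b)"
  "csubst k s (csig A B) = csig (csubst k s A) (csubst (Suc k) (cshift 0 s) B)"
  "csubst k s (cpair a b) = cpair (csubst k s a) (csubst k s b)"
  "csubst k s (csig_ind a b c) = csig_ind (csubst k s a) (csubst k s b) (csubst k s c)"
  "csubst k s (cunit u) = cunit u"
  "csubst k s (cstar u) = cstar u"
  "csubst k s (cunit_ind a b c) = cunit_ind (csubst k s a) (csubst k s b) (csubst k s c)"
  "csubst k s (cident a b c) = cident (csubst k s a) (csubst k s b) (csubst k s c)"
  "csubst k s (crefl a) = crefl (csubst k s a)"
  "csubst k s (cid_ind a b c d e) =
    cid_ind (csubst k s a) (csubst k s b) (csubst k s c) (csubst k s d) (csubst k s e)"
  by (transfer; simp add: conv_refl)+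

lemma ctm_computation [simp]:
  "capp (clam A b) a = csubst 0 a b"
  "csig_ind C d (cpair a b) = capp (capp d a) b"
  "cunit_ind C c (cstar u) = c"
  "cid_ind C d a a (crefl a) = capp d a"
  by (transfer; rule beta_Pi beta_Sig beta_Unit beta_Id)+

lemma ctm_eta: "clam A (capp (cshift 0 f) (cvar 0)) = f"
  by (transfer, rule eta_Pi)

lemma cshift_cshift: "j \<le> k \<Longrightarrow> cshift (Suc k) (cshift j t) = cshift j (cshift k t)"
  by (transfer, simp add: shift_shift conv_refl)

lemma csubst_cshift_cancel [simp]: "csubst k s (cshift k t) = t"
  by (transfer, simp add: conv_refl)

lemma csubst_Suc_cshift:
  "j \<le> k \<Longrightarrow> csubst (Suc k) (cshift j s) (cshift j t) = cshift j (csubst k s t)"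
  by (transfer, simp add: subst_Suc_shift conv_refl)

lemma cshift_csubst:
  "j \<le> k \<Longrightarrow> cshift k (csubst j s t) = csubst j (cshift k s) (cshift (Suc k) t)"
  by (transfer, simp add: shift_subst conv_refl)

lemma csubst_csubst:
  "j \<le> k \<Longrightarrow> csubst k u (csubst j s t) = csubst j (csubst k u s) (csubst (Suc k) (cshift j u) t)"
  by (transfer, simp add: subst_subst conv_refl)

lemma csubst_var_cshift_Suc [simp]: "csubst k (cvar k) (cshift (Suc k) t) = t"
  by (transfer, simp add: conv_refl)

section \<open>Weakening and substitution for the typing judgement\<close>

fun lookup :: "'l tm list \<Rightarrow> nat \<Rightarrow> 'l tm" where
  "lookup (A # \<Gamma>) 0 = \<up>A"
| "lookup (A # \<Gamma>) (Suc i) = \<up>(lookup \<Gamma> i)"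
| "lookup [] i = undefined"

lemma lookup_eq: "i < length \<Gamma> \<Longrightarrow> lookup \<Gamma> i = (shift 0 ^^ Suc i) (\<Gamma> ! i)"
  by (induction \<Gamma> i rule: lookup.induct) auto

lemma ty_lookup: "ctx S \<Gamma> \<Longrightarrow> i < length \<Gamma> \<Longrightarrow> S \<parallel> \<Gamma> \<turnstile> TVar i \<Colon> lookup \<Gamma> i"
  by (simp only: lookup_eq ty_Var)

lemma axiom_type_closed: "shift k (axiom_type c 0) = axiom_type c 0"
  "subst k s (axiom_type c 0) = axiom_type c 0"
  by (cases c; simp add: univalence_def universe_def pi_type_def is_equiv_def ident_def
    bound_var_def
      id_to_equiv_def lam_def equivalence_def sig_type_def arr_def homotopy_def fun_comp_def app_def
      id_fun_def id_equiv_def id_ind_def prod_type_def pair_of_def rfl_def is_prop_def axm_def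
      prop_resizing_def)+

text \<open>
  Weakening and substitution are proved at once, for an operation \<open>F i\<close> on raw terms that acts
  under a binder as \<open>F (L i)\<close>; \<open>M i \<Gamma> \<Delta>\<close> says that \<open>F i\<close> maps the variables of \<open>\<Gamma>\<close> to
  terms over \<open>\<Delta>\<close>.
\<close>

locale context_morphism =
  fixes S :: "'l::universe_level axiom_name set"
    and F :: "'i \<Rightarrow> 'l tm \<Rightarrow> 'l tm" and L :: "'i \<Rightarrow> 'i"
    and M :: "'i \<Rightarrow> 'l tm list \<Rightarrow> 'l tm list \<Rightarrow> bool"
  assumes F_simps [simp]:
    "F i (TAx c) = TAx c"
    "F i (TUniv u) = TUniv u"
    "F i (TPi A B) = TPi (F i A) (F (L i) B)"
    "F i (TLam A b) = TLam (F i A) (F (L i) b)"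
    "F i (TApp f a) = TApp (F i f) (F i a)"
    "F i (TSig A B) = TSig (F i A) (F (L i) B)"
    "F i (TPair a b) = TPair (F i a) (F i b)"
    "F i (TSigInd C d p) = TSigInd (F i C) (F i d) (F i p)"
    "F i (TPlus A B) = TPlus (F i A) (F i B)"
    "F i (TInl a) = TInl (F i a)"
    "F i (TInr b) = TInr (F i b)"
    "F i (TPlusInd C l r x) = TPlusInd (F i C) (F i l) (F i r) (F i x)"
    "F i (TEmpty u) = TEmpty u"
    "F i (TEmptyInd C e) = TEmptyInd (F i C) (F i e)"
    "F i (TUnit u) = TUnit u"
    "F i (TStar u) = TStar u"
    "F i (TUnitInd C d p) = TUnitInd (F i C) (F i d) (F i p)"
    "F i TNat = TNat"
    "F i TZero = TZero"
    "F i (TSucc n) = TSucc (F i n)"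
    "F i (TNatInd C z s n) = TNatInd (F i C) (F i z) (F i s) (F i n)"
    "F i (TId A a b) = TId (F i A) (F i a) (F i b)"
    "F i (TRefl a) = TRefl (F i a)"
    "F i (TIdInd C d a b p) = TIdInd (F i C) (F i d) (F i a) (F i b) (F i p)"
    and F_bound [simp]: "F (L i) v0 = v0" "F (L (L i)) v1 = v1"
    and F_up [simp]: "F (L i) (\<up>t) = \<up>(F i t)"
    and F_subst: "F i (subst 0 a t) = subst 0 (F i a) (F (L i) t)"
    and F_axiom_type [simp]: "F i (axiom_type c 0) = axiom_type c 0"
    and F_conv: "t \<equiv>\<^sub>\<beta>\<^sub>\<eta> t' \<Longrightarrow> F i t \<equiv>\<^sub>\<beta>\<^sub>\<eta> F i t'"
    and M_ctx: "M i \<Gamma> \<Delta> \<Longrightarrow> ctx S \<Delta>"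
    and M_var: "M i \<Gamma> \<Delta> \<Longrightarrow> j < length \<Gamma> \<Longrightarrow> S \<parallel> \<Delta> \<turnstile> F i (TVar j) \<Colon> F i (lookup \<Gamma> j)"
    and M_binder: "M i \<Gamma> \<Delta> \<Longrightarrow> S \<parallel> \<Delta> \<turnstile> F i A \<Colon> TUniv u \<Longrightarrow> M (L i) (A # \<Gamma>) (F i A # \<Delta>)"
begin

definition stable :: "'l tm list \<Rightarrow> 'l tm \<Rightarrow> 'l tm \<Rightarrow> bool" where
  "stable \<Gamma> t A \<longleftrightarrow> (\<forall>i \<Delta>. M i \<Gamma> \<Delta> \<longrightarrow> S \<parallel> \<Delta> \<turnstile> F i t \<Colon> F i A)"

text \<open>
  The induction also has to carry stability of the types in the context, because the premise of
  \<open>ty_Lam\<close> does not contain a derivation for the domain.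
\<close>

primrec stable_ctx :: "'l tm list \<Rightarrow> bool" where
  "stable_ctx [] = True"
| "stable_ctx (A # \<Gamma>) \<longleftrightarrow> (\<exists>u. stable \<Gamma> A (TUniv u)) \<and> stable_ctx \<Gamma>"

lemma stableI: "(\<And>i \<Delta>. M i \<Gamma> \<Delta> \<Longrightarrow> S \<parallel> \<Delta> \<turnstile> F i t \<Colon> F i A) \<Longrightarrow> stable \<Gamma> t A"
  by (auto simp: stable_def)

lemma stableD: "stable \<Gamma> t A \<Longrightarrow> M i \<Gamma> \<Delta> \<Longrightarrow> S \<parallel> \<Delta> \<turnstile> F i t \<Colon> F i A"
  by (auto simp: stable_def)

lemma stable_binder:
  assumes "stable (A # \<Gamma>) b B" "stable_ctx (A # \<Gamma>)" "M i \<Gamma> \<Delta>"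
  shows "S \<parallel> F i A # \<Delta> \<turnstile> F (L i) b \<Colon> F (L i) B"
proof -
  from assms(2) obtain u where "stable \<Gamma> A (TUniv u)" by auto
  from stableD[OF this assms(3)] have "S \<parallel> \<Delta> \<turnstile> F i A \<Colon> TUniv u" by simp
  from stableD[OF assms(1) M_binder[OF assms(3) this]] show ?thesis .
qed

lemma stability:
  "ctx S \<Gamma> \<Longrightarrow> stable_ctx \<Gamma>"
  "S \<parallel> \<Gamma> \<turnstile> t \<Colon> A \<Longrightarrow> stable_ctx \<Gamma> \<and> stable \<Gamma> t A"
proof (induction rule: ctx_typing.inducts)
  case (ty_Var \<Gamma> x)
  have "stable \<Gamma> (TVar x) (lookup \<Gamma> x)" by (rule stableI) (rule M_var[OF _ ty_Var(3)])
  with ty_Var show ?case by (simp only: lookup_eq)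
next
  case (ty_conv \<Gamma> t A B u)
  show ?case
  proof (intro conjI stableI)
    fix i \<Delta> assume w: "M i \<Gamma> \<Delta>"
    show "S \<parallel> \<Delta> \<turnstile> F i t \<Colon> F i B"
      by (rule ctx_typing.ty_conv[OF stableD[OF conjunct2[OF ty_conv(2)] w, simplified]
        stableD[OF conjunct2[OF ty_conv(4)] w, simplified]
          F_conv[OF ty_conv(5)]])
  qed (use ty_conv in auto)
next
  case (ty_Pi \<Gamma> A u B v)
  show ?case
  proof (intro conjI stableI)
    fix i \<Delta> assume w: "M i \<Gamma> \<Delta>"
    from ctx_typing.ty_Pi[OF stableD[OF conjunct2[OF ty_Pi(2)] w, simplified]
      stable_binder[OF conjunct2[OF ty_Pi(4)] conjunct1[OF ty_Pi(4)] w, simplified]]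
    show "S \<parallel> \<Delta> \<turnstile> F i (TPi A B) \<Colon> F i (TUniv (u \<squnion> v))" by simp
  qed (use ty_Pi in auto)
next
  case (ty_Sig \<Gamma> A u B v)
  show ?case
  proof (intro conjI stableI)
    fix i \<Delta> assume w: "M i \<Gamma> \<Delta>"
    from ctx_typing.ty_Sig[OF stableD[OF conjunct2[OF ty_Sig(2)] w, simplified]
      stable_binder[OF conjunct2[OF ty_Sig(4)] conjunct1[OF ty_Sig(4)] w, simplified]]
    show "S \<parallel> \<Delta> \<turnstile> F i (TSig A B) \<Colon> F i (TUniv (u \<squnion> v))" by simp
  qed (use ty_Sig in auto)
next
  case (ty_Lam A \<Gamma> b B)
  show ?case
  proof (intro conjI stableI)
    fix i \<Delta> assume w: "M i \<Gamma> \<Delta>"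
    from stable_binder[OF conjunct2[OF ty_Lam(2)] conjunct1[OF ty_Lam(2)] w, simplified]
    show "S \<parallel> \<Delta> \<turnstile> F i (TLam A b) \<Colon> F i (TPi A B)" by (simp add: ctx_typing.ty_Lam)
  qed (use ty_Lam in auto)
next
  case (ty_App \<Gamma> f A B a)
  show ?case
  proof (intro conjI stableI)
    fix i \<Delta> assume w: "M i \<Gamma> \<Delta>"
    from ctx_typing.ty_App[OF stableD[OF conjunct2[OF ty_App(2)] w, simplified]
      stableD[OF conjunct2[OF ty_App(4)] w, simplified]]
    show "S \<parallel> \<Delta> \<turnstile> F i (TApp f a) \<Colon> F i (subst 0 a B)"
      by (simp add: F_subst)
  qed (use ty_App in auto)
next
  case (ty_Pair \<Gamma> a A B v b)
  show ?case
  proof (intro conjI stableI)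
    fix i \<Delta> assume w: "M i \<Gamma> \<Delta>"
    note B = stable_binder[OF conjunct2[OF ty_Pair(4)] conjunct1[OF ty_Pair(4)] w, simplified]
    from ctx_typing.ty_Pair[OF stableD[OF conjunct2[OF ty_Pair(2)] w, simplified] B]
      stableD[OF conjunct2[OF ty_Pair(6)] w, simplified]
    show "S \<parallel> \<Delta> \<turnstile> F i (TPair a b) \<Colon> F i (TSig A B)"
      by (simp add: F_subst)
  qed (use ty_Pair in auto)
next
  case (ty_SigInd \<Gamma> C A B w d p)
  show ?case
  proof (intro conjI stableI)
    fix i \<Delta> assume w': "M i \<Gamma> \<Delta>"
    from ctx_typing.ty_SigInd[unfolded One_nat_def, OF
      stableD[OF conjunct2[OF ty_SigInd(2)] w', simplified]
      stableD[OF conjunct2[OF ty_SigInd(4)] w', simplified]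
      stableD[OF conjunct2[OF ty_SigInd(6)] w', simplified]]
    show "S \<parallel> \<Delta> \<turnstile> F i (TSigInd C d p) \<Colon> F i (TApp C p)"
      by (simp add: F_subst)
  qed (use ty_SigInd in auto)
next
  case (ty_PlusInd \<Gamma> C A B w l r s)
  show ?case
  proof (intro conjI stableI)
    fix i \<Delta> assume w': "M i \<Gamma> \<Delta>"
    from ctx_typing.ty_PlusInd[unfolded One_nat_def, OF
      stableD[OF conjunct2[OF ty_PlusInd(2)] w', simplified]
      stableD[OF conjunct2[OF ty_PlusInd(4)] w', simplified]
      stableD[OF conjunct2[OF ty_PlusInd(6)] w', simplified]
      stableD[OF conjunct2[OF ty_PlusInd(8)] w', simplified]]
    show "S \<parallel> \<Delta> \<turnstile> F i (TPlusInd C l r s) \<Colon> F i (TApp C s)"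
      by (simp add: F_subst)
  qed (use ty_PlusInd in auto)
next
  case (ty_NatInd \<Gamma> C w z s n)
  show ?case
  proof (intro conjI stableI)
    fix i \<Delta> assume w': "M i \<Gamma> \<Delta>"
    from ctx_typing.ty_NatInd[unfolded One_nat_def, OF
      stableD[OF conjunct2[OF ty_NatInd(2)] w', simplified]
      stableD[OF conjunct2[OF ty_NatInd(4)] w', simplified]
      stableD[OF conjunct2[OF ty_NatInd(6)] w', simplified]
      stableD[OF conjunct2[OF ty_NatInd(8)] w', simplified]]
    show "S \<parallel> \<Delta> \<turnstile> F i (TNatInd C z s n) \<Colon> F i (TApp C n)"
      by (simp add: F_subst)
  qed (use ty_NatInd in auto)
next
  case (ty_IdInd \<Gamma> C A w d a b p)
  show ?case
  proof (intro conjI stableI)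
    fix i \<Delta> assume w': "M i \<Gamma> \<Delta>"
    from ctx_typing.ty_IdInd[unfolded One_nat_def, OF
      stableD[OF conjunct2[OF ty_IdInd(2)] w', simplified]
      stableD[OF conjunct2[OF ty_IdInd(4)] w', simplified]
      stableD[OF conjunct2[OF ty_IdInd(6)] w', simplified]
      stableD[OF conjunct2[OF ty_IdInd(8)] w', simplified]
      stableD[OF conjunct2[OF ty_IdInd(10)] w', simplified]]
    show "S \<parallel> \<Delta> \<turnstile> F i (TIdInd C d a b p) \<Colon> F i (TApp (TApp (TApp C a) b) p)"
      by (simp add: F_subst)
  qed (use ty_IdInd in auto)
qed (auto simp: stable_def dest: M_ctx intro: ctx_Nil ty_Ax ty_Univ ty_Plus ty_Empty ty_Unit ty_Star
      ty_Nat ty_Zero ty_Succ ty_Id ty_Refl,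
    (blast intro: ty_Inl ty_Inr ty_EmptyInd ty_UnitInd)+)

lemma typing_map: "S \<parallel> \<Gamma> \<turnstile> t \<Colon> A \<Longrightarrow> M i \<Gamma> \<Delta> \<Longrightarrow> S \<parallel> \<Delta> \<turnstile> F i t \<Colon> F i A"
  using stability(2) stableD by blast

end

definition weakens ::
    "'l::universe_level axiom_name set \<Rightarrow> nat \<Rightarrow> 'l tm list \<Rightarrow> 'l tm list \<Rightarrow> bool" where
  "weakens S k \<Gamma> \<Delta> \<longleftrightarrow> ctx S \<Delta> \<and> (\<forall>i<length \<Gamma>.
    (if i < k then i else Suc i) < length \<Delta> \<and>
    lookup \<Delta> (if i < k then i else Suc i) = shift k (lookup \<Gamma> i))"

interpretation weakening: context_morphism S shift Suc "weakens S"
  for S :: "'l::universe_level axiom_name set"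
proof (unfold_locales, goal_cases)
  case (32 i \<Gamma> \<Delta> x)
  then show ?case using ty_lookup[of S \<Delta> "if x < i then x else Suc x"]
    by (auto simp: weakens_def split: if_splits)
next
  case (33 k \<Gamma> \<Delta> A u)
  show ?case unfolding weakens_def
  proof (intro conjI allI impI)
    show "ctx S (shift k A # \<Delta>)" using 33(2) by (rule ctx_Cons)
  next
    fix i assume i: "i < length (A # \<Gamma>)"
    then show "(if i < Suc k then i else Suc i) < length (shift k A # \<Delta>)"
      using 33(1) by (cases i) (auto simp: weakens_def split: if_splits)
    show "lookup (shift k A # \<Delta>) (if i < Suc k then i else Suc i) = shift (Suc k)
      (lookup (A # \<Gamma>) i)"
      using 33(1) i by (cases i) (auto simp: weakens_def)
  qed
qed (auto simp: shift_subst axiom_type_closed conv_shift weakens_def)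

lemma weaken:
  assumes "S \<parallel> \<Gamma> \<turnstile> t \<Colon> A" "ctx S (B # \<Gamma>)"
  shows "S \<parallel> B # \<Gamma> \<turnstile> \<up>t \<Colon> \<up>A"
  by (rule weakening.typing_map[OF assms(1)]) (simp add: weakens_def assms(2))

definition substitutes ::
    "'l::universe_level axiom_name set \<Rightarrow> nat \<times> 'l tm \<Rightarrow> 'l tm list \<Rightarrow> 'l tm list \<Rightarrow> bool" where
  "substitutes S = (\<lambda>(k, s) \<Gamma> \<Delta>. ctx S \<Delta> \<and>
    (\<forall>i<length \<Gamma>. S \<parallel> \<Delta> \<turnstile> subst k s (TVar i) \<Colon> subst k s (lookup \<Gamma> i)))"

interpretation substitution:
  context_morphism S "\<lambda>(k, s). subst k s" "\<lambda>(k, s). (Suc k, \<up>s)" "substitutes S"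
  for S :: "'l::universe_level axiom_name set"
proof (unfold_locales, goal_cases)
  case (33 ks \<Gamma> \<Delta> A u)
  obtain k s where ks: "ks = (k, s)" by force
  have c: "ctx S (subst k s A # \<Delta>)" using 33(2) ks by (auto intro: ctx_Cons)
  have "S \<parallel> subst k s A # \<Delta> \<turnstile> subst (Suc k) (\<up>s) (TVar i) \<Colon> subst (Suc k) (\<up>s) (lookup (A # \<Gamma>) i)"
    if "i < length (A # \<Gamma>)" for i
  proof (cases i)
    case 0
    then show ?thesis using ty_lookup[OF c, of 0] by simp
  next
    case (Suc j)
    with that 33(1) ks have "S \<parallel> \<Delta> \<turnstile> subst k s (TVar j) \<Colon> subst k s (lookup \<Gamma> j)"
      by (auto simp: substitutes_def)
    from weaken[OF this c] Suc show ?thesis by (auto split: if_splits)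
  qed
  with c ks show ?case by (auto simp: substitutes_def)
qed (auto simp: subst_subst axiom_type_closed conv_subst_right substitutes_def)

section \<open>Derived typing rules\<close>

lemma shift_up_funpow: "shift k ((shift 0 ^^ k) t) = (shift 0 ^^ Suc k) t"
  by (induction k) auto

lemma subst_up_funpow: "subst k s ((shift 0 ^^ Suc k) t) = (shift 0 ^^ k) t"
  by (metis shift_up_funpow subst_shift_cancel)

lemma subst_up_simps [simp]:
  "subst (Suc 0) s (\<up>\<up>t) = \<up>t"
  "subst (Suc (Suc 0)) s (\<up>\<up>\<up>t) = \<up>\<up>t"
  "subst (Suc (Suc (Suc 0))) s (\<up>\<up>\<up>\<up>t) = \<up>\<up>\<up>t"
  "subst (Suc (Suc (Suc (Suc 0)))) s (\<up>\<up>\<up>\<up>\<up>t) = \<up>\<up>\<up>\<up>t"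
  "subst (Suc (Suc (Suc (Suc (Suc 0))))) s (\<up>\<up>\<up>\<up>\<up>\<up>t) = \<up>\<up>\<up>\<up>\<up>t"
  "subst (Suc (Suc (Suc (Suc (Suc (Suc 0)))))) s (\<up>\<up>\<up>\<up>\<up>\<up>\<up>t) = \<up>\<up>\<up>\<up>\<up>\<up>t"
  "subst (Suc (Suc (Suc (Suc (Suc (Suc (Suc 0))))))) s (\<up>\<up>\<up>\<up>\<up>\<up>\<up>\<up>t) = \<up>\<up>\<up>\<up>\<up>\<up>\<up>t"
  using subst_up_funpow[of "Suc 0" s t] subst_up_funpow[of "Suc (Suc 0)" s t]
    subst_up_funpow[of "Suc (Suc (Suc 0))" s t] subst_up_funpow[of "Suc (Suc (Suc (Suc 0)))" s t]
    subst_up_funpow[of "Suc (Suc (Suc (Suc (Suc 0))))" s t]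
    subst_up_funpow[of "Suc (Suc (Suc (Suc (Suc (Suc 0)))))" s t]
    subst_up_funpow[of "Suc (Suc (Suc (Suc (Suc (Suc (Suc 0))))))" s t]
  by simp_all

lemma subst_var_shift_shift [simp]:
  "subst k (TVar (Suc k)) (shift (Suc k) (shift (Suc k) t)) = shift k t"
  by (induction t arbitrary: k) auto

lemma cshift_up [simp]: "cshift (Suc k) (cshift 0 t) = cshift 0 (cshift k t)"
  by (simp add: cshift_cshift)

lemma csubst_up [simp]: "csubst (Suc k) (cshift 0 s) (cshift 0 t) = cshift 0 (csubst k s t)"
  by (simp add: csubst_Suc_cshift)

lemma csubst_up_simps [simp]:
  "csubst (Suc 0) s (cshift 0 (cshift 0 t)) = cshift 0 t"
  "csubst (Suc (Suc 0)) s (cshift 0 (cshift 0 (cshift 0 t))) = cshift 0 (cshift 0 t)"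
  "csubst (Suc (Suc (Suc 0))) s (cshift 0 (cshift 0 (cshift 0 (cshift 0 t)))) =
    cshift 0 (cshift 0 (cshift 0 t))"
  "csubst (Suc (Suc (Suc (Suc 0)))) s (cshift 0 (cshift 0 (cshift 0 (cshift 0 (cshift 0 t))))) =
    cshift 0 (cshift 0 (cshift 0 (cshift 0 t)))"
  "csubst (Suc (Suc (Suc (Suc (Suc 0))))) s
     (cshift 0 (cshift 0 (cshift 0 (cshift 0 (cshift 0 (cshift 0 t)))))) =
    cshift 0 (cshift 0 (cshift 0 (cshift 0 (cshift 0 t))))"
  by (transfer; simp add: conv_refl)+

text \<open>
  The \<open>_eq\<close> rules below carry their types up to an equation, so that substitutions are normalised
  before types are compared.
\<close>

locale type_theory =
  fixes S :: "'l::universe_level axiom_name set"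
begin

abbreviation typed :: "'l tm list \<Rightarrow> 'l tm \<Rightarrow> 'l tm \<Rightarrow> bool" ("_ \<turnstile> _ \<Colon> _" [51, 51, 51] 50) where
  "\<Gamma> \<turnstile> t \<Colon> A \<equiv> S \<parallel> \<Gamma> \<turnstile> t \<Colon> A"

lemma weaken_eq: "\<Gamma> \<turnstile> t \<Colon> A \<Longrightarrow> ctx S (B # \<Gamma>) \<Longrightarrow> \<up>A = C \<Longrightarrow> B # \<Gamma> \<turnstile> \<up>t \<Colon> C"
  using weaken by blast

lemma weaken_1_eq:
  assumes "A # \<Gamma> \<turnstile> t \<Colon> B" "\<Gamma> \<turnstile> A \<Colon> TUniv u" "ctx S (D # \<Gamma>)" "shift (Suc 0) B = C"
  shows "\<up>A # D # \<Gamma> \<turnstile> shift (Suc 0) t \<Colon> C"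
  unfolding assms(4)[symmetric]
proof (rule weakening.typing_map[OF assms(1)], rule weakening.M_binder)
  show "weakens S 0 \<Gamma> (D # \<Gamma>)" using assms(3) by (simp add: weakens_def)
  show "D # \<Gamma> \<turnstile> \<up>A \<Colon> TUniv u" using weaken[OF assms(2,3)] by simp
qed

lemma Var_eq: "ctx S \<Gamma> \<Longrightarrow> i < length \<Gamma> \<Longrightarrow> lookup \<Gamma> i = C \<Longrightarrow> \<Gamma> \<turnstile> TVar i \<Colon> C"
  using ty_lookup by blast

lemma Univ_eq: "ctx S \<Gamma> \<Longrightarrow> TUniv (next_level u) = C \<Longrightarrow> \<Gamma> \<turnstile> TUniv u \<Colon> C"
  using ty_Univ by blast

lemma Pi_eq: "\<Gamma> \<turnstile> A \<Colon> TUniv u \<Longrightarrow> (ctx S (A # \<Gamma>) \<Longrightarrow> A # \<Gamma> \<turnstile> B \<Colon> TUniv v) \<Longrightarrow>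
    TUniv (u \<squnion> v) = C \<Longrightarrow> \<Gamma> \<turnstile> TPi A B \<Colon> C"
  using ty_Pi ctx_Cons by blast

lemma Lam_eq: "\<Gamma> \<turnstile> A \<Colon> TUniv u \<Longrightarrow> (ctx S (A # \<Gamma>) \<Longrightarrow> A # \<Gamma> \<turnstile> b \<Colon> B) \<Longrightarrow>
    \<Gamma> \<turnstile> TLam A b \<Colon> TPi A B"
  using ty_Lam ctx_Cons by blast

lemma App_eq: "\<Gamma> \<turnstile> f \<Colon> TPi A B \<Longrightarrow> \<Gamma> \<turnstile> a \<Colon> A \<Longrightarrow> subst 0 a B = C \<Longrightarrow> \<Gamma> \<turnstile> TApp f a \<Colon> C"
  using ty_App by blast

lemma Sig_eq: "\<Gamma> \<turnstile> A \<Colon> TUniv u \<Longrightarrow> (ctx S (A # \<Gamma>) \<Longrightarrow> A # \<Gamma> \<turnstile> B \<Colon> TUniv v) \<Longrightarrow>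
    TUniv (u \<squnion> v) = C \<Longrightarrow> \<Gamma> \<turnstile> TSig A B \<Colon> C"
  using ty_Sig ctx_Cons by blast

lemma Pair_eq: "\<Gamma> \<turnstile> A \<Colon> TUniv u \<Longrightarrow> (ctx S (A # \<Gamma>) \<Longrightarrow> A # \<Gamma> \<turnstile> B \<Colon> TUniv v) \<Longrightarrow>
    \<Gamma> \<turnstile> a \<Colon> A \<Longrightarrow> subst 0 a B = B' \<Longrightarrow> \<Gamma> \<turnstile> b \<Colon> B' \<Longrightarrow> \<Gamma> \<turnstile> TPair a b \<Colon> TSig A B"
  using ty_Pair ctx_Cons by blast

lemma Unit_eq: "ctx S \<Gamma> \<Longrightarrow> TUniv u = C \<Longrightarrow> \<Gamma> \<turnstile> TUnit u \<Colon> C"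
  using ty_Unit by blast

lemma Id_eq: "\<Gamma> \<turnstile> A \<Colon> TUniv u \<Longrightarrow> \<Gamma> \<turnstile> a \<Colon> A \<Longrightarrow> \<Gamma> \<turnstile> b \<Colon> A \<Longrightarrow> TUniv u = C \<Longrightarrow>
    \<Gamma> \<turnstile> TId A a b \<Colon> C"
  using ty_Id by blast

lemmas ty_intros = weaken_eq weaken_1_eq Var_eq Univ_eq Pi_eq Lam_eq App_eq Sig_eq Pair_eq Unit_eq
  ty_Star
  Id_eq ty_Refl

lemma ty_convert: "\<Gamma> \<turnstile> t \<Colon> A \<Longrightarrow> \<Gamma> \<turnstile> B \<Colon> TUniv u \<Longrightarrow> abs_ctm A = abs_ctm B \<Longrightarrow> \<Gamma> \<turnstile> t \<Colon> B"
  using ty_conv conv_iff by blast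

lemma substitutes_0: "\<Gamma> \<turnstile> a \<Colon> A \<Longrightarrow> ctx S \<Gamma> \<Longrightarrow> substitutes S (0, a) (A # \<Gamma>) \<Gamma>"
  using ty_lookup by (auto simp: substitutes_def less_Suc_eq_0_disj)

lemma substitute:
  assumes "A # \<Gamma> \<turnstile> t \<Colon> B" "\<Gamma> \<turnstile> a \<Colon> A" "ctx S \<Gamma>"
  shows "\<Gamma> \<turnstile> subst 0 a t \<Colon> subst 0 a B"
  using substitution.typing_map[OF assms(1) substitutes_0[OF assms(2,3)]] by simp

lemma substitute_1:
  assumes "B # A # \<Gamma> \<turnstile> t \<Colon> C" "A # \<Gamma> \<turnstile> B \<Colon> TUniv v" "\<Gamma> \<turnstile> a \<Colon> A" "ctx S \<Gamma>"
  shows "subst 0 a B # \<Gamma> \<turnstile> subst (Suc 0) (\<up>a) t \<Colon> subst (Suc 0) (\<up>a) C"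
  using substitution.typing_map[OF assms(1)
      substitution.M_binder[OF substitutes_0[OF assms(3,4)], of B v]]
    substitute[OF assms(2-4)] by simp

lemma substitute_2:
  assumes "C # B # A # \<Gamma> \<turnstile> t \<Colon> D" "B # A # \<Gamma> \<turnstile> C \<Colon> TUniv w"
    "A # \<Gamma> \<turnstile> B \<Colon> TUniv v" "\<Gamma> \<turnstile> a \<Colon> A" "ctx S \<Gamma>"
  shows "subst (Suc 0) (\<up>a) C # subst 0 a B # \<Gamma> \<turnstile>
    subst (Suc (Suc 0)) (\<up>\<up>a) t \<Colon> subst (Suc (Suc 0)) (\<up>\<up>a) D"
  using substitution.typing_map[OF assms(1)
      substitution.M_binder[OF substitution.M_binder[OF substitutes_0[OF assms(4,5)], of B v], of C
        w]]
    substitute[OF assms(3-5)] substitute_1[OF assms(2-5)] by simp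

section \<open>Inhabited types\<close>

definition inh :: "'l tm list \<Rightarrow> 'l tm \<Rightarrow> bool" where
  "inh \<Gamma> A \<longleftrightarrow> (\<exists>t. \<Gamma> \<turnstile> t \<Colon> A)"

lemma inhI: "\<Gamma> \<turnstile> t \<Colon> A \<Longrightarrow> inh \<Gamma> A"
  by (auto simp: inh_def)

lemma inh_convert: "inh \<Gamma> A \<Longrightarrow> \<Gamma> \<turnstile> B \<Colon> TUniv u \<Longrightarrow> abs_ctm A = abs_ctm B \<Longrightarrow> inh \<Gamma> B"
  unfolding inh_def by (blast intro: ty_convert)

lemma inh_Pi: "inh (A # \<Gamma>) B \<Longrightarrow> inh \<Gamma> (TPi A B)"
  unfolding inh_def by (blast intro: ty_Lam)

lemma inh_Pi_elim: "inh \<Gamma> (TPi A B) \<Longrightarrow> \<Gamma> \<turnstile> a \<Colon> A \<Longrightarrow> subst 0 a B = C \<Longrightarrow> inh \<Gamma> C"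
  unfolding inh_def by (blast intro: App_eq)

lemma inh_Arr_elim: "inh \<Gamma> (TPi A (\<up>B)) \<Longrightarrow> inh \<Gamma> A \<Longrightarrow> inh \<Gamma> B"
  unfolding inh_def by (blast intro: App_eq subst_shift_cancel)

lemma inh_weaken: "inh \<Gamma> A \<Longrightarrow> ctx S (B # \<Gamma>) \<Longrightarrow> \<up>A = C \<Longrightarrow> inh (B # \<Gamma>) C"
  unfolding inh_def by (blast intro: weaken_eq)

lemma inh_Pi_open:
  assumes "inh \<Gamma> (TPi A B)" "ctx S (A # \<Gamma>)"
  shows "inh (A # \<Gamma>) B"
proof -
  from assms(1) obtain t where "\<Gamma> \<turnstile> t \<Colon> TPi A B" by (auto simp: inh_def)
  from weaken[OF this assms(2)] have "A # \<Gamma> \<turnstile> \<up>t \<Colon> TPi (\<up>A) (shift (Suc 0) B)" by simp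
  from ty_App[OF this, of "v0"] ty_lookup[OF assms(2), of 0] show ?thesis
    by (auto simp: inh_def)
qed

lemma inh_substitute: "inh (A # \<Gamma>) B \<Longrightarrow> \<Gamma> \<turnstile> a \<Colon> A \<Longrightarrow> subst 0 a B = C \<Longrightarrow> inh \<Gamma> C"
  using inh_Pi inh_Pi_elim by blast

lemma inh_refl: "\<Gamma> \<turnstile> a \<Colon> A \<Longrightarrow> inh \<Gamma> (TId A a a)"
  unfolding inh_def by (blast intro: ty_Refl)

lemma IdInd_eq:
  assumes \<Gamma>: "ctx S \<Gamma>" and A: "\<Gamma> \<turnstile> A \<Colon> TUniv u"
    and A': "\<up>A = A'" and I: "TId (\<up>A') v1 v0 = I"
    and M: "ctx S (A # \<Gamma>) \<Longrightarrow> ctx S (A' # A # \<Gamma>) \<Longrightarrow> ctx S (I # A' # A # \<Gamma>) \<Longrightarrow> I # A' # A # \<Gamma> \<turnstile> M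
      \<Colon> TUniv w"
    and D: "subst 0 (TRefl v0) (subst (Suc 0) v1
      (subst (Suc (Suc 0)) v2 (shift (Suc (Suc (Suc 0))) M))) = D"
    and d: "ctx S (A # \<Gamma>) \<Longrightarrow> A # \<Gamma> \<turnstile> d \<Colon> D"
    and a: "\<Gamma> \<turnstile> a \<Colon> A" and b: "\<Gamma> \<turnstile> b \<Colon> A" and p: "\<Gamma> \<turnstile> p \<Colon> TId A a b"
    and R: "subst 0 p (subst (Suc 0) (\<up>b) (subst (Suc (Suc 0)) (\<up>\<up>a) M)) = R"
  shows "\<Gamma> \<turnstile> TIdInd (TLam A (TLam A' (TLam I M))) (TLam A d) a b p \<Colon> R"
proof -
  note A' = A'[symmetric]
  note I = I[symmetric, unfolded A']
  define C where "C = TLam A (TLam A' (TLam I M))"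
  have A1: "ctx S (A # \<Gamma>)" using A by (rule ctx_Cons)
  have A1': "A # \<Gamma> \<turnstile> \<up>A \<Colon> TUniv u" using weaken[OF A A1] by simp
  have A2: "ctx S (\<up>A # A # \<Gamma>)" using A1' by (rule ctx_Cons)
  have tI: "\<up>A # A # \<Gamma> \<turnstile> TId (\<up>\<up>A) v1 v0 \<Colon> TUniv u"
    by (insert A A1 A2; (assumption | rule ty_intros | simp (no_asm))+)
  have M: "I # A' # A # \<Gamma> \<turnstile> M \<Colon> TUniv w"
    by (rule M[OF A1]) (use A2 ctx_Cons[OF tI] in \<open>simp_all add: A' I\<close>)
  have C: "\<Gamma> \<turnstile> C \<Colon> TPi A (TPi (\<up>A) (TPi (TId (\<up>\<up>A) v1 v0) (TUniv w)))"
    unfolding C_def using M unfolding A' I by (intro ty_Lam)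
  have "A # \<Gamma> \<turnstile> TApp (TApp (TApp (\<up>C) v0) v0) (TRefl v0) \<Colon> TUniv w"
    by (insert A A1 A2 C; (assumption | rule ty_intros | simp (no_asm))+)
  then have "A # \<Gamma> \<turnstile> d \<Colon> TApp (TApp (TApp (\<up>C) v0) v0) (TRefl v0)"
    by (rule ty_convert[OF d[OF A1]]) (simp add: C_def D[symmetric])
  from ty_IdInd[unfolded One_nat_def, OF C ty_Lam[OF this] a b p]
  have "\<Gamma> \<turnstile> TIdInd C (TLam A d) a b p \<Colon> TApp (TApp (TApp C a) b) p" .
  moreover have "\<Gamma> \<turnstile> R \<Colon> TUniv w"
  proof -
    from substitute_2[OF M[unfolded A' I] tI A1' a \<Gamma>]
    have 1: "TId (\<up>A) (\<up>a) v0 # A # \<Gamma> \<turnstile> subst (Suc (Suc 0)) (\<up>\<up>a) M \<Colon> TUniv w" by simp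
    have "A # \<Gamma> \<turnstile> TId (\<up>A) (\<up>a) v0 \<Colon> TUniv u"
      by (insert A A1 a; (assumption | rule ty_intros | simp (no_asm))+)
    from substitute_1[OF 1 this b \<Gamma>] substitute[OF _ p \<Gamma>] R show ?thesis by fastforce
  qed
  ultimately have "\<Gamma> \<turnstile> TIdInd C (TLam A d) a b p \<Colon> R"
    by (rule ty_convert) (simp add: C_def R[symmetric])
  then show ?thesis by (simp only: C_def)
qed

lemma inh_Id_elim:
  assumes "ctx S \<Gamma>" "\<Gamma> \<turnstile> A \<Colon> TUniv u"
    "TId (\<up>\<up>A) v1 v0 # \<up>A # A # \<Gamma> \<turnstile> M \<Colon> TUniv w"
    "\<Gamma> \<turnstile> a \<Colon> A" "\<Gamma> \<turnstile> b \<Colon> A" "\<Gamma> \<turnstile> p \<Colon> TId A a b"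
    "inh (A # \<Gamma>) D"
    "subst 0 (TRefl v0) (subst (Suc 0) v1
      (subst (Suc (Suc 0)) v2 (shift (Suc (Suc (Suc 0))) M))) = D"
    "subst 0 p (subst (Suc 0) (\<up>b) (subst (Suc (Suc 0)) (\<up>\<up>a) M)) = R"
  shows "inh \<Gamma> R"
proof -
  from assms(7) obtain d where "A # \<Gamma> \<turnstile> d \<Colon> D" by (auto simp: inh_def)
  from IdInd_eq[OF assms(1,2) refl refl assms(3) assms(8) this assms(4-6,9)] show ?thesis
    by (rule inhI)
qed

lemma leibniz:
  assumes \<Gamma>: "ctx S \<Gamma>" and A: "\<Gamma> \<turnstile> A \<Colon> TUniv u" and C: "A # \<Gamma> \<turnstile> C \<Colon> TUniv w"
    and a: "\<Gamma> \<turnstile> a \<Colon> A" and b: "\<Gamma> \<turnstile> b \<Colon> A" and p: "inh \<Gamma> (TId A a b)"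
    and X: "subst 0 a C = X" "inh \<Gamma> X" and Y: "subst 0 b C = Y"
  shows "inh \<Gamma> Y"
proof -
  define c where "c = TLam A C"
  have c: "\<Gamma> \<turnstile> c \<Colon> TPi A (TUniv w)" unfolding c_def using C by (rule ty_Lam)
  have A1: "ctx S (A # \<Gamma>)" using A by (rule ctx_Cons)
  have "A # \<Gamma> \<turnstile> \<up>A \<Colon> TUniv u" using weaken[OF A A1] by simp
  then have A2: "ctx S (\<up>A # A # \<Gamma>)" by (rule ctx_Cons)
  have "\<up>A # A # \<Gamma> \<turnstile> TId (\<up>\<up>A) v1 v0 \<Colon> TUniv u"
    by (insert A A1 A2; (assumption | rule ty_intros | simp (no_asm))+)
  then have A3: "ctx S (TId (\<up>\<up>A) v1 v0 # \<up>A # A # \<Gamma>)" by (rule ctx_Cons)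
  let ?M = "TPi (TApp (\<up>\<up>\<up>c) v2) (TApp (\<up>\<up>\<up>\<up>c) v2)"
  have M: "TId (\<up>\<up>A) v1 v0 # \<up>A # A # \<Gamma> \<turnstile> ?M \<Colon> TUniv (w \<squnion> w)"
    by (insert c A1 A2 A3; (assumption | rule ty_intros | simp (no_asm))+)
  have d: "inh (A # \<Gamma>) (TPi (TApp (\<up>c) v0) (TApp (\<up>\<up>c) v1))"
    by (rule inhI[where t = "TLam (TApp (\<up>c) v0) v0"])
      (insert c A1; (assumption | rule ty_intros | simp (no_asm))+)
  from p obtain q where q: "\<Gamma> \<turnstile> q \<Colon> TId A a b" by (auto simp: inh_def)
  have "inh \<Gamma> (TPi (TApp c a) (\<up>(TApp c b)))"
    by (rule inh_Id_elim[OF \<Gamma> A M a b q d]) simp_all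
  moreover have "\<Gamma> \<turnstile> TApp c a \<Colon> TUniv w"
    by (insert c a; (assumption | rule ty_intros | simp (no_asm))+)
  then have "inh \<Gamma> (TApp c a)"
    by (rule inh_convert[OF X(2)]) (simp add: c_def X(1)[symmetric])
  ultimately have "inh \<Gamma> (TApp c b)" by (rule inh_Arr_elim)
  moreover have "\<Gamma> \<turnstile> Y \<Colon> TUniv w" using substitute[OF C b \<Gamma>] Y by simp
  ultimately show ?thesis by (rule inh_convert) (simp add: c_def Y[symmetric])
qed

lemma inh_Id_sym:
  assumes \<Gamma>: "ctx S \<Gamma>" and A: "\<Gamma> \<turnstile> A \<Colon> TUniv u"
    and a: "\<Gamma> \<turnstile> a \<Colon> A" and b: "\<Gamma> \<turnstile> b \<Colon> A" and p: "inh \<Gamma> (TId A a b)"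
  shows "inh \<Gamma> (TId A b a)"
proof (rule leibniz[OF \<Gamma> A _ a b p])
  have A1: "ctx S (A # \<Gamma>)" using A by (rule ctx_Cons)
  show "A # \<Gamma> \<turnstile> TId (\<up>A) v0 (\<up>a) \<Colon> TUniv u"
    by (insert A a A1; (assumption | rule ty_intros | simp (no_asm))+)
qed (use inh_refl[OF a] in simp_all)

lemma inh_Id_trans:
  assumes \<Gamma>: "ctx S \<Gamma>" and A: "\<Gamma> \<turnstile> A \<Colon> TUniv u"
    and a: "\<Gamma> \<turnstile> a \<Colon> A" and b: "\<Gamma> \<turnstile> b \<Colon> A" and c: "\<Gamma> \<turnstile> c \<Colon> A"
    and p: "inh \<Gamma> (TId A a b)" and q: "inh \<Gamma> (TId A b c)"
  shows "inh \<Gamma> (TId A a c)"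
proof (rule leibniz[OF \<Gamma> A _ b c q])
  have A1: "ctx S (A # \<Gamma>)" using A by (rule ctx_Cons)
  show "A # \<Gamma> \<turnstile> TId (\<up>A) (\<up>a) v0 \<Colon> TUniv u"
    by (insert A a A1; (assumption | rule ty_intros | simp (no_asm))+)
qed (use p in simp_all)

lemma inh_Id_cong:
  assumes \<Gamma>: "ctx S \<Gamma>" and A: "\<Gamma> \<turnstile> A \<Colon> TUniv u" and B: "\<Gamma> \<turnstile> B \<Colon> TUniv v"
    and t: "A # \<Gamma> \<turnstile> t \<Colon> \<up>B"
    and a: "\<Gamma> \<turnstile> a \<Colon> A" and b: "\<Gamma> \<turnstile> b \<Colon> A" and p: "inh \<Gamma> (TId A a b)"
    and l: "subst 0 a t = l" and r: "subst 0 b t = r"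
  shows "inh \<Gamma> (TId B l r)"
proof (rule leibniz[OF \<Gamma> A _ a b p])
  have A1: "ctx S (A # \<Gamma>)" using A by (rule ctx_Cons)
  have l': "\<Gamma> \<turnstile> l \<Colon> B" using substitute[OF t a \<Gamma>] l by simp
  show "A # \<Gamma> \<turnstile> TId (\<up>B) (\<up>l) t \<Colon> TUniv v"
    by (insert B l' A1 t; (assumption | rule ty_intros | simp (no_asm))+)
  from l' show "inh \<Gamma> (TId B l l)" by (rule inh_refl)
qed (use l r in simp_all)

lemma SigInd_eq:
  assumes \<Gamma>: "ctx S \<Gamma>" and A: "\<Gamma> \<turnstile> A \<Colon> TUniv u"
    and B: "ctx S (A # \<Gamma>) \<Longrightarrow> A # \<Gamma> \<turnstile> B \<Colon> TUniv v" and Z: "TSig A B = Z"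
    and C: "ctx S (Z # \<Gamma>) \<Longrightarrow> Z # \<Gamma> \<turnstile> C \<Colon> TUniv w"
    and D: "subst 0 (TPair v1 v0) (shift (Suc 0) (shift (Suc 0) C)) = D"
    and d: "ctx S (A # \<Gamma>) \<Longrightarrow> ctx S (B # A # \<Gamma>) \<Longrightarrow> B # A # \<Gamma> \<turnstile> d \<Colon> D"
    and p: "\<Gamma> \<turnstile> p \<Colon> TSig A B" and R: "subst 0 p C = R"
  shows "\<Gamma> \<turnstile> TSigInd (TLam Z C) (TLam A (TLam B d)) p \<Colon> R"
proof -
  note Z = Z[symmetric]
  define c where "c = TLam (TSig A B) C"
  have A1: "ctx S (A # \<Gamma>)" using A by (rule ctx_Cons)
  have B: "A # \<Gamma> \<turnstile> B \<Colon> TUniv v" by (rule B[OF A1])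
  then have A2: "ctx S (B # A # \<Gamma>)" by (rule ctx_Cons)
  have C: "TSig A B # \<Gamma> \<turnstile> C \<Colon> TUniv w"
    using C ctx_Cons[OF ty_Sig[OF A B]] unfolding Z by blast
  have c: "\<Gamma> \<turnstile> c \<Colon> TPi (TSig A B) (TUniv w)" unfolding c_def using C by (rule ty_Lam)
  have pr: "B # A # \<Gamma> \<turnstile> TApp (\<up>\<up>c) (TPair v1 v0) \<Colon> TUniv w"
    by (insert A A1 A2 B c; (assumption | rule ty_intros | simp (no_asm))+)
  have "B # A # \<Gamma> \<turnstile> d \<Colon> TApp (\<up>\<up>c) (TPair v1 v0)"
    by (rule ty_convert[OF d[OF A1 A2] pr]) (simp add: c_def D[symmetric])
  from ty_SigInd[unfolded One_nat_def, OF c ty_Lam[OF ty_Lam[OF this]] p]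
  have "\<Gamma> \<turnstile> TSigInd c (TLam A (TLam B d)) p \<Colon> TApp c p" .
  moreover have "\<Gamma> \<turnstile> R \<Colon> TUniv w" using substitute[OF C p \<Gamma>] R by simp
  ultimately have "\<Gamma> \<turnstile> TSigInd c (TLam A (TLam B d)) p \<Colon> R"
    by (rule ty_convert) (simp add: c_def R[symmetric])
  then show ?thesis by (simp only: c_def Z)
qed

lemma inh_Sig_elim:
  assumes "ctx S \<Gamma>" "\<Gamma> \<turnstile> A \<Colon> TUniv u" "A # \<Gamma> \<turnstile> B \<Colon> TUniv v"
    "TSig A B # \<Gamma> \<turnstile> C \<Colon> TUniv w" "\<Gamma> \<turnstile> p \<Colon> TSig A B"
    "inh (B # A # \<Gamma>) D"
    "subst 0 (TPair v1 v0) (shift (Suc 0) (shift (Suc 0) C)) = D" "subst 0 p C = R"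
  shows "inh \<Gamma> R"
proof -
  from assms(6) obtain d where "B # A # \<Gamma> \<turnstile> d \<Colon> D" by (auto simp: inh_def)
  from SigInd_eq[OF assms(1-3) refl assms(4,7) this assms(5,8)] show ?thesis by (rule inhI)
qed

lemma UnitInd_eq:
  assumes \<Gamma>: "ctx S \<Gamma>" and C: "ctx S (TUnit u # \<Gamma>) \<Longrightarrow> TUnit u # \<Gamma> \<turnstile> C \<Colon> TUniv w"
    and D: "subst 0 (TStar u) C = D" and d: "\<Gamma> \<turnstile> d \<Colon> D" and p: "\<Gamma> \<turnstile> p \<Colon> TUnit u"
    and R: "subst 0 p C = R"
  shows "\<Gamma> \<turnstile> TUnitInd (TLam (TUnit u) C) d p \<Colon> R"
proof -
  define c where "c = TLam (TUnit u) C"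
  have C: "TUnit u # \<Gamma> \<turnstile> C \<Colon> TUniv w" by (rule C[OF ctx_Cons[OF ty_Unit[OF \<Gamma>]]])
  have c: "\<Gamma> \<turnstile> c \<Colon> TPi (TUnit u) (TUniv w)" unfolding c_def using C by (rule ty_Lam)
  have "\<Gamma> \<turnstile> TApp c (TStar u) \<Colon> TUniv w"
    by (insert \<Gamma> c; (assumption | rule ty_intros | simp (no_asm))+)
  then have "\<Gamma> \<turnstile> d \<Colon> TApp c (TStar u)"
    by (rule ty_convert[OF d]) (simp add: c_def D[symmetric])
  from ty_UnitInd[OF c this p] have "\<Gamma> \<turnstile> TUnitInd c d p \<Colon> TApp c p" .
  moreover have "\<Gamma> \<turnstile> R \<Colon> TUniv w" using substitute[OF C p \<Gamma>] R by simp
  ultimately have "\<Gamma> \<turnstile> TUnitInd c d p \<Colon> R"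
    by (rule ty_convert) (simp add: c_def R[symmetric])
  then show ?thesis by (simp only: c_def)
qed

end

section \<open>Projections and equivalences\<close>

lemma csubst_var_cshift_cshift [simp]:
  "csubst k (cvar (Suc k)) (cshift (Suc k) (cshift (Suc k) t)) = cshift k t"
  by (transfer, simp add: conv_refl)

definition Prj1 :: "'l tm \<Rightarrow> 'l tm \<Rightarrow> 'l tm \<Rightarrow> 'l tm" where
  "Prj1 A B p = TSigInd (TLam (TSig A B) (\<up>A)) (TLam A (TLam B v1)) p"

definition Prj2 :: "'l tm \<Rightarrow> 'l tm \<Rightarrow> 'l tm \<Rightarrow> 'l tm" where
  "Prj2 A B p =
    TSigInd (TLam (TSig A B) (subst 0 (Prj1 (\<up>A) (shift (Suc 0) B) v0) (shift (Suc 0) B)))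
      (TLam A (TLam B v0)) p"

lemma Prj_simps [simp]:
  "shift k (Prj1 A B p) = Prj1 (shift k A) (shift (Suc k) B) (shift k p)"
  "subst k s (Prj1 A B p) = Prj1 (subst k s A) (subst (Suc k) (\<up>s) B) (subst k s p)"
  "shift k (Prj2 A B p) = Prj2 (shift k A) (shift (Suc k) B) (shift k p)"
  "subst k s (Prj2 A B p) = Prj2 (subst k s A) (subst (Suc k) (\<up>s) B) (subst k s p)"
  using subst_Suc_shift[of "Suc 0" "Suc k" "\<up>s" B] shift_shift[of 0 0 s]
  by (simp_all add: Prj1_def Prj2_def shift_subst subst_subst shift_shift)

lift_definition cprj1 :: "'l ctm \<Rightarrow> 'l ctm \<Rightarrow> 'l ctm \<Rightarrow> 'l ctm" is Prj1
  unfolding Prj1_def by (simp add: conv_iff)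

lift_definition cprj2 :: "'l ctm \<Rightarrow> 'l ctm \<Rightarrow> 'l ctm \<Rightarrow> 'l ctm" is Prj2
  unfolding Prj2_def Prj1_def by (simp add: conv_iff)

lemma abs_ctm_Prj [simp]:
  "abs_ctm (Prj1 A B p) = cprj1 (abs_ctm A) (abs_ctm B) (abs_ctm p)"
  "abs_ctm (Prj2 A B p) = cprj2 (abs_ctm A) (abs_ctm B) (abs_ctm p)"
  by (simp_all add: cprj1.abs_eq cprj2.abs_eq)

lemma cprj_simps [simp]:
  "cshift k (cprj1 A B p) = cprj1 (cshift k A) (cshift (Suc k) B) (cshift k p)"
  "csubst k s (cprj1 A B p) = cprj1 (csubst k s A) (csubst (Suc k) (cshift 0 s) B) (csubst k s p)"
  "cshift k (cprj2 A B p) = cprj2 (cshift k A) (cshift (Suc k) B) (cshift k p)"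
  "csubst k s (cprj2 A B p) = cprj2 (csubst k s A) (csubst (Suc k) (cshift 0 s) B) (csubst k s p)"
  by (transfer; simp add: conv_refl)+

lemma cprj_pair [simp]:
  "cprj1 A B (cpair a b) = a"
  "cprj2 A B (cpair a b) = b"
  by (transfer; simp add: Prj1_def Prj2_def conv_iff)+

abbreviation Arr :: "'l tm \<Rightarrow> 'l tm \<Rightarrow> 'l tm" where
  "Arr A B \<equiv> TPi A (\<up>B)"

abbreviation Comp :: "'l tm \<Rightarrow> 'l tm \<Rightarrow> 'l tm \<Rightarrow> 'l tm" where
  "Comp A g f \<equiv> TLam A (TApp (\<up>g) (TApp (\<up>f) v0))"

abbreviation IdF :: "'l tm \<Rightarrow> 'l tm" where
  "IdF A \<equiv> TLam A v0"

abbreviation Htpy :: "'l tm \<Rightarrow> 'l tm \<Rightarrow> 'l tm \<Rightarrow> 'l tm \<Rightarrow> 'l tm" where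
  "Htpy A B f g \<equiv> TPi A (TId (\<up>B) (TApp (\<up>f) v0) (TApp (\<up>g) v0))"

abbreviation SecFam :: "'l tm \<Rightarrow> 'l tm \<Rightarrow> 'l tm" where
  "SecFam B f \<equiv> Htpy (\<up>B) (\<up>B) (Comp (\<up>B) (\<up>f) v0) (IdF (\<up>B))"

abbreviation RetFam :: "'l tm \<Rightarrow> 'l tm \<Rightarrow> 'l tm" where
  "RetFam A f \<equiv> Htpy (\<up>A) (\<up>A) (Comp (\<up>A) v0 (\<up>f)) (IdF (\<up>A))"

definition IsEquiv :: "'l tm \<Rightarrow> 'l tm \<Rightarrow> 'l tm \<Rightarrow> 'l tm" where
  "IsEquiv A B f = TSig (TSig (Arr B A) (SecFam B f)) (\<up>(TSig (Arr B A) (RetFam A f)))"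

definition Equiv :: "'l tm \<Rightarrow> 'l tm \<Rightarrow> 'l tm" where
  "Equiv A B = TSig (Arr A B) (IsEquiv (\<up>A) (\<up>B) v0)"

definition EquivFun :: "'l tm \<Rightarrow> 'l tm \<Rightarrow> 'l tm \<Rightarrow> 'l tm" where
  "EquivFun A B e = Prj1 (Arr A B) (IsEquiv (\<up>A) (\<up>B) v0) e"

definition IdEquiv :: "'l tm \<Rightarrow> 'l tm" where
  "IdEquiv A =
    TPair (IdF A) (TPair (TPair (IdF A) (TLam A (TRefl v0))) (TPair (IdF A) (TLam A (TRefl v0))))"

definition IdToEquiv :: "'l \<Rightarrow> 'l tm \<Rightarrow> 'l tm \<Rightarrow> 'l tm" where
  "IdToEquiv u X Y = TLam (TId (TUniv u) X Y)
    (TIdInd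
      (TLam (TUniv u) (TLam (TUniv u) (TLam (TId (TUniv u) v1 v0)
        (Equiv v2 v1))))
      (TLam (TUniv u) (IdEquiv v0)) (\<up>X) (\<up>Y) v0)"

lemma equiv_simps [simp]:
  "shift k (IsEquiv A B f) = IsEquiv (shift k A) (shift k B) (shift k f)"
  "subst k s (IsEquiv A B f) = IsEquiv (subst k s A) (subst k s B) (subst k s f)"
  "shift k (Equiv A B) = Equiv (shift k A) (shift k B)"
  "subst k s (Equiv A B) = Equiv (subst k s A) (subst k s B)"
  "shift k (EquivFun A B e) = EquivFun (shift k A) (shift k B) (shift k e)"
  "subst k s (EquivFun A B e) = EquivFun (subst k s A) (subst k s B) (subst k s e)"
  "shift k (IdEquiv A) = IdEquiv (shift k A)"
  "subst k s (IdEquiv A) = IdEquiv (subst k s A)"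
  "shift k (IdToEquiv u A B) = IdToEquiv u (shift k A) (shift k B)"
  "subst k s (IdToEquiv u A B) = IdToEquiv u (subst k s A) (subst k s B)"
  by (simp_all add: IsEquiv_def Equiv_def EquivFun_def IdEquiv_def IdToEquiv_def)

lemma univalence_raw:
  "univalence u 0 = TPi (TUniv u) (TPi (TUniv u)
    (IsEquiv (TId (TUniv u) v1 v0) (Equiv v1 v0)
      (IdToEquiv u v1 v0)))"
  by (simp add: univalence_def universe_def pi_type_def is_equiv_def ident_def bound_var_def
      id_to_equiv_def lam_def equivalence_def sig_type_def arr_def homotopy_def fun_comp_def app_def
      id_fun_def id_equiv_def id_ind_def prod_type_def pair_of_def rfl_def
      IsEquiv_def Equiv_def IdEquiv_def IdToEquiv_def)

context type_theory
begin

lemma Prj1_eq: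
  assumes A: "\<Gamma> \<turnstile> A \<Colon> TUniv u" and B: "ctx S (A # \<Gamma>) \<Longrightarrow> A # \<Gamma> \<turnstile> B \<Colon> TUniv v"
    and p: "\<Gamma> \<turnstile> p \<Colon> TSig A B" and C: "A = C"
  shows "\<Gamma> \<turnstile> Prj1 A B p \<Colon> C"
proof -
  have A1: "ctx S (A # \<Gamma>)" using A by (rule ctx_Cons)
  have B': "A # \<Gamma> \<turnstile> B \<Colon> TUniv v" by (rule B[OF A1])
  have A2: "ctx S (B # A # \<Gamma>)" using B' by (rule ctx_Cons)
  define c where "c = TLam (TSig A B) (\<up>A)"
  have c: "\<Gamma> \<turnstile> c \<Colon> TPi (TSig A B) (TUniv u)" unfolding c_def
    by (insert A B'; (assumption | rule ty_intros | simp (no_asm))+)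
  have pr: "B # A # \<Gamma> \<turnstile> TApp (\<up>\<up>c) (TPair v1 v0) \<Colon> TUniv u"
    by (insert A A1 A2 B' c; (assumption | rule ty_intros | simp (no_asm))+)
  have "B # A # \<Gamma> \<turnstile> v1 \<Colon> \<up>\<up>A" using ty_lookup[OF A2, of "Suc 0"] by simp
  then have "B # A # \<Gamma> \<turnstile> v1 \<Colon> TApp (\<up>\<up>c) (TPair v1 v0)"
    by (rule ty_convert[OF _ pr]) (simp add: c_def)
  from ty_SigInd[unfolded One_nat_def, OF c ty_Lam[OF ty_Lam[OF this]] p]
  have "\<Gamma> \<turnstile> Prj1 A B p \<Colon> TApp c p" by (simp add: Prj1_def c_def)
  then have "\<Gamma> \<turnstile> Prj1 A B p \<Colon> A" by (rule ty_convert[OF _ A]) (simp add: c_def)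
  with C show ?thesis by simp
qed

lemma Prj2_eq:
  assumes \<Gamma>: "ctx S \<Gamma>" and A: "\<Gamma> \<turnstile> A \<Colon> TUniv u" and B: "ctx S (A # \<Gamma>) \<Longrightarrow> A # \<Gamma> \<turnstile> B \<Colon> TUniv v"
    and p: "\<Gamma> \<turnstile> p \<Colon> TSig A B" and C: "subst 0 (Prj1 A B p) B = C"
  shows "\<Gamma> \<turnstile> Prj2 A B p \<Colon> C"
proof -
  have A1: "ctx S (A # \<Gamma>)" using A by (rule ctx_Cons)
  have B': "A # \<Gamma> \<turnstile> B \<Colon> TUniv v" by (rule B[OF A1])
  have A2: "ctx S (B # A # \<Gamma>)" using B' by (rule ctx_Cons)
  define c where "c = TLam (TSig A B) (subst 0 (Prj1 (\<up>A) (shift (Suc 0) B) v0) (shift (Suc 0) B))"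
  have "\<Gamma> \<turnstile> TSig A B \<Colon> TUniv (u \<squnion> v)" using A B' by (rule ty_Sig)
  then have S1: "ctx S (TSig A B # \<Gamma>)" by (rule ctx_Cons)
  have B1: "\<up>A # TSig A B # \<Gamma> \<turnstile> shift (Suc 0) B \<Colon> TUniv v"
    by (insert A B' S1; (assumption | rule ty_intros | simp (no_asm))+)
  have "TSig A B # \<Gamma> \<turnstile> Prj1 (\<up>A) (shift (Suc 0) B) v0 \<Colon> \<up>A"
    by (insert A B' S1; (assumption | rule Prj1_eq ty_intros | simp (no_asm))+)
  from substitute[OF B1 this S1] have c: "\<Gamma> \<turnstile> c \<Colon> TPi (TSig A B) (TUniv v)"
    unfolding c_def by (intro ty_Lam) simp
  have pr: "B # A # \<Gamma> \<turnstile> TApp (\<up>\<up>c) (TPair v1 v0) \<Colon> TUniv v"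
    by (insert A A1 A2 B' c; (assumption | rule ty_intros | simp (no_asm))+)
  have "B # A # \<Gamma> \<turnstile> v0 \<Colon> \<up>B" using ty_lookup[OF A2, of 0] by simp
  then have "B # A # \<Gamma> \<turnstile> v0 \<Colon> TApp (\<up>\<up>c) (TPair v1 v0)"
    by (rule ty_convert[OF _ pr]) (simp add: c_def cshift_csubst csubst_csubst cshift_cshift)
  from ty_SigInd[unfolded One_nat_def, OF c ty_Lam[OF ty_Lam[OF this]] p]
  have *: "\<Gamma> \<turnstile> Prj2 A B p \<Colon> TApp c p" by (simp add: Prj2_def c_def)
  have "\<Gamma> \<turnstile> Prj1 A B p \<Colon> A" using A B' p by (intro Prj1_eq) auto
  from substitute[OF B' this \<Gamma>] have "\<Gamma> \<turnstile> C \<Colon> TUniv v" by (simp add: C)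
  with * show ?thesis by (rule ty_convert) (simp add: c_def C[symmetric] csubst_csubst)
qed

lemmas tyI = ty_intros Prj1_eq Prj2_eq

lemma IsEquiv_eq:
  assumes "ctx S \<Gamma>" "\<Gamma> \<turnstile> A \<Colon> TUniv u" "\<Gamma> \<turnstile> B \<Colon> TUniv u" "\<Gamma> \<turnstile> f \<Colon> Arr A B" "TUniv u = C"
  shows "\<Gamma> \<turnstile> IsEquiv A B f \<Colon> C"
  unfolding IsEquiv_def assms(5)[symmetric]
  by (insert assms(1-4); (assumption | rule tyI | simp (no_asm))+)

lemma Equiv_eq:
  assumes "ctx S \<Gamma>" "\<Gamma> \<turnstile> A \<Colon> TUniv u" "\<Gamma> \<turnstile> B \<Colon> TUniv u" "TUniv u = C"
  shows "\<Gamma> \<turnstile> Equiv A B \<Colon> C"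
  unfolding Equiv_def assms(4)[symmetric]
  by (insert assms(1-3); (assumption | rule IsEquiv_eq tyI | simp (no_asm))+)

end

context type_theory
begin

lemma IsEquivI:
  assumes \<Gamma>: "ctx S \<Gamma>" and A: "\<Gamma> \<turnstile> A \<Colon> TUniv u" and B: "\<Gamma> \<turnstile> B \<Colon> TUniv u"
    and f: "\<Gamma> \<turnstile> f \<Colon> Arr A B" and s: "\<Gamma> \<turnstile> s \<Colon> Arr B A" and r: "\<Gamma> \<turnstile> r \<Colon> Arr B A"
    and h: "\<Gamma> \<turnstile> h \<Colon> TPi B (TId (\<up>B) (TApp (\<up>f) (TApp (\<up>s) v0)) v0)"
    and k: "\<Gamma> \<turnstile> k \<Colon> TPi A (TId (\<up>A) (TApp (\<up>r) (TApp (\<up>f) v0)) v0)"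
  shows "\<Gamma> \<turnstile> TPair (TPair s h) (TPair r k) \<Colon> IsEquiv A B f"
proof -
  have "\<Gamma> \<turnstile> Htpy B B (Comp B f s) (IdF B) \<Colon> TUniv (u \<squnion> u)"
    by (insert A B f s; (assumption | rule tyI | simp (no_asm))+)
  then have h': "\<Gamma> \<turnstile> h \<Colon> Htpy B B (Comp B f s) (IdF B)"
    by (rule ty_convert[OF h]) simp
  have "\<Gamma> \<turnstile> Htpy A A (Comp A r f) (IdF A) \<Colon> TUniv (u \<squnion> u)"
    by (insert A B f r; (assumption | rule tyI | simp (no_asm))+)
  then have k': "\<Gamma> \<turnstile> k \<Colon> Htpy A A (Comp A r f) (IdF A)"
    by (rule ty_convert[OF k]) simp
  note h' = h'[simplified]
  note k' = k'[simplified]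
  show ?thesis unfolding IsEquiv_def
    by (insert \<Gamma> A B f s r h' k'; (assumption | rule tyI | simp (no_asm))+)
qed

lemma ty_IdEquiv:
  assumes \<Gamma>: "ctx S \<Gamma>" and A: "\<Gamma> \<turnstile> A \<Colon> TUniv u"
  shows "\<Gamma> \<turnstile> IdEquiv A \<Colon> Equiv A A"
proof -
  have i: "\<Gamma> \<turnstile> IdF A \<Colon> Arr A A"
    by (insert A; (assumption | rule tyI | simp (no_asm))+)
  have "\<Gamma> \<turnstile> TLam A (TRefl v0) \<Colon> TPi A (TId (\<up>A) v0 v0)"
    by (insert A; (assumption | rule tyI | simp (no_asm))+)
  moreover have "\<Gamma> \<turnstile> TPi A (TId (\<up>A) (TApp (\<up>(IdF A)) (TApp (\<up>(IdF A)) v0)) v0) \<Colon> TUniv (u \<squnion> u)"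
    by (insert A; (assumption | rule tyI | simp (no_asm))+)
  ultimately have h: "\<Gamma> \<turnstile> TLam A (TRefl v0) \<Colon>
      TPi A (TId (\<up>A) (TApp (\<up>(IdF A)) (TApp (\<up>(IdF A)) v0)) v0)"
    by (rule ty_convert) simp
  note IsEquivI[OF \<Gamma> A A i i i h h]
  with \<Gamma> A i show ?thesis unfolding IdEquiv_def Equiv_def
    apply -
    apply (rule Pair_eq)
    by (assumption | rule IsEquiv_eq tyI | simp (no_asm))+
qed

lemma EquivFun_eq:
  assumes \<Gamma>: "ctx S \<Gamma>" and A: "\<Gamma> \<turnstile> A \<Colon> TUniv u" and B: "\<Gamma> \<turnstile> B \<Colon> TUniv u"
    and e: "\<Gamma> \<turnstile> e \<Colon> Equiv A B" and C: "TPi A (\<up>B) = C"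
  shows "\<Gamma> \<turnstile> EquivFun A B e \<Colon> C"
  unfolding EquivFun_def C[symmetric]
  by (insert \<Gamma> A B e[unfolded Equiv_def]; (assumption | rule IsEquiv_eq tyI | simp (no_asm))+)

lemma IdToEquiv_eq:
  assumes \<Gamma>: "ctx S \<Gamma>" and X: "\<Gamma> \<turnstile> X \<Colon> TUniv u" and Y: "\<Gamma> \<turnstile> Y \<Colon> TUniv u"
    and C: "TPi (TId (TUniv u) X Y) (Equiv (\<up>X) (\<up>Y)) = C"
  shows "\<Gamma> \<turnstile> IdToEquiv u X Y \<Colon> C"
proof -
  let ?U = "TUniv u"
  define K where "K = TLam ?U (TLam ?U (TLam (TId ?U v1 v0)
        (Equiv v2 v1)))"
  have K_up: "\<up>K = K" by (simp add: K_def)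
  have I: "\<Gamma> \<turnstile> TId ?U X Y \<Colon> TUniv (next_level u)"
    by (insert \<Gamma> X Y; (assumption | rule tyI | simp (no_asm))+)
  then have \<Delta>: "ctx S (TId ?U X Y # \<Gamma>)" by (rule ctx_Cons)
  let ?\<Delta> = "TId ?U X Y # \<Gamma>"
  have K: "?\<Delta> \<turnstile> K \<Colon> TPi ?U (TPi (\<up>?U) (TPi (TId (\<up>\<up>?U) v1 v0) (TUniv u)))"
    unfolding K_def shift.simps
    by (insert \<Delta>; (assumption | rule Equiv_eq tyI | simp (no_asm))+)
  have U: "?\<Delta> \<turnstile> ?U \<Colon> TUniv (next_level u)" using \<Delta> by (rule ty_Univ)
  then have U1: "ctx S (?U # ?\<Delta>)" by (rule ctx_Cons)
  have "?U # ?\<Delta> \<turnstile> IdEquiv v0 \<Colon> Equiv v0 v0"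
    using ty_IdEquiv[OF U1 ty_lookup[OF U1, of 0, simplified]] .
  moreover have "?U # ?\<Delta> \<turnstile> TApp (TApp (TApp (\<up>K) v0) v0) (TRefl v0) \<Colon> TUniv u"
    by (insert \<Delta> U1 K; (assumption | rule tyI | simp (no_asm))+)
  ultimately have "?U # ?\<Delta> \<turnstile> IdEquiv v0 \<Colon>
      TApp (TApp (TApp (\<up>K) v0) v0) (TRefl v0)"
    by (rule ty_convert) (simp add: K_def Equiv_def IsEquiv_def)
  note d = ty_Lam[OF this]
  have X': "?\<Delta> \<turnstile> \<up>X \<Colon> ?U" and Y': "?\<Delta> \<turnstile> \<up>Y \<Colon> ?U"
    using weaken[OF X \<Delta>] weaken[OF Y \<Delta>] by simp_all
  have v: "?\<Delta> \<turnstile> v0 \<Colon> TId ?U (\<up>X) (\<up>Y)" using ty_lookup[OF \<Delta>, of 0] by simp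
  from ty_IdInd[unfolded One_nat_def, OF K d X' Y' v]
  have "?\<Delta> \<turnstile> TIdInd K (TLam ?U (IdEquiv v0)) (\<up>X) (\<up>Y) v0 \<Colon> TApp (TApp (TApp K (\<up>X)) (\<up>Y)) v0" .
  then have "?\<Delta> \<turnstile> TIdInd K (TLam ?U (IdEquiv v0)) (\<up>X) (\<up>Y) v0 \<Colon> Equiv (\<up>X) (\<up>Y)"
    by (rule ty_convert[OF _ Equiv_eq[OF \<Delta> X' Y' refl]]) (simp add: K_def Equiv_def IsEquiv_def)
  from ty_Lam[OF this] show ?thesis by (simp add: K_def IdToEquiv_def C)
qed

lemmas tyE = EquivFun_eq Equiv_eq IsEquiv_eq IdToEquiv_eq tyI

lemma IsEquiv_section:
  assumes \<Gamma>: "ctx S \<Gamma>" and A: "\<Gamma> \<turnstile> A \<Colon> TUniv u" and B: "\<Gamma> \<turnstile> B \<Colon> TUniv v"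
    and f: "\<Gamma> \<turnstile> f \<Colon> Arr A B" and w: "\<Gamma> \<turnstile> w \<Colon> IsEquiv A B f"
  obtains s where "\<Gamma> \<turnstile> s \<Colon> Arr B A"
    and "inh (B # \<Gamma>) (TId (\<up>B) (TApp (\<up>f) (TApp (\<up>s) v0)) v0)"
proof -
  let ?w1 = "Prj1 (TSig (Arr B A) (SecFam B f)) (\<up>(TSig (Arr B A) (RetFam A f))) w"
  have w1: "\<Gamma> \<turnstile> ?w1 \<Colon> TSig (Arr B A) (SecFam B f)"
    by (insert \<Gamma> A B f w[unfolded IsEquiv_def]; (assumption | rule tyI | simp (no_asm))+)
  define s where "s = Prj1 (Arr B A) (SecFam B f) ?w1"
  have s: "\<Gamma> \<turnstile> s \<Colon> Arr B A" unfolding s_def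
    by (insert \<Gamma> A B f w1; (assumption | rule tyI | simp (no_asm))+)
  have "\<Gamma> \<turnstile> Prj2 (Arr B A) (SecFam B f) ?w1 \<Colon> Htpy B B (Comp B f s) (IdF B)"
    apply (rule Prj2_eq[OF \<Gamma>, where u = "v \<squnion> u" and v = "v \<squnion> v"])
       apply (insert \<Gamma> A B f w1, simp_all add: s_def)
     apply (assumption | rule tyI | simp (no_asm))+
    done
  then have "inh \<Gamma> (Htpy B B (Comp B f s) (IdF B))" by (rule inhI)
  have B1: "ctx S (B # \<Gamma>)" using B by (rule ctx_Cons)
  from inh_Pi_open[OF \<open>inh \<Gamma> _\<close> B1]
  have "inh (B # \<Gamma>) (TId (\<up>B) (TApp (\<up>(Comp B f s)) v0) (TApp (\<up>(IdF B)) v0))" .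
  moreover have "B # \<Gamma> \<turnstile> TId (\<up>B) (TApp (\<up>f) (TApp (\<up>s) v0)) v0 \<Colon> TUniv v"
    by (insert B1 A B f s; (assumption | rule tyI | simp (no_asm))+)
  ultimately have "inh (B # \<Gamma>) (TId (\<up>B) (TApp (\<up>f) (TApp (\<up>s) v0)) v0)"
    by (rule inh_convert) simp
  with s show ?thesis by (rule that)
qed

end

section \<open>Univalence and function extensionality\<close>

locale univalent_type_theory = type_theory S
  for S :: "'l::universe_level axiom_name set" +
  assumes univalence_axiom: "Univalence u \<in> S"
begin

lemma equivalence_induction:
  assumes \<Gamma>: "ctx S \<Gamma>" and A: "\<Gamma> \<turnstile> A \<Colon> TUniv u" and B: "\<Gamma> \<turnstile> B \<Colon> TUniv u"
    and M: "TPi v1 v1 # TUniv u # TUniv u # \<Gamma> \<turnstile> M \<Colon> TUniv w"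
    and f: "\<Gamma> \<turnstile> f \<Colon> Arr A B" and g: "\<Gamma> \<turnstile> g \<Colon> Arr B A"
    and fg: "inh (B # \<Gamma>) (TId (\<up>B) (TApp (\<up>f) (TApp (\<up>g) v0)) v0)"
    and gf: "inh (A # \<Gamma>) (TId (\<up>A) (TApp (\<up>g) (TApp (\<up>f) v0)) v0)"
    and base: "inh (TUniv u # \<Gamma>) D"
    and D: "subst 0 (IdF v0) (subst (Suc 0) v1
      (subst (Suc (Suc 0)) v2 (shift (Suc (Suc (Suc 0))) M))) = D"
    and R: "subst 0 f (subst (Suc 0) (\<up>B) (subst (Suc (Suc 0)) (\<up>\<up>A) M)) = R"
  shows "inh \<Gamma> R"
proof -
  let ?U = "TUniv u" and ?I = "\<lambda>X Y. TId (TUniv u) X Y"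
  define m where "m = TLam ?U (TLam ?U (TLam (TPi v1 v1) M))"
  have m: "\<Gamma> \<turnstile> m \<Colon> TPi ?U (TPi ?U (TPi (TPi v1 v1) (TUniv w)))"
    unfolding m_def using M by (intro ty_Lam)
  have U: "\<Gamma> \<turnstile> ?U \<Colon> TUniv (next_level u)" using \<Gamma> by (rule ty_Univ)
  then have U1: "ctx S (?U # \<Gamma>)" by (rule ctx_Cons)
  then have "?U # \<Gamma> \<turnstile> ?U \<Colon> TUniv (next_level u)" by (rule ty_Univ)
  then have U2: "ctx S (?U # ?U # \<Gamma>)" by (rule ctx_Cons)
  have "?U # ?U # \<Gamma> \<turnstile> ?I v1 v0 \<Colon> TUniv (next_level u)"
    by (insert U1 U2; (assumption | rule tyE | simp (no_asm))+)
  then have U3: "ctx S (?I v1 v0 # ?U # ?U # \<Gamma>)" by (rule ctx_Cons)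
  let ?M = "TApp (TApp (TApp (\<up>\<up>\<up>m) v2) v1)
    (EquivFun v2 v1 (TApp (IdToEquiv u v2 v1) v0))"
  have M': "?I v1 v0 # ?U # ?U # \<Gamma> \<turnstile> ?M \<Colon> TUniv w"
    by (insert m U1 U2 U3; (assumption | rule tyE | simp (no_asm))+)
  let ?D = "TApp (TApp (TApp (\<up>m) v0) v0)
    (EquivFun v0 v0 (TApp (IdToEquiv u v0 v0) (TRefl v0)))"
  have "?U # \<Gamma> \<turnstile> ?D \<Colon> TUniv w"
    by (insert m U1; (assumption | rule tyE | simp (no_asm))+)
  then have D': "inh (?U # \<Gamma>) ?D"
    by (rule inh_convert[OF base])
      (simp add: m_def D[symmetric] EquivFun_def IdToEquiv_def IdEquiv_def)
  have ua: "\<Gamma> \<turnstile> TAx (Univalence u) \<Colon> TPi ?U (TPi ?U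
    (IsEquiv (?I v1 v0) (Equiv v1 v0)
      (IdToEquiv u v1 v0)))"
    using ty_Ax[OF \<Gamma> univalence_axiom] by (simp add: univalence_raw)
  have I: "\<Gamma> \<turnstile> ?I A B \<Colon> TUniv (next_level u)"
    by (insert \<Gamma> A B; (assumption | rule tyE | simp (no_asm))+)
  have E: "\<Gamma> \<turnstile> Equiv A B \<Colon> TUniv u"
    by (insert \<Gamma> A B; (assumption | rule tyE | simp (no_asm))+)
  have ite: "\<Gamma> \<turnstile> IdToEquiv u A B \<Colon> Arr (?I A B) (Equiv A B)"
    by (insert \<Gamma> A B; (assumption | rule tyE | simp (no_asm))+)
  have "\<Gamma> \<turnstile> TApp (TApp (TAx (Univalence u)) A) B \<Colon> IsEquiv (?I A B) (Equiv A B) (IdToEquiv u A B)"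
    by (insert ua A B; (assumption | rule tyE | simp (no_asm))+)
  then obtain s where s: "\<Gamma> \<turnstile> s \<Colon> Arr (Equiv A B) (?I A B)"
    and sec: "inh (Equiv A B # \<Gamma>) (TId (\<up>(Equiv A B)) (TApp (\<up>(IdToEquiv u A B)) (TApp (\<up>s) v0))
      v0)"
    using IsEquiv_section[OF \<Gamma> I E ite] by blast
  from inh_Pi[OF fg] obtain h where h: "\<Gamma> \<turnstile> h \<Colon> TPi B (TId (\<up>B) (TApp (\<up>f) (TApp (\<up>g) v0)) v0)"
    by (auto simp: inh_def)
  from inh_Pi[OF gf] obtain k where k: "\<Gamma> \<turnstile> k \<Colon> TPi A (TId (\<up>A) (TApp (\<up>g) (TApp (\<up>f) v0)) v0)"
    by (auto simp: inh_def)
  define e where "e = TPair f (TPair (TPair g h) (TPair g k))"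
  note i = IsEquivI[OF \<Gamma> A B f g g h k]
  have e: "\<Gamma> \<turnstile> e \<Colon> Equiv A B" unfolding e_def Equiv_def
    by (rule Pair_eq, insert \<Gamma> A B f i, (assumption | rule tyE | simp (no_asm))+)
  let ?q = "TApp s e" and ?C = "\<lambda>e. TApp (TApp (TApp m A) B) (EquivFun A B e)"
  have q: "\<Gamma> \<turnstile> ?q \<Colon> ?I A B" by (insert s e; (assumption | rule tyE | simp (no_asm))+)
  have *: "inh \<Gamma> (?C (TApp (IdToEquiv u A B) ?q))"
    by (rule inh_Id_elim[OF \<Gamma> U _ A B q D', where M = ?M]) (use M' in simp_all)
  have "inh \<Gamma> (?C e)"
  proof (rule leibniz[OF \<Gamma> E _ _ e _ _ *])
    have E1: "ctx S (Equiv A B # \<Gamma>)" using E by (rule ctx_Cons)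
    show "Equiv A B # \<Gamma> \<turnstile> TApp (TApp (TApp (\<up>m) (\<up>A)) (\<up>B)) (EquivFun (\<up>A) (\<up>B) v0) \<Colon> TUniv w"
      by (insert E1 m A B; (assumption | rule tyE | simp (no_asm))+)
    show "\<Gamma> \<turnstile> TApp (IdToEquiv u A B) ?q \<Colon> Equiv A B"
      by (insert ite q; (assumption | rule tyE | simp (no_asm))+)
    show "inh \<Gamma> (TId (Equiv A B) (TApp (IdToEquiv u A B) ?q) e)"
      by (rule inh_substitute[OF sec e]) simp
  qed simp_all
  moreover have "\<Gamma> \<turnstile> R \<Colon> TUniv w"
  proof -
    have P: "?U # ?U # \<Gamma> \<turnstile> TPi v1 v1 \<Colon> TUniv u"
      by (insert U1 U2; (assumption | rule tyE | simp (no_asm))+)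
    from substitute_2[OF M P ty_Univ[OF U1] A \<Gamma>]
    have 1: "TPi (\<up>A) v1 # ?U # \<Gamma> \<turnstile> subst (Suc (Suc 0)) (\<up>\<up>A) M \<Colon> TUniv w"
      by simp
    have "?U # \<Gamma> \<turnstile> TPi (\<up>A) v1 \<Colon> TUniv u"
      by (insert A U1; (assumption | rule tyE | simp (no_asm))+)
    from substitute_1[OF 1 this B \<Gamma>]
    have "Arr A B # \<Gamma> \<turnstile> subst (Suc 0) (\<up>B) (subst (Suc (Suc 0)) (\<up>\<up>A) M) \<Colon> TUniv w" by simp
    from substitute[OF this f \<Gamma>] R show ?thesis by simp
  qed
  ultimately show ?thesis by (rule inh_convert) (simp add: m_def R[symmetric] EquivFun_def e_def)
qed

end

lemma ctm_eta_simps [simp]: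
  "clam A (capp (cshift 0 f) (cvar 0)) = f"
  "clam A (capp (cvar (Suc i)) (cvar 0)) = cvar i"
  using ctm_eta[of A f] ctm_eta[of A "cvar i"] by simp_all

definition PathFam :: "'l tm \<Rightarrow> 'l tm \<Rightarrow> 'l tm" where
  "PathFam Y a = TSig Y (TId (\<up>Y) (\<up>a) v0)"

definition PathSpace :: "'l tm \<Rightarrow> 'l tm" where
  "PathSpace Y = TSig Y (PathFam (\<up>Y) v0)"

lemma PathSpace_simps [simp]:
  "shift k (PathFam Y a) = PathFam (shift k Y) (shift k a)"
  "subst k s (PathFam Y a) = PathFam (subst k s Y) (subst k s a)"
  "shift k (PathSpace Y) = PathSpace (shift k Y)"
  "subst k s (PathSpace Y) = PathSpace (subst k s Y)"
  by (simp_all add: PathFam_def PathSpace_def)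

context type_theory
begin

lemma PathFam_eq:
  assumes "\<Gamma> \<turnstile> Y \<Colon> TUniv u" "\<Gamma> \<turnstile> a \<Colon> Y" "TUniv u = C"
  shows "\<Gamma> \<turnstile> PathFam Y a \<Colon> C"
  unfolding PathFam_def assms(3)[symmetric]
  by (insert assms(1,2); (assumption | rule tyE | simp (no_asm))+)

lemma PathSpace_eq:
  assumes "\<Gamma> \<turnstile> Y \<Colon> TUniv u" "TUniv u = C"
  shows "\<Gamma> \<turnstile> PathSpace Y \<Colon> C"
  unfolding PathSpace_def assms(2)[symmetric]
  by (insert assms(1); (assumption | rule PathFam_eq tyE | simp (no_asm))+)

lemma PathFam_pair:
  assumes "\<Gamma> \<turnstile> Y \<Colon> TUniv u" "\<Gamma> \<turnstile> a \<Colon> Y" "\<Gamma> \<turnstile> b \<Colon> Y" "\<Gamma> \<turnstile> p \<Colon> TId Y a b"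
  shows "\<Gamma> \<turnstile> TPair b p \<Colon> PathFam Y a"
  unfolding PathFam_def by (insert assms; (assumption | rule tyE | simp (no_asm))+)

lemma PathSpace_pair:
  assumes "\<Gamma> \<turnstile> Y \<Colon> TUniv u" "\<Gamma> \<turnstile> a \<Colon> Y" "\<Gamma> \<turnstile> t \<Colon> PathFam Y a"
  shows "\<Gamma> \<turnstile> TPair a t \<Colon> PathSpace Y"
  unfolding PathSpace_def by (insert assms; (assumption | rule PathFam_eq tyE | simp (no_asm))+)

lemma PathSpace_fst:
  assumes "\<Gamma> \<turnstile> Y \<Colon> TUniv u" "\<Gamma> \<turnstile> z \<Colon> PathSpace Y" "Y = C"
  shows "\<Gamma> \<turnstile> Prj1 Y (PathFam (\<up>Y) v0) z \<Colon> C"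
  unfolding assms(3)[symmetric]
  by (insert assms(1,2); unfold PathSpace_def; (assumption | rule PathFam_eq tyE | simp (no_asm))+)

lemmas tyP = PathSpace_fst PathFam_eq PathSpace_eq PathFam_pair PathSpace_pair tyE

lemma PathSpace_contract_1:
  assumes \<Gamma>: "ctx S \<Gamma>" and Y: "\<Gamma> \<turnstile> Y \<Colon> TUniv u" and a: "\<Gamma> \<turnstile> a \<Colon> Y" and b: "\<Gamma> \<turnstile> b \<Colon> Y"
    and p: "\<Gamma> \<turnstile> p \<Colon> TId Y a b"
  shows "inh \<Gamma> (TId (PathSpace Y) (TPair a (TPair a (TRefl a))) (TPair a (TPair b p)))"
proof (rule inh_Id_elim[OF \<Gamma> Y _ a b p])
  let ?M = "TId (PathSpace (\<up>\<up>\<up>Y)) (TPair v2 (TPair v2 (TRefl v2))) (TPair v2 (TPair v1 v0))"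
  have Y1: "ctx S (Y # \<Gamma>)" using Y by (rule ctx_Cons)
  have "Y # \<Gamma> \<turnstile> \<up>Y \<Colon> TUniv u" using weaken[OF Y Y1] by simp
  then have Y2: "ctx S (\<up>Y # Y # \<Gamma>)" by (rule ctx_Cons)
  have "\<up>Y # Y # \<Gamma> \<turnstile> TId (\<up>\<up>Y) v1 v0 \<Colon> TUniv u"
    by (insert Y Y1 Y2; (assumption | rule tyP | simp (no_asm))+)
  then have Y3: "ctx S (TId (\<up>\<up>Y) v1 v0 # \<up>Y # Y # \<Gamma>)" by (rule ctx_Cons)
  show "TId (\<up>\<up>Y) v1 v0 # \<up>Y # Y # \<Gamma> \<turnstile> ?M \<Colon> TUniv u"
    by (insert Y Y1 Y2 Y3; (assumption | rule tyP | simp (no_asm))+)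
  show "inh (Y # \<Gamma>) (TId (PathSpace (\<up>Y)) (TPair v0 (TPair v0 (TRefl v0)))
      (TPair v0 (TPair v0 (TRefl v0))))"
    by (rule inh_refl) (insert Y Y1; (assumption | rule tyP | simp (no_asm))+)
qed simp_all

lemma PathSpace_contract_2:
  assumes \<Gamma>: "ctx S \<Gamma>" and Y: "\<Gamma> \<turnstile> Y \<Colon> TUniv u" and a: "\<Gamma> \<turnstile> a \<Colon> Y"
    and t: "\<Gamma> \<turnstile> t \<Colon> PathFam Y a"
  shows "inh \<Gamma> (TId (PathSpace Y) (TPair a (TPair a (TRefl a))) (TPair a t))"
proof (rule inh_Sig_elim[OF \<Gamma> Y _ _ t[unfolded PathFam_def]])
  have Y1: "ctx S (Y # \<Gamma>)" using Y by (rule ctx_Cons)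
  show I: "Y # \<Gamma> \<turnstile> TId (\<up>Y) (\<up>a) v0 \<Colon> TUniv u"
    by (insert Y Y1 a; (assumption | rule tyP | simp (no_asm))+)
  have Y2: "ctx S (TId (\<up>Y) (\<up>a) v0 # Y # \<Gamma>)" using I by (rule ctx_Cons)
  have P: "\<Gamma> \<turnstile> PathFam Y a \<Colon> TUniv u"
    by (insert Y a; (assumption | rule tyP | simp (no_asm))+)
  then have P1: "ctx S (PathFam Y a # \<Gamma>)" by (rule ctx_Cons)
  have "PathFam Y a # \<Gamma> \<turnstile>
      TId (PathSpace (\<up>Y)) (TPair (\<up>a) (TPair (\<up>a) (TRefl (\<up>a)))) (TPair (\<up>a) v0) \<Colon> TUniv u"
    by (insert Y P1 a; (assumption | rule tyP | simp (no_asm))+)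
  then show "TSig Y (TId (\<up>Y) (\<up>a) v0) # \<Gamma> \<turnstile>
      TId (PathSpace (\<up>Y)) (TPair (\<up>a) (TPair (\<up>a) (TRefl (\<up>a)))) (TPair (\<up>a) v0) \<Colon> TUniv u"
    by (simp add: PathFam_def)
  show "inh (TId (\<up>Y) (\<up>a) v0 # Y # \<Gamma>)
     (TId (PathSpace (\<up>\<up>Y)) (TPair (\<up>\<up>a) (TPair (\<up>\<up>a) (TRefl (\<up>\<up>a)))) (TPair (\<up>\<up>a) (TPair v1 v0)))"
    apply (rule PathSpace_contract_1[OF Y2, where u = u])
    apply (insert Y a Y1 Y2)
       apply (assumption | rule tyP | simp (no_asm))+
    done
qed simp_all

lemma PathSpace_contract:
  assumes \<Gamma>: "ctx S \<Gamma>" and Y: "\<Gamma> \<turnstile> Y \<Colon> TUniv u" and z: "\<Gamma> \<turnstile> z \<Colon> PathSpace Y"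
    and R: "(\<lambda>a. TId (PathSpace Y) (TPair a (TPair a (TRefl a))) z) (Prj1 Y (PathFam (\<up>Y) v0) z) =
      R"
  shows "inh \<Gamma> R"
proof (rule inh_Sig_elim[OF \<Gamma> Y _ _ z[unfolded PathSpace_def]])
  have Y1: "ctx S (Y # \<Gamma>)" using Y by (rule ctx_Cons)
  show I: "Y # \<Gamma> \<turnstile> PathFam (\<up>Y) v0 \<Colon> TUniv u"
    by (insert Y Y1; (assumption | rule tyP | simp (no_asm))+)
  then have Y2: "ctx S (PathFam (\<up>Y) v0 # Y # \<Gamma>)" by (rule ctx_Cons)
  have "\<Gamma> \<turnstile> PathSpace Y \<Colon> TUniv u"
    by (insert Y; (assumption | rule tyP | simp (no_asm))+)
  then have P1: "ctx S (PathSpace Y # \<Gamma>)" by (rule ctx_Cons)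
  let ?a = "Prj1 (\<up>Y) (PathFam (\<up>\<up>Y) v0) v0"
  have v: "PathSpace Y # \<Gamma> \<turnstile> v0 \<Colon> PathSpace (\<up>Y)"
    by (insert P1; (assumption | rule tyP | simp (no_asm))+)
  have "PathSpace Y # \<Gamma> \<turnstile> ?a \<Colon> \<up>Y"
    by (insert Y P1 v; (assumption | rule tyP | simp (no_asm))+)
  then have "PathSpace Y # \<Gamma> \<turnstile> TId (PathSpace (\<up>Y)) (TPair ?a (TPair ?a (TRefl ?a))) v0 \<Colon> TUniv u"
    by - (insert Y P1 v; (assumption | rule tyP | simp (no_asm))+)
  then show "TSig Y (PathFam (\<up>Y) v0) # \<Gamma> \<turnstile> TId (PathSpace (\<up>Y)) (TPair ?a (TPair ?a (TRefl ?a)))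
    v0 \<Colon> TUniv u"
    by (simp add: PathSpace_def)
  let ?\<Delta> = "PathFam (\<up>Y) v0 # Y # \<Gamma>"
  let ?p = "TPair v1 v0"
  let ?b = "Prj1 (\<up>\<up>Y) (PathFam (\<up>\<up>\<up>Y) v0) ?p"
  have Y': "?\<Delta> \<turnstile> \<up>\<up>Y \<Colon> TUniv u"
    by (insert Y Y1 Y2; (assumption | rule tyP | simp (no_asm))+)
  have v1: "?\<Delta> \<turnstile> v1 \<Colon> \<up>\<up>Y" and v0: "?\<Delta> \<turnstile> v0 \<Colon> PathFam (\<up>\<up>Y) v1"
    using ty_lookup[OF Y2, of 0] ty_lookup[OF Y2, of "Suc 0"] by simp_all
  have p: "?\<Delta> \<turnstile> ?p \<Colon> PathSpace (\<up>\<up>Y)" by (rule PathSpace_pair[OF Y' v1 v0])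
  have "?\<Delta> \<turnstile> ?b \<Colon> \<up>\<up>Y"
    by (insert Y' p; (assumption | rule tyP | simp (no_asm))+)
  then have "?\<Delta> \<turnstile> TId (PathSpace (\<up>\<up>Y)) (TPair ?b (TPair ?b (TRefl ?b))) ?p \<Colon> TUniv u"
    by - (insert Y' p; (assumption | rule tyP | simp (no_asm))+)
  then show "inh ?\<Delta> (TId (PathSpace (\<up>\<up>Y)) (TPair ?b (TPair ?b (TRefl ?b))) ?p)"
    by (rule inh_convert[OF PathSpace_contract_2[OF Y2 Y' v1 v0]]) simp
qed (use R in simp_all)

end

context univalent_type_theory
begin

text \<open>By equivalence induction it suffices to consider precomposition with the identity.\<close>

lemma precomposition_injective:
  assumes \<Gamma>: "ctx S \<Gamma>"
    and X: "\<Gamma> \<turnstile> X \<Colon> TUniv u" and Z: "\<Gamma> \<turnstile> Z \<Colon> TUniv u" and Y: "\<Gamma> \<turnstile> Y \<Colon> TUniv v"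
    and f: "\<Gamma> \<turnstile> f \<Colon> Arr X Z" and g: "\<Gamma> \<turnstile> g \<Colon> Arr Z X"
    and fg: "inh (Z # \<Gamma>) (TId (\<up>Z) (TApp (\<up>f) (TApp (\<up>g) v0)) v0)"
    and gf: "inh (X # \<Gamma>) (TId (\<up>X) (TApp (\<up>g) (TApp (\<up>f) v0)) v0)"
    and p: "\<Gamma> \<turnstile> p \<Colon> Arr Z Y" and q: "\<Gamma> \<turnstile> q \<Colon> Arr Z Y"
    and eq: "inh \<Gamma> (TId (Arr X Y) (Comp X p f) (Comp X q f))"
  shows "inh \<Gamma> (TId (Arr Z Y) p q)"
proof -
  let ?U = "TUniv u"
  let ?M = "TPi (TPi v1 (\<up>\<up>\<up>\<up>\<up>Y)) (TPi (TPi v2 (\<up>\<up>\<up>\<up>\<up>\<up>Y))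
    (TPi (TId (TPi v4 (\<up>\<up>\<up>\<up>\<up>\<up>Y)) (TLam v4 (TApp v2 (TApp v3 v0))) (TLam v4 (TApp v1 (TApp v3 v0))))
      (TId (TPi v4 (\<up>\<up>\<up>\<up>\<up>\<up>\<up>Y)) v2 v1)))"
  let ?D1 = "TPi v0 (\<up>\<up>Y)" and ?D2 = "TPi v1 (\<up>\<up>\<up>Y)"
    and ?D3 = "TId (TPi v2 (\<up>\<up>\<up>\<up>Y)) (TLam v2 (TApp v2 (TApp (IdF v3) v0)))
      (TLam v2 (TApp v1 (TApp (IdF v3) v0)))"
    and ?D4 = "TId (TPi v3 (\<up>\<up>\<up>\<up>\<up>Y)) v2 v1"
  have "\<Gamma> \<turnstile> ?U \<Colon> TUniv (next_level u)" using \<Gamma> by (rule ty_Univ)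
  then have U1: "ctx S (?U # \<Gamma>)" by (rule ctx_Cons)
  then have "?U # \<Gamma> \<turnstile> ?U \<Colon> TUniv (next_level u)" by (rule ty_Univ)
  then have U2: "ctx S (?U # ?U # \<Gamma>)" by (rule ctx_Cons)
  have "?U # ?U # \<Gamma> \<turnstile> TPi v1 v1 \<Colon> TUniv u"
    by (insert U1 U2; (assumption | rule tyE | simp (no_asm))+)
  then have U3: "ctx S (TPi v1 v1 # ?U # ?U # \<Gamma>)" by (rule ctx_Cons)
  have M: "TPi v1 v1 # ?U # ?U # \<Gamma> \<turnstile> TPi (TPi v1 (\<up>\<up>\<up>\<up>Y)) (TPi (TPi v2 (\<up>\<up>\<up>\<up>\<up>Y))
    (TPi (TId (TPi v4 (\<up>\<up>\<up>\<up>\<up>\<up>Y)) (TLam v4 (TApp v2 (TApp v3 v0))) (TLam v4 (TApp v1 (TApp v3 v0))))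
      (TId (TPi v4 (\<up>\<up>\<up>\<up>\<up>\<up>\<up>Y)) v2 v1))) \<Colon> TUniv (u \<squnion> v)" (is "_ \<turnstile> ?M' \<Colon> _")
    by (insert U1 U2 U3 Y; (assumption | rule tyE | simp (no_asm) add: sup.left_commute)+)
  have "?U # \<Gamma> \<turnstile> ?D1 \<Colon> TUniv (u \<squnion> v)"
    by (insert U1 Y; (assumption | rule tyE | simp (no_asm))+)
  then have C1: "ctx S (?D1 # ?U # \<Gamma>)" by (rule ctx_Cons)
  have "?D1 # ?U # \<Gamma> \<turnstile> ?D2 \<Colon> TUniv (u \<squnion> v)"
    by (insert U1 C1 Y; (assumption | rule tyE | simp (no_asm))+)
  then have C2: "ctx S (?D2 # ?D1 # ?U # \<Gamma>)" by (rule ctx_Cons)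
  have "?D2 # ?D1 # ?U # \<Gamma> \<turnstile> ?D3 \<Colon> TUniv (u \<squnion> v)"
    by (insert U1 C1 C2 Y; (assumption | rule tyE | simp (no_asm))+)
  then have C3: "ctx S (?D3 # ?D2 # ?D1 # ?U # \<Gamma>)" by (rule ctx_Cons)
  have "?D3 # ?D2 # ?D1 # ?U # \<Gamma> \<turnstile> ?D4 \<Colon> TUniv (u \<squnion> v)"
    by (insert U1 C1 C2 C3 Y; (assumption | rule tyE | simp (no_asm))+)
  moreover have "inh (?D3 # ?D2 # ?D1 # ?U # \<Gamma>) (\<up>?D3)"
    using ty_lookup[OF C3, of 0] by (intro inhI) simp
  ultimately have "inh (?D3 # ?D2 # ?D1 # ?U # \<Gamma>) ?D4"
    by - (rule inh_convert, assumption, assumption, simp)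
  then have base: "inh (?U # \<Gamma>) (TPi ?D1 (TPi ?D2 (TPi ?D3 ?D4)))" by (intro inh_Pi)
  have "inh \<Gamma> (TPi (Arr Z Y) (TPi (Arr (\<up>Z) (\<up>Y)) (TPi
      (TId (Arr (\<up>\<up>X) (\<up>\<up>Y)) (Comp (\<up>\<up>X) v1 (\<up>\<up>f)) (Comp (\<up>\<up>X) v0 (\<up>\<up>f)))
      (TId (Arr (\<up>\<up>\<up>Z) (\<up>\<up>\<up>Y)) v2 v1))))"
    by (rule equivalence_induction[OF \<Gamma> X Z M f g fg gf base]) simp_all
  from inh_Pi_elim[OF this p refl] have "inh \<Gamma> (TPi (Arr Z Y) (TPi
      (TId (Arr (\<up>X) (\<up>Y)) (Comp (\<up>X) (\<up>p) (\<up>f)) (Comp (\<up>X) v0 (\<up>f)))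
      (TId (Arr (\<up>\<up>Z) (\<up>\<up>Y)) (\<up>\<up>p) v1)))" by simp
  from inh_Pi_elim[OF this q refl] have "inh \<Gamma> (TPi
      (TId (Arr X Y) (Comp X p f) (Comp X q f)) (\<up>(TId (Arr Z Y) p q)))" by simp
  from inh_Arr_elim[OF this eq] show ?thesis .
qed

theorem function_extensionality:
  assumes \<Gamma>: "ctx S \<Gamma>"
    and A: "\<Gamma> \<turnstile> A \<Colon> TUniv u" and Y: "\<Gamma> \<turnstile> Y \<Colon> TUniv v"
    and f: "\<Gamma> \<turnstile> f \<Colon> Arr A Y" and g: "\<Gamma> \<turnstile> g \<Colon> Arr A Y"
    and fg: "inh (A # \<Gamma>) (TId (\<up>Y) (TApp (\<up>f) v0) (TApp (\<up>g) v0))"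
  shows "inh \<Gamma> (TId (Arr A Y) f g)"
proof -
  let ?D = "PathSpace Y"
  have D: "\<Gamma> \<turnstile> ?D \<Colon> TUniv v" using Y by (rule PathSpace_eq) simp
  then have D1: "ctx S (?D # \<Gamma>)" by (rule ctx_Cons)
  have Y1: "ctx S (Y # \<Gamma>)" using Y by (rule ctx_Cons)
  have A1: "ctx S (A # \<Gamma>)" using A by (rule ctx_Cons)
  define d where "d = TLam Y (TPair v0 (TPair v0 (TRefl v0)))"
  define p where "p = TLam ?D (Prj1 (\<up>Y) (PathFam (\<up>\<up>Y) v0) v0)"
  define q where "q = TLam ?D (Prj1 (\<up>Y) (TId (\<up>\<up>Y) (\<up>(Prj1 (\<up>Y) (PathFam (\<up>\<up>Y) v0) v0)) v0)
    (Prj2 (\<up>Y) (PathFam (\<up>\<up>Y) v0) v0))"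
  have d: "\<Gamma> \<turnstile> d \<Colon> Arr Y ?D" unfolding d_def
    by (insert Y; (simp (no_asm))?; (assumption | rule tyP | simp (no_asm))+)
  have p: "\<Gamma> \<turnstile> p \<Colon> Arr ?D Y" unfolding p_def
    by (insert D Y; (simp (no_asm))?; (assumption | rule tyP | simp (no_asm))+)
  have q: "\<Gamma> \<turnstile> q \<Colon> Arr ?D Y"
  proof -
    let ?a = "Prj1 (\<up>Y) (PathFam (\<up>\<up>Y) v0) v0"
    have v: "?D # \<Gamma> \<turnstile> v0 \<Colon> PathSpace (\<up>Y)" using ty_lookup[OF D1, of 0] by simp
    have Y': "?D # \<Gamma> \<turnstile> \<up>Y \<Colon> TUniv v" using weaken[OF Y D1] by simp
    have a: "?D # \<Gamma> \<turnstile> ?a \<Colon> \<up>Y" using Y' v by (rule PathSpace_fst) simp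
    have "?D # \<Gamma> \<turnstile> Prj2 (\<up>Y) (PathFam (\<up>\<up>Y) v0) v0 \<Colon> PathFam (\<up>Y) ?a"
    proof (rule Prj2_eq[OF D1 Y'])
      show "\<up>Y # ?D # \<Gamma> \<turnstile> PathFam (\<up>\<up>Y) v0 \<Colon> TUniv v" if "ctx S (\<up>Y # ?D # \<Gamma>)"
        by (insert that Y D1; (assumption | rule tyP | simp (no_asm))+)
    qed (use v in \<open>simp_all add: PathSpace_def\<close>)
    then have "?D # \<Gamma> \<turnstile> Prj2 (\<up>Y) (PathFam (\<up>\<up>Y) v0) v0 \<Colon> TSig (\<up>Y) (TId (\<up>\<up>Y) (\<up>?a) v0)"
      by (simp add: PathFam_def)
    moreover have "\<up>Y # ?D # \<Gamma> \<turnstile> TId (\<up>\<up>Y) (\<up>?a) v0 \<Colon> TUniv v" if c: "ctx S (\<up>Y # ?D # \<Gamma>)"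
      using weaken[OF Y' c] weaken[OF a c] ty_lookup[OF c, of 0] by (auto intro: ty_Id)
    ultimately show ?thesis unfolding q_def by (intro ty_Lam Prj1_eq[OF Y']) auto
  qed
  have "inh \<Gamma> (TId (Arr ?D Y) p q)"
  proof (rule precomposition_injective[OF \<Gamma> Y D Y d p _ _ p q])
    have "Y # \<Gamma> \<turnstile> TId (\<up>Y) (TApp (\<up>p) (TApp (\<up>d) v0)) v0 \<Colon> TUniv v"
      by (insert d p Y Y1; (assumption | rule tyP | simp (no_asm))+)
    moreover have "inh (Y # \<Gamma>) (TId (\<up>Y) v0 v0)"
      by (rule inh_refl) (insert Y Y1; (assumption | rule tyP | simp (no_asm))+)
    ultimately show "inh (Y # \<Gamma>) (TId (\<up>Y) (TApp (\<up>p) (TApp (\<up>d) v0)) v0)"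
      by - (rule inh_convert, assumption, assumption, simp add: p_def d_def PathSpace_def
        PathFam_def)
    have "?D # \<Gamma> \<turnstile> TId (\<up>?D) (TApp (\<up>d) (TApp (\<up>p) v0)) v0 \<Colon> TUniv v"
      by (insert d p D D1 Y; (simp (no_asm))?; (assumption | rule tyP | simp (no_asm))+)
    moreover have "?D # \<Gamma> \<turnstile> \<up>Y \<Colon> TUniv v" "?D # \<Gamma> \<turnstile> v0 \<Colon> PathSpace (\<up>Y)"
      using weaken[OF Y D1] ty_lookup[OF D1, of 0] by simp_all
    note PathSpace_contract[OF D1 this refl]
    ultimately show "inh (?D # \<Gamma>) (TId (\<up>?D) (TApp (\<up>d) (TApp (\<up>p) v0)) v0)"
      by - (rule inh_convert, assumption, assumption, simp add: p_def d_def PathSpace_def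
        PathFam_def)
    have "\<Gamma> \<turnstile> TId (Arr Y Y) (Comp Y p d) (Comp Y q d) \<Colon> TUniv v"
      by (insert d p q Y; (assumption | rule tyP | simp (no_asm))+)
    moreover have "inh \<Gamma> (TId (Arr Y Y) (IdF Y) (IdF Y))"
      by (rule inh_refl) (insert Y; (assumption | rule tyP | simp (no_asm))+)
    ultimately show "inh \<Gamma> (TId (Arr Y Y) (Comp Y p d) (Comp Y q d))"
      by - (rule inh_convert, assumption, assumption, simp add: p_def d_def q_def PathSpace_def
        PathFam_def)
  qed
  from fg obtain h where h: "A # \<Gamma> \<turnstile> h \<Colon> TId (\<up>Y) (TApp (\<up>f) v0) (TApp (\<up>g) v0)"
    by (auto simp: inh_def)
  define k where "k = TLam A (TPair (TApp (\<up>f) v0) (TPair (TApp (\<up>g) v0) h))"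
  have k: "\<Gamma> \<turnstile> k \<Colon> Arr A ?D" unfolding k_def
    by (insert A A1 Y f g h; (simp (no_asm))?; (assumption | rule tyP | simp (no_asm))+)
  let ?C = "TId (Arr (\<up>A) (\<up>Y)) (\<up>f) (TLam (\<up>A) (TApp v1 (TApp (\<up>\<up>k) v0)))"
  have P: "\<Gamma> \<turnstile> Arr ?D Y \<Colon> TUniv v" 
    by (insert D Y; (assumption | rule tyP | simp (no_asm))+)
  then have P1: "ctx S (Arr ?D Y # \<Gamma>)" by (rule ctx_Cons)
  have "inh \<Gamma> (TId (Arr A Y) f (Comp A q k))"
  proof (rule leibniz[OF \<Gamma> P _ p q \<open>inh \<Gamma> (TId (Arr ?D Y) p q)\<close>])
    show "Arr ?D Y # \<Gamma> \<turnstile> ?C \<Colon> TUniv (u \<squnion> v)"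
      by (insert P1 A f k Y; (assumption | rule tyP | simp (no_asm))+)
    have "\<Gamma> \<turnstile> TId (Arr A Y) f (Comp A p k) \<Colon> TUniv (u \<squnion> v)"
      by (insert A f k p Y; (assumption | rule tyP | simp (no_asm))+)
    then show "inh \<Gamma> (TId (Arr A Y) f (Comp A p k))"
      by (rule inh_convert[OF inh_refl[OF f]]) (simp add: p_def k_def PathSpace_def PathFam_def)
  qed simp_all
  moreover have "\<Gamma> \<turnstile> TId (Arr A Y) f g \<Colon> TUniv (u \<squnion> v)"
    by (insert A f g Y; (assumption | rule tyP | simp (no_asm))+)
  ultimately show ?thesis
    by (rule inh_convert) (simp add: q_def k_def PathSpace_def PathFam_def)
qed

end

section \<open>Propositions\<close>

definition IsProp :: "'l tm \<Rightarrow> 'l tm" where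
  "IsProp A = TPi A (TPi (\<up>A) (TId (\<up>\<up>A) v1 v0))"

lemma IsProp_simps [simp]:
  "shift k (IsProp A) = IsProp (shift k A)"
  "subst k s (IsProp A) = IsProp (subst k s A)"
  by (simp_all add: IsProp_def)

text \<open>\<open>Tr A x y p z q\<close> is the composite of the inverse of \<open>p : x = y\<close> with \<open>q : x = z\<close>.\<close>

definition Tr :: "'l tm \<Rightarrow> 'l tm \<Rightarrow> 'l tm \<Rightarrow> 'l tm \<Rightarrow> 'l tm \<Rightarrow> 'l tm \<Rightarrow> 'l tm" where
  "Tr A x y p z q = TApp (TApp (TIdInd
    (TLam A (TLam (\<up>A) (TLam (TId (\<up>\<up>A) v1 v0)
      (TPi (\<up>\<up>\<up>A) (TPi (TId (\<up>\<up>\<up>\<up>A) v3 v0)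
        (TId (\<up>\<up>\<up>\<up>\<up>A) v3 v1))))))
    (TLam A (TLam (\<up>A) (TLam (TId (\<up>\<up>A) v1 v0) v0))) x y p) z) q"

lemma Tr_simps [simp]:
  "shift k (Tr A x y p z q) =
    Tr (shift k A) (shift k x) (shift k y) (shift k p) (shift k z) (shift k q)"
  "subst k s (Tr A x y p z q) =
    Tr (subst k s A) (subst k s x) (subst k s y) (subst k s p) (subst k s z) (subst k s q)"
  by (simp_all add: Tr_def)

context type_theory
begin

lemma IsProp_eq:
  assumes "\<Gamma> \<turnstile> A \<Colon> TUniv u" "TUniv u = C"
  shows "\<Gamma> \<turnstile> IsProp A \<Colon> C"
  unfolding IsProp_def assms(2)[symmetric]
  by (insert assms(1); (assumption | rule tyE | simp (no_asm))+)

lemma IsProp_app: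
  assumes "\<Gamma> \<turnstile> i \<Colon> IsProp A" "\<Gamma> \<turnstile> a \<Colon> A" "\<Gamma> \<turnstile> b \<Colon> A"
  shows "\<Gamma> \<turnstile> TApp (TApp i a) b \<Colon> TId A a b"
  by (insert assms(2,3) assms(1)[unfolded IsProp_def]; (assumption | rule tyE | simp (no_asm))+)

lemma inh_IsProp_app:
  "inh \<Gamma> (IsProp A) \<Longrightarrow> \<Gamma> \<turnstile> a \<Colon> A \<Longrightarrow> \<Gamma> \<turnstile> b \<Colon> A \<Longrightarrow> inh \<Gamma> (TId A a b)"
  unfolding inh_def by (blast intro: IsProp_app)

lemma Tr_eq:
  assumes \<Gamma>: "ctx S \<Gamma>" and A: "\<Gamma> \<turnstile> A \<Colon> TUniv u" and x: "\<Gamma> \<turnstile> x \<Colon> A" and y: "\<Gamma> \<turnstile> y \<Colon> A"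
    and p: "\<Gamma> \<turnstile> p \<Colon> TId A x y" and z: "\<Gamma> \<turnstile> z \<Colon> A" and q: "\<Gamma> \<turnstile> q \<Colon> TId A x z"
    and C: "TId A y z = C"
  shows "\<Gamma> \<turnstile> Tr A x y p z q \<Colon> C"
proof -
  let ?M = "TPi (\<up>\<up>\<up>A) (TPi (TId (\<up>\<up>\<up>\<up>A) v3 v0) (TId (\<up>\<up>\<up>\<up>\<up>A) v3 v1))"
  define K where "K = TLam A (TLam (\<up>A) (TLam (TId (\<up>\<up>A) v1 v0) ?M))"
  define d where "d = TLam A (TLam (\<up>A) (TLam (TId (\<up>\<up>A) v1 v0) v0))"
  have A1: "ctx S (A # \<Gamma>)" using A by (rule ctx_Cons)
  have K: "\<Gamma> \<turnstile> K \<Colon> TPi A (TPi (\<up>A) (TPi (TId (\<up>\<up>A) v1 v0) (TUniv u)))"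
    unfolding K_def by (insert A; (assumption | rule tyE | simp (no_asm))+)
  have "A # \<Gamma> \<turnstile> TLam (\<up>A) (TLam (TId (\<up>\<up>A) v1 v0) v0) \<Colon>
      TPi (\<up>A) (TPi (TId (\<up>\<up>A) v1 v0) (TId (\<up>\<up>\<up>A) v2 v1))"
    by (insert A A1; (assumption | rule tyE | simp (no_asm))+)
  moreover have "A # \<Gamma> \<turnstile> TApp (TApp (TApp (\<up>K) v0) v0) (TRefl v0) \<Colon> TUniv u"
    by (insert A A1 K; (assumption | rule tyE | simp (no_asm))+)
  ultimately have "A # \<Gamma> \<turnstile> TLam (\<up>A) (TLam (TId (\<up>\<up>A) v1 v0) v0) \<Colon>
      TApp (TApp (TApp (\<up>K) v0) v0) (TRefl v0)"
    by (rule ty_convert) (simp add: K_def)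
  from ty_IdInd[unfolded One_nat_def, OF K ty_Lam[OF this] x y p]
  have "\<Gamma> \<turnstile> TIdInd K d x y p \<Colon> TApp (TApp (TApp K x) y) p" by (simp add: d_def)
  moreover have "\<Gamma> \<turnstile> TPi A (TPi (TId (\<up>A) (\<up>x) v0) (TId (\<up>\<up>A) (\<up>\<up>y) v1)) \<Colon> TUniv u"
    by (insert A x y; (assumption | rule tyE | simp (no_asm))+)
  ultimately have t: "\<Gamma> \<turnstile> TIdInd K d x y p \<Colon> TPi A (TPi (TId (\<up>A) (\<up>x) v0) (TId (\<up>\<up>A) (\<up>\<up>y) v1))"
    by (rule ty_convert) (simp add: K_def)
  have "\<Gamma> \<turnstile> TApp (TApp (TIdInd K d x y p) z) q \<Colon> TId A y z"
    by (insert t z q; (assumption | rule tyE | simp (no_asm))+)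
  then show ?thesis by (simp add: Tr_def K_def d_def C)
qed

lemmas tyB = IsProp_eq IsProp_app Tr_eq tyE

lemma Tr_self:
  assumes \<Gamma>: "ctx S \<Gamma>" and A: "\<Gamma> \<turnstile> A \<Colon> TUniv u" and x: "\<Gamma> \<turnstile> x \<Colon> A" and y: "\<Gamma> \<turnstile> y \<Colon> A"
    and p: "\<Gamma> \<turnstile> p \<Colon> TId A x y"
  shows "inh \<Gamma> (TId (TId A y y) (Tr A x y p y p) (TRefl y))"
proof (rule inh_Id_elim[OF \<Gamma> A _ x y p])
  have A1: "ctx S (A # \<Gamma>)" using A by (rule ctx_Cons)
  have "A # \<Gamma> \<turnstile> \<up>A \<Colon> TUniv u" using weaken[OF A A1] by simp
  then have A2: "ctx S (\<up>A # A # \<Gamma>)" by (rule ctx_Cons)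
  have "\<up>A # A # \<Gamma> \<turnstile> TId (\<up>\<up>A) v1 v0 \<Colon> TUniv u"
    by (insert A A1 A2; (assumption | rule tyB | simp (no_asm))+)
  then have A3: "ctx S (TId (\<up>\<up>A) v1 v0 # \<up>A # A # \<Gamma>)" by (rule ctx_Cons)
  show "TId (\<up>\<up>A) v1 v0 # \<up>A # A # \<Gamma> \<turnstile>
      TId (TId (\<up>\<up>\<up>A) v1 v1) (Tr (\<up>\<up>\<up>A) v2 v1 v0 v1 v0) (TRefl v1) \<Colon> TUniv u"
    by (insert A A1 A2 A3; (assumption | rule tyB | simp (no_asm))+)
  let ?r = "TRefl v0"
  have "A # \<Gamma> \<turnstile> TId (TId (\<up>A) v0 v0) (Tr (\<up>A) v0 v0 ?r v0 ?r) ?r \<Colon> TUniv u"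
    by (insert A A1; (assumption | rule tyB | simp (no_asm))+)
  moreover have "inh (A # \<Gamma>) (TId (TId (\<up>A) v0 v0) ?r ?r)"
    by (rule inh_refl) (insert A A1; (assumption | rule tyB | simp (no_asm))+)
  ultimately show "inh (A # \<Gamma>) (TId (TId (\<up>A) v0 v0) (Tr (\<up>A) v0 v0 ?r v0 ?r) ?r)"
    by - (rule inh_convert, assumption, assumption, simp add: Tr_def)
qed simp_all

lemma prop_is_set:
  assumes \<Gamma>: "ctx S \<Gamma>" and A: "\<Gamma> \<turnstile> A \<Colon> TUniv u" and i: "inh \<Gamma> (IsProp A)"
    and a: "\<Gamma> \<turnstile> a \<Colon> A" and b: "\<Gamma> \<turnstile> b \<Colon> A"
    and p: "\<Gamma> \<turnstile> p \<Colon> TId A a b" and q: "\<Gamma> \<turnstile> q \<Colon> TId A a b"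
  shows "inh \<Gamma> (TId (TId A a b) p q)"
proof -
  from i obtain i where i: "\<Gamma> \<turnstile> i \<Colon> IsProp A" by (auto simp: inh_def)
  have A1: "ctx S (A # \<Gamma>)" using A by (rule ctx_Cons)
  have A1': "A # \<Gamma> \<turnstile> \<up>A \<Colon> TUniv u" using weaken[OF A A1] by simp
  then have A2: "ctx S (\<up>A # A # \<Gamma>)" by (rule ctx_Cons)
  have "\<up>A # A # \<Gamma> \<turnstile> TId (\<up>\<up>A) v1 v0 \<Colon> TUniv u"
    by (insert A A1 A2; (assumption | rule tyB | simp (no_asm))+)
  then have A3: "ctx S (TId (\<up>\<up>A) v1 v0 # \<up>A # A # \<Gamma>)" by (rule ctx_Cons)
  let ?M = "TId (TId (\<up>\<up>\<up>A) v2 v1)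
    (Tr (\<up>\<up>\<up>A) v2 v2 (TApp (TApp (\<up>\<up>\<up>i) v2) v2) v1 (TApp (TApp (\<up>\<up>\<up>i) v2) v1)) v0"
  have M: "TId (\<up>\<up>A) v1 v0 # \<up>A # A # \<Gamma> \<turnstile> ?M \<Colon> TUniv u"
    by (insert i A A1 A2 A3; (assumption | rule tyB | simp (no_asm))+)
  have i1: "A # \<Gamma> \<turnstile> \<up>i \<Colon> IsProp (\<up>A)" using weaken[OF i A1] by simp
  have v: "A # \<Gamma> \<turnstile> v0 \<Colon> \<up>A" using ty_lookup[OF A1, of 0] by simp
  note base = Tr_self[OF A1 A1' v v IsProp_app[OF i1 v v]]
  let ?c = "Tr A a a (TApp (TApp i a) a) b (TApp (TApp i a) b)"
  have c: "\<Gamma> \<turnstile> ?c \<Colon> TId A a b"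
    by (insert \<Gamma> i A a b; (assumption | rule tyB | simp (no_asm))+)
  have *: "inh \<Gamma> (TId (TId A a b) ?c p)" if p: "\<Gamma> \<turnstile> p \<Colon> TId A a b" for p
    by (rule inh_Id_elim[OF \<Gamma> A M a b p base]) simp_all
  have I: "\<Gamma> \<turnstile> TId A a b \<Colon> TUniv u" using A a b by (rule ty_Id)
  show ?thesis by (rule inh_Id_trans[OF \<Gamma> I p c q inh_Id_sym[OF \<Gamma> I c p *[OF p]] *[OF q]])
qed

end

context univalent_type_theory
begin

text \<open>
  For \<open>a : P\<close> the maps \<open>\<lambda>x. a\<close> and \<open>\<lambda>x. x\<close> of \<open>P\<close> into itself are equal by (non-dependent) function
  extensionality, and along the first one every family over \<open>P\<close> becomes constant.
\<close>

lemma dependent_funext_pointed: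
  assumes \<Gamma>: "ctx S \<Gamma>" and P: "\<Gamma> \<turnstile> P \<Colon> TUniv u"
    and i: "inh \<Gamma> (IsProp P)" and a: "\<Gamma> \<turnstile> a \<Colon> P" and b: "\<Gamma> \<turnstile> b \<Colon> TPi P (TUniv v)"
    and f: "\<Gamma> \<turnstile> f \<Colon> TPi P (TApp (\<up>b) v0)" and g: "\<Gamma> \<turnstile> g \<Colon> TPi P (TApp (\<up>b) v0)"
    and fg: "inh (P # \<Gamma>) (TId (TApp (\<up>b) v0) (TApp (\<up>f) v0) (TApp (\<up>g) v0))"
  shows "inh \<Gamma> (TId (TPi P (TApp (\<up>b) v0)) f g)"
proof -
  let ?k = "TLam P (\<up>a)"
  have P1: "ctx S (P # \<Gamma>)" using P by (rule ctx_Cons)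
  have k: "\<Gamma> \<turnstile> ?k \<Colon> Arr P P" and id: "\<Gamma> \<turnstile> IdF P \<Colon> Arr P P"
    using weaken[OF a P1] ty_lookup[OF P1, of 0] by (auto intro: ty_Lam)
  have "inh \<Gamma> (TId (Arr P P) ?k (IdF P))"
  proof (rule function_extensionality[OF \<Gamma> P P k id])
    have "inh (P # \<Gamma>) (TId (\<up>P) (\<up>a) v0)"
      by (rule inh_IsProp_app[OF inh_weaken[OF i P1 refl, simplified]])
        (insert P1 a weaken[OF a P1] ty_lookup[OF P1, of 0], simp_all)
    moreover have "P # \<Gamma> \<turnstile> TId (\<up>P) (TApp (\<up>?k) v0) (TApp (\<up>(IdF P)) v0) \<Colon> TUniv u"
      by (insert P P1 a k; (simp (no_asm))?; (assumption | rule tyB | simp (no_asm))+)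
    ultimately show "inh (P # \<Gamma>) (TId (\<up>P) (TApp (\<up>?k) v0) (TApp (\<up>(IdF P)) v0))"
      by (rule inh_convert) simp
  qed
  then have q: "inh \<Gamma> (TId (Arr P P) ?k (IdF P))" .
  let ?F = "TApp b a"
  let ?D1 = "Arr P ?F"
  have F: "\<Gamma> \<turnstile> ?F \<Colon> TUniv v" by (insert a b; (assumption | rule tyB | simp (no_asm))+)
  have D1: "\<Gamma> \<turnstile> ?D1 \<Colon> TUniv (u \<squnion> v)" by (insert P a b; (assumption | rule tyB | simp (no_asm))+)
  then have C1: "ctx S (?D1 # \<Gamma>)" by (rule ctx_Cons)
  let ?D2 = "TPi (\<up>P) (TApp (\<up>\<up>b) (\<up>\<up>a))"
  have "?D1 # \<Gamma> \<turnstile> ?D2 \<Colon> TUniv (u \<squnion> v)" by (insert P a b C1;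
    (assumption | rule tyB | simp (no_asm))+)
  then have C2: "ctx S (?D2 # ?D1 # \<Gamma>)" by (rule ctx_Cons)
  let ?D3 = "TPi (\<up>\<up>P) (TId (TApp (\<up>\<up>\<up>b) (\<up>\<up>\<up>a)) (TApp v2 v0) (TApp v1 v0))"
  have "?D2 # ?D1 # \<Gamma> \<turnstile> ?D3 \<Colon> TUniv (u \<squnion> v)" by (insert P a b C1 C2;
    (assumption | rule tyB | simp (no_asm))+)
  then have C3: "ctx S (?D3 # ?D2 # ?D1 # \<Gamma>)" by (rule ctx_Cons)
  let ?\<Delta> = "?D3 # ?D2 # ?D1 # \<Gamma>"
  let ?D4 = "TId (TPi (\<up>\<up>\<up>P) (TApp (\<up>\<up>\<up>\<up>b) (\<up>\<up>\<up>\<up>a))) v2 v1"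
  have P3: "?\<Delta> \<turnstile> \<up>\<up>\<up>P \<Colon> TUniv u" by (insert P C1 C2 C3; (assumption | rule tyB | simp (no_asm))+)
  have F3: "?\<Delta> \<turnstile> TApp (\<up>\<up>\<up>b) (\<up>\<up>\<up>a) \<Colon> TUniv v"
    by (insert a b C1 C2 C3; (assumption | rule tyB | simp (no_asm))+)
  have v2: "?\<Delta> \<turnstile> v2 \<Colon> Arr (\<up>\<up>\<up>P) (TApp (\<up>\<up>\<up>b) (\<up>\<up>\<up>a))"
  and v1: "?\<Delta> \<turnstile> v1 \<Colon> Arr (\<up>\<up>\<up>P) (TApp (\<up>\<up>\<up>b) (\<up>\<up>\<up>a))"
    and v0: "inh ?\<Delta> (TPi (\<up>\<up>\<up>P) (TId (TApp (\<up>\<up>\<up>\<up>b) (\<up>\<up>\<up>\<up>a)) (TApp v3 v0) (TApp v2 v0)))"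
    using ty_lookup[OF C3, of "Suc (Suc 0)"] ty_lookup[OF C3, of "Suc 0"]
      inhI[OF ty_lookup[OF C3, of 0]] by simp_all
  from inh_Pi_open[OF v0 ctx_Cons[OF P3]]
  have "inh ?\<Delta> ?D4" using function_extensionality[OF C3 P3 F3 v2 v1] by simp
  then have base: "inh \<Gamma> (TPi ?D1 (TPi ?D2 (TPi ?D3 ?D4)))" by (intro inh_Pi)
  have K: "\<Gamma> \<turnstile> Arr P P \<Colon> TUniv u" by (insert P; (assumption | rule tyB | simp (no_asm))+)
  then have K1: "ctx S (Arr P P # \<Gamma>)" by (rule ctx_Cons)
  let ?C = "TPi (TPi (\<up>P) (TApp (\<up>\<up>b) (TApp v1 v0))) (TPi (TPi (\<up>\<up>P) (TApp (\<up>\<up>\<up>b) (TApp v2 v0)))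
    (TPi (TPi (\<up>\<up>\<up>P) (TId (TApp (\<up>\<up>\<up>\<up>b) (TApp v3 v0)) (TApp v2 v0) (TApp v1 v0)))
      (TId (TPi (\<up>\<up>\<up>\<up>P) (TApp (\<up>\<up>\<up>\<up>\<up>b) (TApp v4 v0))) v2 v1)))"
  have C: "Arr P P # \<Gamma> \<turnstile> ?C \<Colon> TUniv (u \<squnion> v)"
    by (insert P b K1; (assumption | rule tyB | simp (no_asm) add: sup.left_commute)+)
  have k_inh: "inh \<Gamma> (subst 0 ?k ?C)"
    using substitute[OF C k \<Gamma>] by - (rule inh_convert[OF base], simp, simp)
  have "inh \<Gamma> (subst 0 (IdF P) ?C)"
    by (rule leibniz[OF \<Gamma> K C k id q refl k_inh refl])
  moreover have "\<Gamma> \<turnstile> TPi (TPi P (TApp (\<up>b) v0)) (TPi (TPi (\<up>P) (TApp (\<up>\<up>b) v0))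
    (TPi (TPi (\<up>\<up>P) (TId (TApp (\<up>\<up>\<up>b) v0) (TApp v2 v0) (TApp v1 v0)))
      (TId (TPi (\<up>\<up>\<up>P) (TApp (\<up>\<up>\<up>\<up>b) v0)) v2 v1))) \<Colon> TUniv (u \<squnion> v)"
    by (insert P b \<Gamma>; (assumption | rule tyB | simp (no_asm) add: sup.left_commute)+)
  ultimately have "inh \<Gamma> (TPi (TPi P (TApp (\<up>b) v0)) (TPi (TPi (\<up>P) (TApp (\<up>\<up>b) v0))
    (TPi (TPi (\<up>\<up>P) (TId (TApp (\<up>\<up>\<up>b) v0) (TApp v2 v0) (TApp v1 v0)))
      (TId (TPi (\<up>\<up>\<up>P) (TApp (\<up>\<up>\<up>\<up>b) v0)) v2 v1))))"
    by (rule inh_convert) simp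
  from inh_Pi_elim[OF this f refl] have "inh \<Gamma> (TPi (TPi P (TApp (\<up>b) v0))
    (TPi (TPi (\<up>P) (TId (TApp (\<up>\<up>b) v0) (TApp (\<up>\<up>f) v0) (TApp v1 v0)))
      (TId (TPi (\<up>\<up>P) (TApp (\<up>\<up>\<up>b) v0)) (\<up>\<up>f) v1)))" by simp
  from inh_Pi_elim[OF this g refl]
  have "inh \<Gamma> (Arr (TPi P (TId (TApp (\<up>b) v0) (TApp (\<up>f) v0) (TApp (\<up>g) v0)))
      (TId (TPi P (TApp (\<up>b) v0)) f g))" by simp
  from inh_Arr_elim[OF this inh_Pi[OF fg]] show ?thesis .
qed

text \<open>Without a given point, one compares the constant maps \<open>\<lambda>_. f\<close> and \<open>\<lambda>_. g\<close> on \<open>P\<close>.\<close>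

lemma dependent_funext:
  assumes \<Gamma>: "ctx S \<Gamma>" and P: "\<Gamma> \<turnstile> P \<Colon> TUniv u"
    and i: "inh \<Gamma> (IsProp P)" and B: "P # \<Gamma> \<turnstile> B \<Colon> TUniv v"
    and f: "\<Gamma> \<turnstile> f \<Colon> TPi P B" and g: "\<Gamma> \<turnstile> g \<Colon> TPi P B"
    and fg: "inh (P # \<Gamma>) (TId B (TApp (\<up>f) v0) (TApp (\<up>g) v0))"
  shows "inh \<Gamma> (TId (TPi P B) f g)"
proof -
  have P1: "ctx S (P # \<Gamma>)" using P by (rule ctx_Cons)
  have P1': "P # \<Gamma> \<turnstile> \<up>P \<Colon> TUniv u" using weaken[OF P P1] by simp
  then have P2: "ctx S (\<up>P # P # \<Gamma>)" by (rule ctx_Cons)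
  define b where "b = TLam P B"
  have b: "\<Gamma> \<turnstile> b \<Colon> TPi P (TUniv v)" unfolding b_def using B by (rule ty_Lam)
  let ?Q = "TPi P (TApp (\<up>b) v0)"
  have Q: "\<Gamma> \<turnstile> ?Q \<Colon> TUniv (u \<squnion> v)"
    by (insert P b; (assumption | rule tyB | simp (no_asm))+)
  have f': "\<Gamma> \<turnstile> f \<Colon> ?Q" and g': "\<Gamma> \<turnstile> g \<Colon> ?Q"
    by (rule ty_convert[OF f Q] ty_convert[OF g Q]; simp add: b_def)+
  have "P # \<Gamma> \<turnstile> TId (TApp (\<up>b) v0) (TApp (\<up>f) v0) (TApp (\<up>g) v0) \<Colon> TUniv v"
    by (insert P P1 b f' g'; (assumption | rule tyB | simp (no_asm))+)
  then have fg': "inh (P # \<Gamma>) (TId (TApp (\<up>b) v0) (TApp (\<up>f) v0) (TApp (\<up>g) v0))"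
    by (rule inh_convert[OF fg]) (simp add: b_def)
  have i1: "inh (P # \<Gamma>) (IsProp (\<up>P))" using i P1 by (rule inh_weaken) simp
  have v: "P # \<Gamma> \<turnstile> v0 \<Colon> \<up>P" using ty_lookup[OF P1, of 0] by simp
  have b1: "P # \<Gamma> \<turnstile> \<up>b \<Colon> TPi (\<up>P) (TUniv v)"
    and f1: "P # \<Gamma> \<turnstile> \<up>f \<Colon> TPi (\<up>P) (TApp (\<up>\<up>b) v0)"
    and g1: "P # \<Gamma> \<turnstile> \<up>g \<Colon> TPi (\<up>P) (TApp (\<up>\<up>b) v0)"
    using weaken[OF b P1] weaken[OF f' P1] weaken[OF g' P1] by simp_all
  have fg1: "inh (\<up>P # P # \<Gamma>) (TId (TApp (\<up>\<up>b) v0) (TApp (\<up>\<up>f) v0) (TApp (\<up>\<up>g) v0))"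
    using inh_weaken[OF inh_Pi[OF fg'] P1 refl] by (intro inh_Pi_open[OF _ P2]) simp
  from dependent_funext_pointed[OF P1 P1' i1 v b1 f1 g1 fg1]
  have eq: "inh (P # \<Gamma>) (TId (\<up>?Q) (\<up>f) (\<up>g))" by simp
  have F: "\<Gamma> \<turnstile> TLam P (\<up>f) \<Colon> Arr P ?Q" and G: "\<Gamma> \<turnstile> TLam P (\<up>g) \<Colon> Arr P ?Q"
    using weaken[OF f' P1] weaken[OF g' P1] by (auto intro: ty_Lam)
  have FG: "inh \<Gamma> (TId (Arr P ?Q) (TLam P (\<up>f)) (TLam P (\<up>g)))"
  proof (rule function_extensionality[OF \<Gamma> P Q F G])
    have "P # \<Gamma> \<turnstile> TApp (\<up>(TLam P (\<up>f))) v0 \<Colon> \<up>?Q" "P # \<Gamma> \<turnstile> TApp (\<up>(TLam P (\<up>g))) v0 \<Colon> \<up>?Q"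
      using ty_App[OF weaken[OF F P1, simplified] v] ty_App[OF weaken[OF G P1, simplified] v]
        by simp_all
    note ty_Id[OF weaken[OF Q P1, simplified] this[simplified]]
    then have "P # \<Gamma> \<turnstile> TId (\<up>?Q) (TApp (\<up>(TLam P (\<up>f))) v0) (TApp (\<up>(TLam P (\<up>g))) v0)
      \<Colon> TUniv (u \<squnion> v)"
      by simp
    then show "inh (P # \<Gamma>) (TId (\<up>?Q) (TApp (\<up>(TLam P (\<up>f))) v0) (TApp (\<up>(TLam P (\<up>g))) v0))"
      by (rule inh_convert[OF eq]) simp
  qed
  let ?R = "Arr P ?Q"
  have R: "\<Gamma> \<turnstile> ?R \<Colon> TUniv (u \<squnion> v)"
    by (insert P b; (assumption | rule tyB | simp (no_asm))+)
  then have R1: "ctx S (?R # \<Gamma>)" by (rule ctx_Cons)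
  have t: "?R # \<Gamma> \<turnstile> TLam (\<up>P) (TApp (TApp v1 v0) v0) \<Colon> \<up>?Q"
    by (insert P b R1[simplified]; (simp (no_asm))?; (assumption | rule tyB | simp (no_asm))+)
  have "inh \<Gamma> (TId ?Q (TLam P (TApp (TApp (\<up>(TLam P (\<up>f))) v0) v0))
      (TLam P (TApp (TApp (\<up>(TLam P (\<up>g))) v0) v0)))"
    by (rule inh_Id_cong[OF \<Gamma> R Q t F G FG]) simp_all
  moreover have "\<Gamma> \<turnstile> TPi P B \<Colon> TUniv (u \<squnion> v)" using P B by (rule ty_Pi)
  then have "\<Gamma> \<turnstile> TId (TPi P B) f g \<Colon> TUniv (u \<squnion> v)" using f g by (rule ty_Id)
  ultimately show ?thesis by (rule inh_convert) (simp add: b_def)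
qed

lemma IsProp_unique:
  assumes \<Gamma>: "ctx S \<Gamma>" and P: "\<Gamma> \<turnstile> P \<Colon> TUniv u"
    and i: "\<Gamma> \<turnstile> i \<Colon> IsProp P" and j: "\<Gamma> \<turnstile> j \<Colon> IsProp P"
  shows "inh \<Gamma> (TId (IsProp P) i j)"
  unfolding IsProp_def
proof (rule dependent_funext[OF \<Gamma> P inhI[OF i]])
  have P1: "ctx S (P # \<Gamma>)" using P by (rule ctx_Cons)
  have P1': "P # \<Gamma> \<turnstile> \<up>P \<Colon> TUniv u" using weaken[OF P P1] by simp
  then have P2: "ctx S (\<up>P # P # \<Gamma>)" by (rule ctx_Cons)
  show "P # \<Gamma> \<turnstile> TPi (\<up>P) (TId (\<up>\<up>P) v1 v0) \<Colon> TUniv u"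
    by (insert P P1; (assumption | rule tyB | simp (no_asm))+)
  show i': "\<Gamma> \<turnstile> i \<Colon> TPi P (TPi (\<up>P) (TId (\<up>\<up>P) v1 v0))"
    and j': "\<Gamma> \<turnstile> j \<Colon> TPi P (TPi (\<up>P) (TId (\<up>\<up>P) v1 v0))"
    using i j by (simp_all add: IsProp_def)
  show "inh (P # \<Gamma>) (TId (TPi (\<up>P) (TId (\<up>\<up>P) v1 v0)) (TApp (\<up>i) v0) (TApp (\<up>j) v0))"
  proof (rule dependent_funext[OF P1 P1'])
    show "inh (P # \<Gamma>) (IsProp (\<up>P))" using inhI[OF i] P1 by (rule inh_weaken) simp
    show "\<up>P # P # \<Gamma> \<turnstile> TId (\<up>\<up>P) v1 v0 \<Colon> TUniv u"
      by (insert P P1 P2; (assumption | rule tyB | simp (no_asm))+)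
    show "P # \<Gamma> \<turnstile> TApp (\<up>i) v0 \<Colon> TPi (\<up>P) (TId (\<up>\<up>P) v1 v0)"
      by (insert P P1 i'; (assumption | rule tyB | simp (no_asm))+)
    show "P # \<Gamma> \<turnstile> TApp (\<up>j) v0 \<Colon> TPi (\<up>P) (TId (\<up>\<up>P) v1 v0)"
      by (insert P P1 j'; (assumption | rule tyB | simp (no_asm))+)
    have P2': "\<up>P # P # \<Gamma> \<turnstile> \<up>\<up>P \<Colon> TUniv u" using weaken[OF P1' P2] by simp
    have i2: "\<up>P # P # \<Gamma> \<turnstile> \<up>\<up>i \<Colon> IsProp (\<up>\<up>P)" and j2: "\<up>P # P # \<Gamma> \<turnstile> \<up>\<up>j \<Colon> IsProp (\<up>\<up>P)"
      using weaken[OF weaken[OF i P1] P2] weaken[OF weaken[OF j P1] P2] by simp_all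
    have v0: "\<up>P # P # \<Gamma> \<turnstile> v0 \<Colon> \<up>\<up>P" and v1: "\<up>P # P # \<Gamma> \<turnstile> v1 \<Colon> \<up>\<up>P"
      using ty_lookup[OF P2, of 0] ty_lookup[OF P2, of "Suc 0"] by simp_all
    from prop_is_set[OF P2 P2' inhI[OF i2] v1 v0 IsProp_app[OF i2 v1 v0] IsProp_app[OF j2 v1 v0]]
    show "inh (\<up>P # P # \<Gamma>) (TId (TId (\<up>\<up>P) v1 v0)
        (TApp (\<up>(TApp (\<up>i) v0)) v0) (TApp (\<up>(TApp (\<up>j) v0)) v0))"
      by simp
  qed
qed

end

section \<open>The lifting\<close>

definition LiftFam :: "'l tm \<Rightarrow> 'l tm" where
  "LiftFam X = TSig (TPi v0 (\<up>\<up>X)) (IsProp v1)"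

definition Lift :: "'l \<Rightarrow> 'l tm \<Rightarrow> 'l tm" where
  "Lift T X = TSig (TUniv T) (LiftFam X)"

definition LDom :: "'l \<Rightarrow> 'l tm \<Rightarrow> 'l tm \<Rightarrow> 'l tm" where
  "LDom T X l = Prj1 (TUniv T) (LiftFam X) l"

definition LRest :: "'l \<Rightarrow> 'l tm \<Rightarrow> 'l tm \<Rightarrow> 'l tm" where
  "LRest T X l = Prj2 (TUniv T) (LiftFam X) l"

definition LVal :: "'l \<Rightarrow> 'l tm \<Rightarrow> 'l tm \<Rightarrow> 'l tm" where
  "LVal T X l = Prj1 (Arr (LDom T X l) X) (\<up>(IsProp (LDom T X l))) (LRest T X l)"

definition LPrf :: "'l \<Rightarrow> 'l tm \<Rightarrow> 'l tm \<Rightarrow> 'l tm" where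
  "LPrf T X l = Prj2 (Arr (LDom T X l) X) (\<up>(IsProp (LDom T X l))) (LRest T X l)"

lemma LiftFam_simps:
  "shift (Suc k) (LiftFam X) = LiftFam (shift k X)"
  "subst (Suc k) (\<up>s) (LiftFam X) = LiftFam (subst k s X)"
  by (simp_all add: LiftFam_def)

lemma Lift_simps [simp]:
  "shift k (Lift T X) = Lift T (shift k X)"
  "subst k s (Lift T X) = Lift T (subst k s X)"
  "shift k (LDom T X l) = LDom T (shift k X) (shift k l)"
  "subst k s (LDom T X l) = LDom T (subst k s X) (subst k s l)"
  "shift k (LRest T X l) = LRest T (shift k X) (shift k l)"
  "subst k s (LRest T X l) = LRest T (subst k s X) (subst k s l)"
  "shift k (LVal T X l) = LVal T (shift k X) (shift k l)"
  "subst k s (LVal T X l) = LVal T (subst k s X) (subst k s l)"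
  "shift k (LPrf T X l) = LPrf T (shift k X) (shift k l)"
  "subst k s (LPrf T X l) = LPrf T (subst k s X) (subst k s l)"
  by (simp_all add: Lift_def LDom_def LRest_def LVal_def LPrf_def LiftFam_simps)

lift_definition cLift :: "'l \<Rightarrow> 'l ctm \<Rightarrow> 'l ctm" is Lift
  by (simp add: Lift_def LiftFam_def IsProp_def conv_iff)

lift_definition cLDom :: "'l \<Rightarrow> 'l ctm \<Rightarrow> 'l ctm \<Rightarrow> 'l ctm" is LDom
  by (simp add: LDom_def LiftFam_def IsProp_def conv_iff)

lift_definition cLVal :: "'l \<Rightarrow> 'l ctm \<Rightarrow> 'l ctm \<Rightarrow> 'l ctm" is LVal
  by (simp add: LVal_def LRest_def LDom_def LiftFam_def IsProp_def conv_iff)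

lift_definition cLPrf :: "'l \<Rightarrow> 'l ctm \<Rightarrow> 'l ctm \<Rightarrow> 'l ctm" is LPrf
  by (simp add: LPrf_def LRest_def LDom_def LiftFam_def IsProp_def conv_iff)

lift_definition cIsProp :: "'l ctm \<Rightarrow> 'l ctm" is IsProp
  by (simp add: IsProp_def conv_iff)

lemma abs_ctm_Lift [simp]:
  "abs_ctm (Lift T X) = cLift T (abs_ctm X)"
  "abs_ctm (LDom T X l) = cLDom T (abs_ctm X) (abs_ctm l)"
  "abs_ctm (LVal T X l) = cLVal T (abs_ctm X) (abs_ctm l)"
  "abs_ctm (LPrf T X l) = cLPrf T (abs_ctm X) (abs_ctm l)"
  "abs_ctm (IsProp X) = cIsProp (abs_ctm X)"
  by (simp_all add: cLift.abs_eq cLDom.abs_eq cLVal.abs_eq cLPrf.abs_eq cIsProp.abs_eq)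

lemma cLift_simps [simp]:
  "cshift k (cLift T X) = cLift T (cshift k X)"
  "csubst k s (cLift T X) = cLift T (csubst k s X)"
  "cshift k (cLDom T X l) = cLDom T (cshift k X) (cshift k l)"
  "csubst k s (cLDom T X l) = cLDom T (csubst k s X) (csubst k s l)"
  "cshift k (cLVal T X l) = cLVal T (cshift k X) (cshift k l)"
  "csubst k s (cLVal T X l) = cLVal T (csubst k s X) (csubst k s l)"
  "cshift k (cLPrf T X l) = cLPrf T (cshift k X) (cshift k l)"
  "csubst k s (cLPrf T X l) = cLPrf T (csubst k s X) (csubst k s l)"
  "cshift k (cIsProp X) = cIsProp (cshift k X)"
  "csubst k s (cIsProp X) = cIsProp (csubst k s X)"
  by (transfer; simp add: conv_refl)+

lemma cLift_pair [simp]: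
  "cLDom T X (cpair P r) = P"
  "cLVal T X (cpair P (cpair f i)) = f"
  "cLPrf T X (cpair P (cpair f i)) = i"
  by (transfer; simp add: LDom_def LRest_def LVal_def LPrf_def conv_iff)+

lemma sup_next_level [simp]:
  fixes u :: "'l::universe_level"
  shows "u \<squnion> next_level u = next_level u" "next_level u \<squnion> u = next_level u"
    "u \<squnion> (next_level u \<squnion> v) = next_level u \<squnion> v" "next_level u \<squnion> (u \<squnion> v) = next_level u \<squnion> v"
  using less_imp_le[OF less_next_level[of u]]
  by (simp_all add: sup_absorb1 sup_absorb2 sup_assoc[symmetric])

context type_theory
begin

lemma LiftFam_eq:
  assumes \<Gamma>: "ctx S \<Gamma>" and X: "\<Gamma> \<turnstile> X \<Colon> TUniv v"
  shows "TUniv T # \<Gamma> \<turnstile> LiftFam X \<Colon> TUniv (T \<squnion> v)"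
proof -
  have "ctx S (TUniv T # \<Gamma>)" by (rule ctx_Cons[OF ty_Univ[OF \<Gamma>]])
  then show ?thesis unfolding LiftFam_def
    by - (insert X; (assumption | rule tyB | simp (no_asm) add: sup_aci)+)
qed

lemma Lift_eq:
  assumes "ctx S \<Gamma>" "\<Gamma> \<turnstile> X \<Colon> TUniv v" "TUniv (next_level T \<squnion> v) = C"
  shows "\<Gamma> \<turnstile> Lift T X \<Colon> C"
  using ty_Sig[OF ty_Univ[OF assms(1)] LiftFam_eq[OF assms(1,2)], of T] assms(3)
    by (simp add: Lift_def)

lemma LDom_eq:
  assumes "ctx S \<Gamma>" "\<Gamma> \<turnstile> X \<Colon> TUniv v" "\<Gamma> \<turnstile> l \<Colon> Lift T X" "TUniv T = C"
  shows "\<Gamma> \<turnstile> LDom T X l \<Colon> C"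
  unfolding LDom_def
  by (rule Prj1_eq[OF ty_Univ[OF assms(1)] LiftFam_eq[OF assms(1,2)] assms(3)[unfolded Lift_def]
    assms(4)])

lemma LRest_eq:
  assumes "ctx S \<Gamma>" "\<Gamma> \<turnstile> X \<Colon> TUniv v" "\<Gamma> \<turnstile> l \<Colon> Lift T X"
  shows "\<Gamma> \<turnstile> LRest T X l \<Colon> TSig (Arr (LDom T X l) X) (\<up>(IsProp (LDom T X l)))"
  unfolding LRest_def
  by (rule Prj2_eq[OF assms(1) ty_Univ[OF assms(1)] LiftFam_eq[OF assms(1,2)]
    assms(3)[unfolded Lift_def]])
    (simp add: LiftFam_def LDom_def)

lemma LVal_eq:
  assumes "ctx S \<Gamma>" "\<Gamma> \<turnstile> X \<Colon> TUniv v" "\<Gamma> \<turnstile> l \<Colon> Lift T X" "Arr (LDom T X l) X = C"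
  shows "\<Gamma> \<turnstile> LVal T X l \<Colon> C"
proof -
  have "\<Gamma> \<turnstile> LDom T X l \<Colon> TUniv T" using assms LDom_eq by blast
  then show ?thesis unfolding LVal_def assms(4)[symmetric]
    by - (insert assms(2) LRest_eq[OF assms(1-3)]; (assumption | rule tyB | simp (no_asm))+)
qed

lemma LPrf_eq:
  assumes "ctx S \<Gamma>" "\<Gamma> \<turnstile> X \<Colon> TUniv v" "\<Gamma> \<turnstile> l \<Colon> Lift T X" "IsProp (LDom T X l) = C"
  shows "\<Gamma> \<turnstile> LPrf T X l \<Colon> C"
proof -
  have "\<Gamma> \<turnstile> LDom T X l \<Colon> TUniv T" using assms LDom_eq by blast
  then show ?thesis unfolding LPrf_def assms(4)[symmetric]
    by - (insert assms(1,2) LRest_eq[OF assms(1-3)]; (assumption | rule tyB | simp (no_asm))+)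
qed

lemma Lift_pair:
  assumes "ctx S \<Gamma>" "\<Gamma> \<turnstile> X \<Colon> TUniv v" "\<Gamma> \<turnstile> P \<Colon> TUniv T" "\<Gamma> \<turnstile> f \<Colon> Arr P X" "\<Gamma> \<turnstile> i \<Colon> IsProp P"
  shows "\<Gamma> \<turnstile> TPair P (TPair f i) \<Colon> Lift T X"
  unfolding Lift_def
proof (rule Pair_eq[OF ty_Univ[OF assms(1)] LiftFam_eq[OF assms(1,2)] assms(3)])
  show "subst 0 P (LiftFam X) = TSig (Arr P X) (\<up>(IsProp P))" by (simp add: LiftFam_def)
  show "\<Gamma> \<turnstile> TPair f i \<Colon> TSig (Arr P X) (\<up>(IsProp P))"
    by (insert assms; (assumption | rule tyB | simp (no_asm))+)
qed

lemmas tyL = Lift_eq LDom_eq LVal_eq LPrf_eq Lift_pair tyB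

end

context univalent_type_theory
begin

lemma Lift_ext_pointwise:
  assumes \<Gamma>: "ctx S \<Gamma>"
    and X: "\<Gamma> \<turnstile> X \<Colon> TUniv v" and P: "\<Gamma> \<turnstile> P \<Colon> TUniv T"
    and f: "\<Gamma> \<turnstile> f \<Colon> Arr P X" and g: "\<Gamma> \<turnstile> g \<Colon> Arr P X"
    and i: "\<Gamma> \<turnstile> i \<Colon> IsProp P" and j: "\<Gamma> \<turnstile> j \<Colon> IsProp P"
    and fg: "inh (P # \<Gamma>) (TId (\<up>X) (TApp (\<up>f) v0) (TApp (\<up>g) v0))"
  shows "inh \<Gamma> (TId (Lift T X) (TPair P (TPair f i)) (TPair P (TPair g j)))"
proof -
  have L: "\<Gamma> \<turnstile> Lift T X \<Colon> TUniv (next_level T \<squnion> v)" using \<Gamma> X by (rule Lift_eq) simp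
  have F: "\<Gamma> \<turnstile> Arr P X \<Colon> TUniv (T \<squnion> v)" by (insert P X; (assumption | rule tyL | simp (no_asm))+)
  then have F1: "ctx S (Arr P X # \<Gamma>)" by (rule ctx_Cons)
  have I: "\<Gamma> \<turnstile> IsProp P \<Colon> TUniv T" by (insert P; (assumption | rule tyL | simp (no_asm))+)
  then have I1: "ctx S (IsProp P # \<Gamma>)" by (rule ctx_Cons)
  have t1: "Arr P X # \<Gamma> \<turnstile> TPair (\<up>P) (TPair v0 (\<up>i)) \<Colon> \<up>(Lift T X)"
    by (insert P X i F1; simp; (assumption | rule tyL | simp (no_asm))+)
  have t2: "IsProp P # \<Gamma> \<turnstile> TPair (\<up>P) (TPair (\<up>g) v0) \<Colon> \<up>(Lift T X)"
    by (insert P X g I1; (simp (no_asm))?; (assumption | rule tyL | simp (no_asm))+)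
  have 1: "inh \<Gamma> (TId (Lift T X) (TPair P (TPair f i)) (TPair P (TPair g i)))"
    by (rule inh_Id_cong[OF \<Gamma> F L t1 f g function_extensionality[OF \<Gamma> P X f g fg]]) simp_all
  have 2: "inh \<Gamma> (TId (Lift T X) (TPair P (TPair g i)) (TPair P (TPair g j)))"
    by (rule inh_Id_cong[OF \<Gamma> I L t2 i j IsProp_unique[OF \<Gamma> P i j]]) simp_all
  show ?thesis
    by (rule inh_Id_trans[OF \<Gamma> L _ _ _ 1 2]) (rule Lift_pair[OF \<Gamma> X P]; fact)+
qed

theorem Lift_ext:
  assumes \<Gamma>: "ctx S \<Gamma>" and X: "\<Gamma> \<turnstile> X \<Colon> TUniv v"
    and P: "\<Gamma> \<turnstile> P \<Colon> TUniv T" and f: "\<Gamma> \<turnstile> f \<Colon> Arr P X" and i: "\<Gamma> \<turnstile> i \<Colon> IsProp P"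
    and Q: "\<Gamma> \<turnstile> Q \<Colon> TUniv T" and g: "\<Gamma> \<turnstile> g \<Colon> Arr Q X" and j: "\<Gamma> \<turnstile> j \<Colon> IsProp Q"
    and e: "\<Gamma> \<turnstile> e \<Colon> Arr P Q" and e': "\<Gamma> \<turnstile> e' \<Colon> Arr Q P"
    and fg: "inh (P # \<Gamma>) (TId (\<up>X) (TApp (\<up>f) v0) (TApp (\<up>g) (TApp (\<up>e) v0)))"
  shows "inh \<Gamma> (TId (Lift T X) (TPair P (TPair f i)) (TPair Q (TPair g j)))"
proof -
  let ?U = "TUniv T"
  have U: "\<Gamma> \<turnstile> ?U \<Colon> TUniv (next_level T)" using \<Gamma> by (rule ty_Univ)
  then have U1: "ctx S (?U # \<Gamma>)" by (rule ctx_Cons)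
  then have "?U # \<Gamma> \<turnstile> ?U \<Colon> TUniv (next_level T)" by (rule ty_Univ)
  then have U2: "ctx S (?U # ?U # \<Gamma>)" by (rule ctx_Cons)
  have "?U # ?U # \<Gamma> \<turnstile> TPi v1 v1 \<Colon> TUniv T"
    by (insert U1 U2; (assumption | rule tyL | simp (no_asm))+)
  then have U3: "ctx S (TPi v1 v1 # ?U # ?U # \<Gamma>)" by (rule ctx_Cons)
  let ?M = "TPi (TPi v2 (\<up>\<up>\<up>\<up>X)) (TPi (TPi v2 (\<up>\<up>\<up>\<up>\<up>X)) (TPi (IsProp v4) (TPi (IsProp v4)
      (TPi (TPi v6 (TId (\<up>\<up>\<up>\<up>\<up>\<up>\<up>\<up>X) (TApp v4 v0) (TApp v3 (TApp v5 v0))))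
        (TId (Lift T (\<up>\<up>\<up>\<up>\<up>\<up>\<up>\<up>X)) (TPair v7 (TPair v4 v2)) (TPair v6 (TPair v3 v1)))))))"
  obtain w where M: "TPi v1 v1 # ?U # ?U # \<Gamma> \<turnstile> ?M \<Colon> TUniv w"
  proof (rule that)
    show "TPi v1 v1 # ?U # ?U # \<Gamma> \<turnstile> ?M \<Colon> TUniv ((T \<squnion> v) \<squnion>
      ((T \<squnion> v) \<squnion> (T \<squnion> (T \<squnion> ((T \<squnion> v) \<squnion> (next_level T \<squnion> v))))))"
      by (insert U1 U2 U3 X; (assumption | rule tyL | simp (no_asm) add: sup_aci)+)
  qed
  let ?D1 = "TPi v0 (\<up>\<up>X)" and ?D2 = "TPi v1 (\<up>\<up>\<up>X)" and ?D3 = "IsProp v2" and ?D4 = "IsProp v3"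
    and ?D5 = "TPi v4 (TId (\<up>\<up>\<up>\<up>\<up>\<up>X) (TApp v4 v0) (TApp v3 (TApp (IdF v5) v0)))"
    and ?D6 = "TId (Lift T (\<up>\<up>\<up>\<up>\<up>\<up>X)) (TPair v5 (TPair v4 v2)) (TPair v5 (TPair v3 v1))"
  have "?U # \<Gamma> \<turnstile> ?D1 \<Colon> TUniv (T \<squnion> v)"
    by (insert U1 X; (assumption | rule tyL | simp (no_asm))+)
  then have C1: "ctx S (?D1 # ?U # \<Gamma>)" by (rule ctx_Cons)
  have "?D1 # ?U # \<Gamma> \<turnstile> ?D2 \<Colon> TUniv (T \<squnion> v)"
    by (insert U1 C1 X; (assumption | rule tyL | simp (no_asm))+)
  then have C2: "ctx S (?D2 # ?D1 # ?U # \<Gamma>)" by (rule ctx_Cons)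
  have "?D2 # ?D1 # ?U # \<Gamma> \<turnstile> ?D3 \<Colon> TUniv T"
    by (insert U1 C1 C2 X; (assumption | rule tyL | simp (no_asm))+)
  then have C3: "ctx S (?D3 # ?D2 # ?D1 # ?U # \<Gamma>)" by (rule ctx_Cons)
  have "?D3 # ?D2 # ?D1 # ?U # \<Gamma> \<turnstile> ?D4 \<Colon> TUniv T"
    by (insert U1 C1 C2 C3 X; (assumption | rule tyL | simp (no_asm))+)
  then have C4: "ctx S (?D4 # ?D3 # ?D2 # ?D1 # ?U # \<Gamma>)" by (rule ctx_Cons)
  have "?D4 # ?D3 # ?D2 # ?D1 # ?U # \<Gamma> \<turnstile> ?D5 \<Colon> TUniv (T \<squnion> v)"
    by (insert U1 C1 C2 C3 C4 X; (assumption | rule tyL | simp (no_asm))+)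
  then have C5: "ctx S (?D5 # ?D4 # ?D3 # ?D2 # ?D1 # ?U # \<Gamma>)" by (rule ctx_Cons)
  let ?\<Delta> = "?D5 # ?D4 # ?D3 # ?D2 # ?D1 # ?U # \<Gamma>"
  let ?X = "\<up>\<up>\<up>\<up>\<up>\<up>X"
  have X5: "?\<Delta> \<turnstile> ?X \<Colon> TUniv v"
    by (insert U1 C1 C2 C3 C4 C5 X; (assumption | rule tyL | simp (no_asm))+)
  have P5: "?\<Delta> \<turnstile> v5 \<Colon> TUniv T" and f5: "?\<Delta> \<turnstile> v4 \<Colon> Arr v5 ?X" and g5: "?\<Delta> \<turnstile> v3 \<Colon> Arr v5 ?X"
    and i5: "?\<Delta> \<turnstile> v2 \<Colon> IsProp v5" and j5: "?\<Delta> \<turnstile> v1 \<Colon> IsProp v5"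
    using ty_lookup[OF C5, of "Suc (Suc (Suc (Suc (Suc 0))))"]
      ty_lookup[OF C5, of "Suc (Suc (Suc (Suc 0)))"]
      ty_lookup[OF C5, of "Suc (Suc (Suc 0))"] ty_lookup[OF C5, of "Suc (Suc 0)"]
        ty_lookup[OF C5, of "Suc 0"]
    by simp_all
  have "inh ?\<Delta> (\<up>?D5)" using ty_lookup[OF C5, of 0] by (intro inhI) simp
  then have "inh ?\<Delta> (TPi v5 (TId (\<up>?X) (TApp v5 v0) (TApp v4 (TApp (IdF v6) v0))))"
    by simp
  from inh_Pi_open[OF this ctx_Cons[OF P5]]
  have h: "inh (v5 # ?\<Delta>) (TId (\<up>?X) (TApp v5 v0) (TApp v4 (TApp (IdF v6) v0)))" .
  have C6: "ctx S (v5 # ?\<Delta>)" by (rule ctx_Cons[OF P5])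
  have "v5 # ?\<Delta> \<turnstile> TId (\<up>?X) (TApp (\<up>v4) v0) (TApp (\<up>v3) v0) \<Colon> TUniv v"
    by (insert C6 X5 f5 g5; (assumption | rule tyL | simp (no_asm))+)
  then have "inh (v5 # ?\<Delta>) (TId (\<up>?X) (TApp (\<up>v4) v0) (TApp (\<up>v3) v0))"
    by (rule inh_convert[OF h]) simp
  from Lift_ext_pointwise[OF C5 X5 P5 f5 g5 i5 j5 this] have "inh ?\<Delta> ?D6" .
  then have base: "inh (?U # \<Gamma>) (TPi ?D1 (TPi ?D2 (TPi ?D3 (TPi ?D4 (TPi ?D5 ?D6)))))"
    by (intro inh_Pi)
  have P1: "ctx S (P # \<Gamma>)" using P by (rule ctx_Cons)
  have Q1: "ctx S (Q # \<Gamma>)" using Q by (rule ctx_Cons)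
  have "Q # \<Gamma> \<turnstile> \<up>j \<Colon> IsProp (\<up>Q)" "P # \<Gamma> \<turnstile> \<up>i \<Colon> IsProp (\<up>P)"
    using weaken[OF j Q1] weaken[OF i P1] by simp_all
  moreover have "Q # \<Gamma> \<turnstile> TApp (\<up>e) (TApp (\<up>e') v0) \<Colon> \<up>Q"
    by (insert Q1 e e'; (assumption | rule tyL | simp (no_asm))+)
  moreover have "P # \<Gamma> \<turnstile> TApp (\<up>e') (TApp (\<up>e) v0) \<Colon> \<up>P"
    by (insert P1 e e'; (assumption | rule tyL | simp (no_asm))+)
  ultimately have ee': "inh (Q # \<Gamma>) (TId (\<up>Q) (TApp (\<up>e) (TApp (\<up>e') v0)) v0)"
    and e'e: "inh (P # \<Gamma>) (TId (\<up>P) (TApp (\<up>e') (TApp (\<up>e) v0)) v0)"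
    using ty_lookup[OF Q1, of 0] ty_lookup[OF P1, of 0] by (auto intro!: inh_IsProp_app intro: inhI)
  have "inh \<Gamma> (TPi (Arr P X) (TPi (Arr (\<up>Q) (\<up>X)) (TPi (IsProp (\<up>\<up>P)) (TPi (IsProp (\<up>\<up>\<up>Q))
      (TPi (TPi (\<up>\<up>\<up>\<up>P) (TId (\<up>\<up>\<up>\<up>\<up>X) (TApp v4 v0) (TApp v3 (TApp (\<up>\<up>\<up>\<up>\<up>e) v0))))
        (TId (Lift T (\<up>\<up>\<up>\<up>\<up>X)) (TPair (\<up>\<up>\<up>\<up>\<up>P) (TPair v4 v2)) (TPair (\<up>\<up>\<up>\<up>\<up>Q) (TPair v3 v1))))))))"
    by (rule equivalence_induction[OF \<Gamma> P Q M e e' ee' e'e base]) simp_all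
  from inh_Pi_elim[OF this f refl] have "inh \<Gamma> (TPi (Arr Q X) (TPi (IsProp (\<up>P)) (TPi (IsProp (\<up>\<up>Q))
      (TPi (TPi (\<up>\<up>\<up>P) (TId (\<up>\<up>\<up>\<up>X) (TApp (\<up>\<up>\<up>\<up>f) v0) (TApp v3 (TApp (\<up>\<up>\<up>\<up>e) v0))))
        (TId (Lift T (\<up>\<up>\<up>\<up>X)) (TPair (\<up>\<up>\<up>\<up>P) (TPair (\<up>\<up>\<up>\<up>f) v2)) (TPair (\<up>\<up>\<up>\<up>Q) (TPair v3 v1)))))))"
    by simp
  from inh_Pi_elim[OF this g refl] have "inh \<Gamma> (TPi (IsProp P) (TPi (IsProp (\<up>Q))
      (TPi (TPi (\<up>\<up>P) (TId (\<up>\<up>\<up>X) (TApp (\<up>\<up>\<up>f) v0) (TApp (\<up>\<up>\<up>g) (TApp (\<up>\<up>\<up>e) v0))))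
        (TId (Lift T (\<up>\<up>\<up>X)) (TPair (\<up>\<up>\<up>P) (TPair (\<up>\<up>\<up>f) v2)) (TPair (\<up>\<up>\<up>Q) (TPair (\<up>\<up>\<up>g) v1))))))"
    by simp
  from inh_Pi_elim[OF this i refl] have "inh \<Gamma> (TPi (IsProp Q)
      (TPi (TPi (\<up>P) (TId (\<up>\<up>X) (TApp (\<up>\<up>f) v0) (TApp (\<up>\<up>g) (TApp (\<up>\<up>e) v0))))
        (TId (Lift T (\<up>\<up>X)) (TPair (\<up>\<up>P) (TPair (\<up>\<up>f) (\<up>\<up>i))) (TPair (\<up>\<up>Q) (TPair (\<up>\<up>g) v1)))))"
    by simp
  from inh_Pi_elim[OF this j refl] have "inh \<Gamma>
      (Arr (TPi P (TId (\<up>X) (TApp (\<up>f) v0) (TApp (\<up>g) (TApp (\<up>e) v0))))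
        (TId (Lift T X) (TPair P (TPair f i)) (TPair Q (TPair g j))))"
    by simp
  from inh_Arr_elim[OF this inh_Pi[OF fg]] show ?thesis .
qed

end

section \<open>Sums of partial elements and the monad structure\<close>

definition UnitPrf :: "'l \<Rightarrow> 'l tm" where
  "UnitPrf T = TLam (TUnit T)
    (TUnitInd (TLam (TUnit T) (TPi (TUnit T) (TId (TUnit T) v1 v0)))
      (TLam (TUnit T) (TUnitInd (TLam (TUnit T) (TId (TUnit T) (TStar T) v0)) (TRefl (TStar T)) v0))
      v0)"

text \<open>
  For a family \<open>f\<close> of partial elements of \<open>X\<close> over \<open>P\<close>, \<open>SDom\<close> is the sum of their domains,
  \<open>SPrj1\<close> and \<open>SPrj2\<close> are its projections, and \<open>SVal\<close> and \<open>SPrf\<close> are the other two components of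
  the value of the multiplication.
\<close>

definition SDom :: "'l \<Rightarrow> 'l tm \<Rightarrow> 'l tm \<Rightarrow> 'l tm \<Rightarrow> 'l tm" where
  "SDom T X P f = TSig P (LDom T (\<up>X) (TApp (\<up>f) v0))"

definition SPrj1 :: "'l \<Rightarrow> 'l tm \<Rightarrow> 'l tm \<Rightarrow> 'l tm \<Rightarrow> 'l tm \<Rightarrow> 'l tm" where
  "SPrj1 T X P f s = Prj1 P (LDom T (\<up>X) (TApp (\<up>f) v0)) s"

definition SPrj2 :: "'l \<Rightarrow> 'l tm \<Rightarrow> 'l tm \<Rightarrow> 'l tm \<Rightarrow> 'l tm \<Rightarrow> 'l tm" where
  "SPrj2 T X P f s = Prj2 P (LDom T (\<up>X) (TApp (\<up>f) v0)) s"

definition SVal :: "'l \<Rightarrow> 'l tm \<Rightarrow> 'l tm \<Rightarrow> 'l tm \<Rightarrow> 'l tm" where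
  "SVal T X P f = TLam (SDom T X P f)
    (TApp (LVal T (\<up>X) (TApp (\<up>f) (SPrj1 T (\<up>X) (\<up>P) (\<up>f) v0))) (SPrj2 T (\<up>X) (\<up>P) (\<up>f) v0))"

text \<open>\<open>SPrf\<close> has to agree literally with \<open>sum_is_prop\<close>.\<close>

definition SPrf :: "'l \<Rightarrow> 'l tm \<Rightarrow> 'l tm \<Rightarrow> 'l tm \<Rightarrow> 'l tm \<Rightarrow> 'l tm" where
  "SPrf T X P f i =
    (let Q = (\<lambda>d x. LDom T ((shift 0 ^^ d) X) (TApp ((shift 0 ^^ d) f) x));
         Z = (\<lambda>d. SDom T ((shift 0 ^^ d) X) ((shift 0 ^^ d) P) ((shift 0 ^^ d) f));
         P' = (\<lambda>d. (shift 0 ^^ d) P)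
     in TLam (Z 0) (TLam (Z 1)
      (TSigInd (TLam (Z 2) (TId (Z 3) v0 v1))
        (TLam (P' 2) (TLam (Q 3 v0)
          (TSigInd (TLam (Z 4) (TId (Z 5) (TPair v2 v1) v0))
            (TLam (P' 4) (TLam (Q 5 v0)
              (TApp (TApp (TIdInd
                (TLam (P' 6) (TLam (P' 7) (TLam (TId (P' 8) v1 v0)
                  (TPi (Q 9 v2) (TPi (Q 10 v2)
                    (TId (Z 11) (TPair v4 v1) (TPair v3 v0)))))))
                (TLam (P' 6) (TLam (Q 7 v0) (TLam (Q 8 v1)
                  (TIdInd
                    (TLam (Q 9 v2) (TLam (Q 10 v3) (TLam (TId (Q 11 v4) v1 v0)
                      (TId (Z 12) (TPair v5 v2) (TPair v5 v1)))))
                    (TLam (Q 9 v2) (TRefl (TPair v3 v0)))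
                    v1 v0
                    (TApp (TApp (LPrf T ((shift 0 ^^ 9) X) (TApp ((shift 0 ^^ 9) f) v2)) v1) v0)))))
                v3 v1 (TApp (TApp ((shift 0 ^^ 6) i) v3) v1))
                v2) v0)))
            v2)))
        v1)))"

lemma S_simps [simp]:
  "shift k (UnitPrf T) = UnitPrf T"
  "subst k s (UnitPrf T) = UnitPrf T"
  "shift k (SDom T X P f) = SDom T (shift k X) (shift k P) (shift k f)"
  "subst k s (SDom T X P f) = SDom T (subst k s X) (subst k s P) (subst k s f)"
  "shift k (SPrj1 T X P f t) = SPrj1 T (shift k X) (shift k P) (shift k f) (shift k t)"
  "subst k s (SPrj1 T X P f t) = SPrj1 T (subst k s X) (subst k s P) (subst k s f) (subst k s t)"
  "shift k (SPrj2 T X P f t) = SPrj2 T (shift k X) (shift k P) (shift k f) (shift k t)"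
  "subst k s (SPrj2 T X P f t) = SPrj2 T (subst k s X) (subst k s P) (subst k s f) (subst k s t)"
  by (simp_all add: UnitPrf_def SDom_def SPrj1_def SPrj2_def)

lemma SVal_simps [simp]:
  "shift k (SVal T X P f) = SVal T (shift k X) (shift k P) (shift k f)"
  "subst k s (SVal T X P f) = SVal T (subst k s X) (subst k s P) (subst k s f)"
  by (simp_all add: SVal_def)

lemma SPrf_simps [simp]:
  "shift k (SPrf T X P f i) = SPrf T (shift k X) (shift k P) (shift k f) (shift k i)"
  "subst k s (SPrf T X P f i) = SPrf T (subst k s X) (subst k s P) (subst k s f) (subst k s i)"
  by (simp_all add: SPrf_def numeral_eq_Suc)

section \<open>Raw terms denoted by the definitions\<close>

lemmas expr_defs = bound_var_def axm_def universe_def pi_type_def lam_def app_def sig_type_def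
  pair_of_def
  sig_ind_def unit_type_def star_def unit_ind_def ident_def rfl_def id_ind_def arr_def prod_type_def
  proj1_def proj2_def id_fun_def fun_comp_def homotopy_def is_prop_def

context
  fixes n :: nat
begin

definition stable_from :: "'l expr \<Rightarrow> bool" where
  "stable_from e \<longleftrightarrow> (\<forall>m\<ge>n. e (Suc m) = \<up>(e m))"

lemma stable_fromD: "stable_from e \<Longrightarrow> n \<le> m \<Longrightarrow> e (Suc m) = \<up>(e m)"
  by (simp add: stable_from_def)

end

lemma lifting_raw:
  assumes "stable_from n X"
  shows "lifting T X n = Lift T (X n)"
  by (simp add: lifting_def Lift_def LiftFam_def IsProp_def expr_defs stable_fromD[OF assms])

lemma lift_dom_raw:
  assumes "stable_from n X"
  shows "lift_dom T X l n = LDom T (X n) (l n)"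
  by (simp add: lift_dom_def LDom_def Prj1_def LiftFam_def IsProp_def expr_defs
    stable_fromD[OF assms])

lemma lift_rest_raw:
  assumes "stable_from n X"
  shows "lift_rest T X l n = LRest T (X n) (l n)"
  by (simp add: lift_rest_def LRest_def Prj2_def Prj1_def LiftFam_def IsProp_def expr_defs
    stable_fromD[OF assms])

lemma stable_from_mono: "stable_from n X \<Longrightarrow> n \<le> m \<Longrightarrow> stable_from m X"
  by (simp add: stable_from_def)

lemma stable_from_lift_dom:
  assumes "stable_from n X" "stable_from n l"
  shows "stable_from n (lift_dom T X l)"
  using assms stable_fromD[OF assms(1)] stable_fromD[OF assms(2)]
  by (auto simp: stable_from_def lift_dom_raw stable_from_mono)

lemma lift_val_raw:
  assumes "stable_from n X" "stable_from n l"
  shows "lift_val T X l n = LVal T (X n) (l n)"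
proof -
  note D = stable_from_lift_dom[OF assms]
  show ?thesis
    by (simp add: lift_val_def LVal_def Prj1_def IsProp_def expr_defs stable_fromD[OF assms(1)]
        stable_fromD[OF assms(2)] stable_fromD[OF D] lift_dom_raw[OF assms(1)]
          lift_rest_raw[OF assms(1)])
qed

lemma lift_dom_is_prop_raw:
  assumes "stable_from n X" "stable_from n l"
  shows "lift_dom_is_prop T X l n = LPrf T (X n) (l n)"
proof -
  note D = stable_from_lift_dom[OF assms]
  show ?thesis
    by (simp add: lift_dom_is_prop_def LPrf_def Prj2_def Prj1_def IsProp_def expr_defs
      stable_fromD[OF assms(1)]
        stable_fromD[OF assms(2)] stable_fromD[OF D] lift_dom_raw[OF assms(1)]
          lift_rest_raw[OF assms(1)])
qed

lemma sum_is_prop_raw: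
  assumes X: "stable_from n X" and P: "stable_from n P" and f: "stable_from n f"
  and i: "stable_from n i"
  shows "sum_is_prop P (\<lambda>p. lift_dom T X (f \<cdot> p)) i (\<lambda>p. lift_dom_is_prop T X (f \<cdot> p)) n =
    SPrf T (X n) (P n) (f n) (i n)"
proof -
  note s = stable_fromD[OF X] stable_fromD[OF P] stable_fromD[OF f] stable_fromD[OF i]
  have Q: "lift_dom T X l m = LDom T (X m) (l m)" if "n \<le> m" for l m
    using X that by (intro lift_dom_raw) (rule stable_from_mono)
  have k: "lift_dom_is_prop T X (f \<cdot> bound_var j) m = LPrf T (X m) (TApp (f m) (TVar (m - Suc j)))"
    if "n \<le> m" "j < m" for j m
    using X f that
    by (subst lift_dom_is_prop_raw) (auto simp: expr_defs stable_from_def Suc_diff_Suc Suc_diff_le)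
  show ?thesis
    by (simp add: sum_is_prop_def SPrf_def SDom_def expr_defs s Q k[unfolded expr_defs]
      numeral_eq_Suc)
qed

section \<open>The monad laws\<close>

lift_definition cSDom :: "'l \<Rightarrow> 'l ctm \<Rightarrow> 'l ctm \<Rightarrow> 'l ctm \<Rightarrow> 'l ctm" is SDom
  by (simp add: SDom_def conv_iff)

lift_definition cSPrj1 :: "'l \<Rightarrow> 'l ctm \<Rightarrow> 'l ctm \<Rightarrow> 'l ctm \<Rightarrow> 'l ctm \<Rightarrow> 'l ctm" is SPrj1
  by (simp add: SPrj1_def conv_iff)

lift_definition cSPrj2 :: "'l \<Rightarrow> 'l ctm \<Rightarrow> 'l ctm \<Rightarrow> 'l ctm \<Rightarrow> 'l ctm \<Rightarrow> 'l ctm" is SPrj2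
  by (simp add: SPrj2_def conv_iff)

lift_definition cSVal :: "'l \<Rightarrow> 'l ctm \<Rightarrow> 'l ctm \<Rightarrow> 'l ctm \<Rightarrow> 'l ctm" is SVal
  by (simp add: SVal_def SDom_def SPrj1_def SPrj2_def conv_iff)

lift_definition cSPrf :: "'l \<Rightarrow> 'l ctm \<Rightarrow> 'l ctm \<Rightarrow> 'l ctm \<Rightarrow> 'l ctm \<Rightarrow> 'l ctm" is SPrf
  by (simp add: SPrf_def SDom_def numeral_eq_Suc conv_iff)

lemma abs_ctm_S [simp]:
  "abs_ctm (SDom T X P f) = cSDom T (abs_ctm X) (abs_ctm P) (abs_ctm f)"
  "abs_ctm (SPrj1 T X P f s) = cSPrj1 T (abs_ctm X) (abs_ctm P) (abs_ctm f) (abs_ctm s)"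
  "abs_ctm (SPrj2 T X P f s) = cSPrj2 T (abs_ctm X) (abs_ctm P) (abs_ctm f) (abs_ctm s)"
  "abs_ctm (SVal T X P f) = cSVal T (abs_ctm X) (abs_ctm P) (abs_ctm f)"
  "abs_ctm (SPrf T X P f i) = cSPrf T (abs_ctm X) (abs_ctm P) (abs_ctm f) (abs_ctm i)"
  by (simp_all add: cSDom.abs_eq cSPrj1.abs_eq cSPrj2.abs_eq cSVal.abs_eq cSPrf.abs_eq)

lemma cS_simps [simp]:
  "cshift k (cSDom T X P f) = cSDom T (cshift k X) (cshift k P) (cshift k f)"
  "csubst k s (cSDom T X P f) = cSDom T (csubst k s X) (csubst k s P) (csubst k s f)"
  "cshift k (cSPrj1 T X P f t) = cSPrj1 T (cshift k X) (cshift k P) (cshift k f) (cshift k t)"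
  "csubst k s (cSPrj1 T X P f t) = cSPrj1 T (csubst k s X) (csubst k s P) (csubst k s f)
    (csubst k s t)"
  "cshift k (cSPrj2 T X P f t) = cSPrj2 T (cshift k X) (cshift k P) (cshift k f) (cshift k t)"
  "csubst k s (cSPrj2 T X P f t) = cSPrj2 T (csubst k s X) (csubst k s P) (csubst k s f)
    (csubst k s t)"
  "cshift k (cSVal T X P f) = cSVal T (cshift k X) (cshift k P) (cshift k f)"
  "csubst k s (cSVal T X P f) = cSVal T (csubst k s X) (csubst k s P) (csubst k s f)"
  "cshift k (cSPrf T X P f i) = cSPrf T (cshift k X) (cshift k P) (cshift k f) (cshift k i)"
  "csubst k s (cSPrf T X P f i) = cSPrf T (csubst k s X) (csubst k s P) (csubst k s f)
    (csubst k s i)"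
  by (transfer; simp add: conv_refl)+

lemma cS_computation [simp]:
  "cSPrj1 T X P f (cpair a b) = a"
  "cSPrj2 T X P f (cpair a b) = b"
  "capp (cSVal T X P f) s = capp (cLVal T X (capp f (cSPrj1 T X P f s))) (cSPrj2 T X P f s)"
  by (transfer; simp add: SPrj1_def SPrj2_def SVal_def conv_iff)+

definition LUnit :: "'l \<Rightarrow> 'l tm \<Rightarrow> 'l tm" where
  "LUnit T X = TLam X (TPair (TUnit T) (TPair (TLam (TUnit T) v1) (UnitPrf T)))"

definition LMap :: "'l \<Rightarrow> 'l tm \<Rightarrow> 'l tm \<Rightarrow> 'l tm" where
  "LMap T X g = TLam (Lift T X) (TPair (LDom T (\<up>X) v0)
    (TPair (Comp (LDom T (\<up>X) v0) (\<up>g) (LVal T (\<up>X) v0)) (LPrf T (\<up>X) v0)))"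

definition LMult :: "'l \<Rightarrow> 'l tm \<Rightarrow> 'l tm" where
  "LMult T X = (let P = LDom T (Lift T (\<up>X)) v0; f = LVal T (Lift T (\<up>X)) v0;
      i = LPrf T (Lift T (\<up>X)) v0
    in TLam (Lift T (Lift T X)) (TPair (SDom T (\<up>X) P f)
      (TPair (SVal T (\<up>X) P f) (SPrf T (\<up>X) P f i))))"

lemma LMult_simps [simp]:
  "shift k (LUnit T X) = LUnit T (shift k X)"
  "subst k s (LUnit T X) = LUnit T (subst k s X)"
  "shift k (LMap T X g) = LMap T (shift k X) (shift k g)"
  "subst k s (LMap T X g) = LMap T (subst k s X) (subst k s g)"
  "shift k (LMult T X) = LMult T (shift k X)"
  "subst k s (LMult T X) = LMult T (subst k s X)"
  by (simp_all add: LUnit_def LMap_def LMult_def Let_def)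

context type_theory
begin

lemma ty_UnitPrf:
  assumes "ctx S \<Gamma>"
  shows "\<Gamma> \<turnstile> UnitPrf T \<Colon> IsProp (TUnit T)"
  unfolding UnitPrf_def IsProp_def
  by (insert assms; simp; (assumption | rule UnitInd_eq tyL | simp (no_asm))+)

lemma SDom_eq:
  assumes "ctx S \<Gamma>" "\<Gamma> \<turnstile> X \<Colon> TUniv v" "\<Gamma> \<turnstile> P \<Colon> TUniv T" "\<Gamma> \<turnstile> f \<Colon> Arr P (Lift T X)" "TUniv T = C"
  shows "\<Gamma> \<turnstile> SDom T X P f \<Colon> C"
  unfolding SDom_def assms(5)[symmetric]
  by (insert assms(1-4); simp; (assumption | rule tyL | simp (no_asm))+)

lemma SPair:
  assumes "ctx S \<Gamma>" "\<Gamma> \<turnstile> X \<Colon> TUniv v" "\<Gamma> \<turnstile> P \<Colon> TUniv T" "\<Gamma> \<turnstile> f \<Colon> Arr P (Lift T X)"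
    "\<Gamma> \<turnstile> a \<Colon> P" "\<Gamma> \<turnstile> b \<Colon> LDom T X (TApp f a)"
  shows "\<Gamma> \<turnstile> TPair a b \<Colon> SDom T X P f"
  unfolding SDom_def
  by (insert assms; simp; (assumption | rule tyL | simp (no_asm))+)

lemma SPrj1_eq:
  assumes "ctx S \<Gamma>" "\<Gamma> \<turnstile> X \<Colon> TUniv v" "\<Gamma> \<turnstile> P \<Colon> TUniv T" "\<Gamma> \<turnstile> f \<Colon> Arr P (Lift T X)"
    "\<Gamma> \<turnstile> s \<Colon> SDom T X P f" "P = C"
  shows "\<Gamma> \<turnstile> SPrj1 T X P f s \<Colon> C"
  unfolding SPrj1_def assms(6)[symmetric]
  by (insert assms(1-4) assms(5)[unfolded SDom_def]; simp; (assumption | rule tyL | simp (no_asm))+)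

lemma SPrj2_eq:
  assumes "ctx S \<Gamma>" "\<Gamma> \<turnstile> X \<Colon> TUniv v" "\<Gamma> \<turnstile> P \<Colon> TUniv T" "\<Gamma> \<turnstile> f \<Colon> Arr P (Lift T X)"
    "\<Gamma> \<turnstile> s \<Colon> SDom T X P f" "LDom T X (TApp f (SPrj1 T X P f s)) = C"
  shows "\<Gamma> \<turnstile> SPrj2 T X P f s \<Colon> C"
  unfolding SPrj2_def assms(6)[symmetric] SPrj1_def
  by (insert assms(1-4) assms(5)[unfolded SDom_def]; simp; (assumption | rule tyL | simp (no_asm))+)

lemma SVal_eq:
  assumes "ctx S \<Gamma>" "\<Gamma> \<turnstile> X \<Colon> TUniv v" "\<Gamma> \<turnstile> P \<Colon> TUniv T" "\<Gamma> \<turnstile> f \<Colon> Arr P (Lift T X)"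
    "Arr (SDom T X P f) X = C"
  shows "\<Gamma> \<turnstile> SVal T X P f \<Colon> C"
  unfolding SVal_def assms(5)[symmetric]
  by (insert assms(1-4); simp; (assumption | rule SDom_eq SPrj1_eq SPrj2_eq tyL | simp (no_asm))+)

lemma SPrf_eq:
  assumes "ctx S \<Gamma>" "\<Gamma> \<turnstile> X \<Colon> TUniv v" "\<Gamma> \<turnstile> P \<Colon> TUniv T" "\<Gamma> \<turnstile> f \<Colon> Arr P (Lift T X)"
    "\<Gamma> \<turnstile> i \<Colon> IsProp P" "IsProp (SDom T X P f) = C"
  shows "\<Gamma> \<turnstile> SPrf T X P f i \<Colon> C"
  unfolding SPrf_def SDom_def Let_def assms(6)[symmetric] IsProp_def[of "TSig _ _"]
  by (insert assms(1-5); simp add: numeral_eq_Suc;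
    (assumption | rule SigInd_eq IdInd_eq tyL | simp (no_asm))+)

lemmas tyS = SDom_eq SPair SPrj1_eq SPrj2_eq SVal_eq SPrf_eq ty_UnitPrf tyL

lemma LUnit_eq:
  assumes "ctx S \<Gamma>" "\<Gamma> \<turnstile> X \<Colon> TUniv v" "Arr X (Lift T X) = C"
  shows "\<Gamma> \<turnstile> LUnit T X \<Colon> C"
  unfolding LUnit_def assms(3)[symmetric]
  by (insert assms(1,2); simp; (assumption | rule tyS | simp (no_asm))+)

lemma LMap_eq:
  assumes "ctx S \<Gamma>" "\<Gamma> \<turnstile> X \<Colon> TUniv v" "\<Gamma> \<turnstile> Y \<Colon> TUniv w" "\<Gamma> \<turnstile> g \<Colon> Arr X Y"
    "Arr (Lift T X) (Lift T Y) = C"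
  shows "\<Gamma> \<turnstile> LMap T X g \<Colon> C"
  unfolding LMap_def assms(5)[symmetric]
  by (insert assms(1-4); simp; (assumption | rule tyS | simp (no_asm))+)

lemma LMult_eq:
  assumes "ctx S \<Gamma>" "\<Gamma> \<turnstile> X \<Colon> TUniv v" "Arr (Lift T (Lift T X)) (Lift T X) = C"
  shows "\<Gamma> \<turnstile> LMult T X \<Colon> C"
  unfolding LMult_def Let_def assms(3)[symmetric]
  by (insert assms(1,2); simp; (assumption | rule tyS | simp (no_asm))+)

end

context type_theory
begin

lemma Sig_eta:
  assumes \<Gamma>: "ctx S \<Gamma>" and A: "\<Gamma> \<turnstile> A \<Colon> TUniv u" and B: "A # \<Gamma> \<turnstile> B \<Colon> TUniv v"
    and p: "\<Gamma> \<turnstile> p \<Colon> TSig A B"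
  shows "inh \<Gamma> (TId (TSig A B) (TPair (Prj1 A B p) (Prj2 A B p)) p)"
proof (rule inh_Sig_elim[OF \<Gamma> A B _ p])
  let ?B1 = "shift (Suc 0) B" and ?B2 = "shift (Suc 0) (shift (Suc 0) B)"
  have A1: "ctx S (A # \<Gamma>)" using A by (rule ctx_Cons)
  have B1: "ctx S (B # A # \<Gamma>)" using B by (rule ctx_Cons)
  have "\<Gamma> \<turnstile> TSig A B \<Colon> TUniv (u \<squnion> v)" using A B by (rule ty_Sig)
  then have S1: "ctx S (TSig A B # \<Gamma>)" by (rule ctx_Cons)
  let ?p = "TPair (Prj1 (\<up>A) ?B1 v0) (Prj2 (\<up>A) ?B1 v0)"
  show "TSig A B # \<Gamma> \<turnstile> TId (TSig (\<up>A) ?B1) ?p v0 \<Colon> TUniv (u \<squnion> v)"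
    by (insert A B S1; (assumption | rule tyE | simp (no_asm))+)
  let ?v = "TPair v1 v0"
  let ?q = "TPair (Prj1 (\<up>\<up>A) ?B2 ?v) (Prj2 (\<up>\<up>A) ?B2 ?v)"
  have v: "B # A # \<Gamma> \<turnstile> ?v \<Colon> TSig (\<up>\<up>A) ?B2"
    by (insert A B A1 B1; (assumption | rule tyE | simp (no_asm))+)
  have "B # A # \<Gamma> \<turnstile> TId (TSig (\<up>\<up>A) ?B2) ?q ?v \<Colon> TUniv (u \<squnion> v)"
    by (insert A B A1 B1; (assumption | rule tyE | simp (no_asm))+)
  then show "inh (B # A # \<Gamma>) (TId (TSig (\<up>\<up>A) ?B2) ?q ?v)"
    by (rule inh_convert[OF inh_refl[OF v]]) simp
qed (simp_all add: shift_shift)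

lemma Lift_eta:
  assumes \<Gamma>: "ctx S \<Gamma>" and X: "\<Gamma> \<turnstile> X \<Colon> TUniv v" and l: "\<Gamma> \<turnstile> l \<Colon> Lift T X"
  shows "inh \<Gamma> (TId (Lift T X) (TPair (LDom T X l) (TPair (LVal T X l) (LPrf T X l))) l)"
proof -
  let ?P = "LDom T X l"
  let ?R = "TSig (Arr ?P X) (\<up>(IsProp ?P))"
  have P: "\<Gamma> \<turnstile> ?P \<Colon> TUniv T" and f: "\<Gamma> \<turnstile> LVal T X l \<Colon> Arr ?P X" and i: "\<Gamma> \<turnstile> LPrf T X l \<Colon> IsProp ?P"
    and r: "\<Gamma> \<turnstile> LRest T X l \<Colon> ?R"
    using LDom_eq[OF \<Gamma> X l refl] LVal_eq[OF \<Gamma> X l refl] LPrf_eq[OF \<Gamma> X l refl] LRest_eq[OF \<Gamma> X l] .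
  have L: "\<Gamma> \<turnstile> Lift T X \<Colon> TUniv (next_level T \<squnion> v)" using \<Gamma> X by (rule Lift_eq) simp
  have A: "\<Gamma> \<turnstile> Arr ?P X \<Colon> TUniv (T \<squnion> v)" by (insert P X; (assumption | rule tyL | simp (no_asm))+)
  then have A1: "ctx S (Arr ?P X # \<Gamma>)" by (rule ctx_Cons)
  have I: "Arr ?P X # \<Gamma> \<turnstile> \<up>(IsProp ?P) \<Colon> TUniv T"
    using weaken[OF IsProp_eq[OF P refl] A1] by simp
  have R: "\<Gamma> \<turnstile> ?R \<Colon> TUniv (T \<squnion> v \<squnion> T)" using A I by (rule ty_Sig)
  then have R1: "ctx S (?R # \<Gamma>)" by (rule ctx_Cons)
  have fi: "\<Gamma> \<turnstile> TPair (LVal T X l) (LPrf T X l) \<Colon> ?R"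
    using ty_Pair[OF f I, of "LPrf T X l"] i by simp
  from Sig_eta[OF \<Gamma> A I r] have 1: "inh \<Gamma> (TId ?R (TPair (LVal T X l) (LPrf T X l)) (LRest T X l))"
    by (simp only: LVal_def LPrf_def)
  have t: "?R # \<Gamma> \<turnstile> TPair (\<up>?P) v0 \<Colon> \<up>(Lift T X)"
    unfolding Lift_def shift.simps
  proof (rule ty_Pair)
    show "?R # \<Gamma> \<turnstile> \<up>?P \<Colon> TUniv T" using weaken[OF P R1] by simp
    show "TUniv T # ?R # \<Gamma> \<turnstile> shift (Suc 0) (LiftFam X) \<Colon> TUniv (T \<squnion> v)"
      unfolding LiftFam_simps by (rule LiftFam_eq[OF R1]) (use weaken[OF X R1] in simp)
    show "?R # \<Gamma> \<turnstile> v0 \<Colon> subst 0 (\<up>?P) (shift (Suc 0) (LiftFam X))"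
      using ty_lookup[OF R1, of 0] by (simp add: LiftFam_def)
  qed
  have 2: "inh \<Gamma> (TId (Lift T X) (TPair ?P (TPair (LVal T X l) (LPrf T X l)))
    (TPair ?P (LRest T X l)))"
    by (rule inh_Id_cong[OF \<Gamma> R L t fi r 1]) simp_all
  have 3: "inh \<Gamma> (TId (Lift T X) (TPair ?P (LRest T X l)) l)"
    using Sig_eta[OF \<Gamma> ty_Univ[OF \<Gamma>] LiftFam_eq[OF \<Gamma> X] l[unfolded Lift_def]]
    by (simp only: Lift_def LDom_def LRest_def)
  have "\<Gamma> \<turnstile> TPair ?P (LRest T X l) \<Colon> Lift T X"
    using substitute[OF t r \<Gamma>] by simp
  then show ?thesis by (rule inh_Id_trans[OF \<Gamma> L Lift_pair[OF \<Gamma> X P f i] _ l 2 3])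
qed

end

context univalent_type_theory
begin

lemma mult_unit:
  assumes \<Gamma>: "ctx S \<Gamma>"
    and X: "\<Gamma> \<turnstile> X \<Colon> TUniv v" and l: "\<Gamma> \<turnstile> l \<Colon> Lift T X"
  shows "inh \<Gamma> (TId (Lift T X) (TApp (LMult T X) (TApp (LUnit T (Lift T X)) l)) l)"
proof -
  have L: "\<Gamma> \<turnstile> Lift T X \<Colon> TUniv (next_level T \<squnion> v)" using \<Gamma> X by (rule Lift_eq) simp
  let ?Q = "LDom T X l" and ?I = "TUnit T"
  have Q: "\<Gamma> \<turnstile> ?Q \<Colon> TUniv T" and g: "\<Gamma> \<turnstile> LVal T X l \<Colon> Arr ?Q X" and j: "\<Gamma> \<turnstile> LPrf T X l \<Colon> IsProp ?Q"
    using LDom_eq[OF \<Gamma> X l refl] LVal_eq[OF \<Gamma> X l refl] LPrf_eq[OF \<Gamma> X l refl] .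
  have one: "\<Gamma> \<turnstile> ?I \<Colon> TUniv T" using \<Gamma> by (rule ty_Unit)
  define F where "F = TLam ?I (\<up>l)"
  have F: "\<Gamma> \<turnstile> F \<Colon> Arr ?I (Lift T X)"
    unfolding F_def using weaken[OF l ctx_Cons[OF one]] by (rule ty_Lam)
  let ?P = "SDom T X ?I F" and ?f = "SVal T X ?I F" and ?i = "SPrf T X ?I F (UnitPrf T)"
  have P: "\<Gamma> \<turnstile> ?P \<Colon> TUniv T" by (insert \<Gamma> X F; (assumption | rule tyS | simp (no_asm))+)
  have f: "\<Gamma> \<turnstile> ?f \<Colon> Arr ?P X" by (insert \<Gamma> X F; (assumption | rule tyS | simp (no_asm))+)
  have i: "\<Gamma> \<turnstile> ?i \<Colon> IsProp ?P" by (insert \<Gamma> X F; (assumption | rule tyS | simp (no_asm))+)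
  have P1: "ctx S (?P # \<Gamma>)" using P by (rule ctx_Cons)
  have Q1: "ctx S (?Q # \<Gamma>)" using Q by (rule ctx_Cons)
  define e where "e = TLam ?P (SPrj2 T (\<up>X) ?I (\<up>F) v0)"
  have "?P # \<Gamma> \<turnstile> SPrj2 T (\<up>X) ?I (\<up>F) v0 \<Colon> LDom T (\<up>X) (TApp (\<up>F) (SPrj1 T (\<up>X) ?I (\<up>F) v0))"
    by (insert P1 X F; (assumption | rule tyS | simp (no_asm))+)
  then have "?P # \<Gamma> \<turnstile> SPrj2 T (\<up>X) ?I (\<up>F) v0 \<Colon> \<up>?Q"
    by (rule ty_convert[where u = T]) (use weaken[OF Q P1] in \<open>simp_all add: F_def\<close>)
  then have e: "\<Gamma> \<turnstile> e \<Colon> Arr ?P ?Q" unfolding e_def by (rule ty_Lam)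
  define e' where "e' = TLam ?Q (TPair (TStar T) v0)"
  have "?Q # \<Gamma> \<turnstile> LDom T (\<up>X) (TApp (\<up>F) (TStar T)) \<Colon> TUniv T"
    by (insert Q1 X F; (assumption | rule tyS | simp (no_asm))+)
  then have "?Q # \<Gamma> \<turnstile> v0 \<Colon> LDom T (\<up>X) (TApp (\<up>F) (TStar T))"
    by (rule ty_convert[OF ty_lookup[OF Q1, of 0, simplified]]) (simp_all add: F_def)
  then have e': "\<Gamma> \<turnstile> e' \<Colon> Arr ?Q ?P" unfolding e'_def
    by - (insert Q Q1 X F; (assumption | rule tyS | simp (no_asm))+)
  have a: "?P # \<Gamma> \<turnstile> TApp (\<up>?f) v0 \<Colon> \<up>X"
    by (insert P1 f; (assumption | rule weaken_eq tyS | simp (no_asm))+)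
  have "?P # \<Gamma> \<turnstile> TApp (\<up>(LVal T X l)) (TApp (\<up>e) v0) \<Colon> \<up>X"
    by (insert P1 g e; (assumption | rule weaken_eq tyS | simp (no_asm))+)
  then have "?P # \<Gamma> \<turnstile> TId (\<up>X) (TApp (\<up>?f) v0) (TApp (\<up>(LVal T X l)) (TApp (\<up>e) v0)) \<Colon> TUniv v"
    using weaken[OF X P1] a by (auto intro: ty_Id)
  then have "inh (?P # \<Gamma>) (TId (\<up>X) (TApp (\<up>?f) v0) (TApp (\<up>(LVal T X l)) (TApp (\<up>e) v0)))"
    by (rule inh_convert[OF inh_refl[OF a]]) (simp add: e_def F_def)
  from Lift_ext[OF \<Gamma> X P f i Q g j e e' this]
  have 1: "inh \<Gamma> (TId (Lift T X) (TPair ?P (TPair ?f ?i))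
    (TPair ?Q (TPair (LVal T X l) (LPrf T X l))))" .
  note 2 = inh_Id_trans[OF \<Gamma> L Lift_pair[OF \<Gamma> X P f i] Lift_pair[OF \<Gamma> X Q g j] l 1
    Lift_eta[OF \<Gamma> X l]]
  have "\<Gamma> \<turnstile> TApp (LMult T X) (TApp (LUnit T (Lift T X)) l) \<Colon> Lift T X"
    by (insert \<Gamma> X L l LMult_eq[OF \<Gamma> X refl, of T] LUnit_eq[OF \<Gamma> L refl];
      (assumption | rule tyS | simp (no_asm))+)
  then have "\<Gamma> \<turnstile> TId (Lift T X) (TApp (LMult T X) (TApp (LUnit T (Lift T X)) l)) l
    \<Colon> TUniv (next_level T \<squnion> v)"
    using L l by (intro ty_Id)
  then show ?thesis
    by (rule inh_convert[OF 2]) (simp add: LMult_def LUnit_def UnitPrf_def Let_def F_def)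
qed

end

context type_theory
begin

lemma assoc_forward:
  fixes T :: 'l
  defines "m \<equiv> \<lambda>X. abs_ctm (LMult T X)"
  assumes \<Gamma>: "ctx S \<Gamma>" and X: "\<Gamma> \<turnstile> X \<Colon> TUniv v" and P: "\<Gamma> \<turnstile> P \<Colon> TUniv T"
    and f: "\<Gamma> \<turnstile> f \<Colon> Arr P (Lift T (Lift T X))" and g: "\<Gamma> \<turnstile> g \<Colon> Arr P (Lift T X)"
    and g_app: "\<And>p. capp (abs_ctm g) p = capp (m X) (capp (abs_ctm f) p)"
    and t: "\<Gamma> \<turnstile> t \<Colon> SDom T X (SDom T (Lift T X) P f) (SVal T (Lift T X) P f)"
    and s_def: "s = SPrj1 T X (SDom T (Lift T X) P f) (SVal T (Lift T X) P f) t"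
    and r_def: "r = SPrj2 T X (SDom T (Lift T X) P f) (SVal T (Lift T X) P f) t"
  shows "\<Gamma> \<turnstile> TPair (SPrj1 T (Lift T X) P f s) (TPair (SPrj2 T (Lift T X) P f s) r) \<Colon> SDom T X P g"
proof -
  let ?L = "Lift T X" and ?p = "SPrj1 T (Lift T X) P f s" and ?q = "SPrj2 T (Lift T X) P f s"
  let ?P1 = "SDom T ?L P f" and ?f1 = "SVal T ?L P f" and ?h = "TApp f ?p"
  have L: "\<Gamma> \<turnstile> ?L \<Colon> TUniv (next_level T \<squnion> v)" using \<Gamma> X by (rule Lift_eq) simp
  have P1: "\<Gamma> \<turnstile> ?P1 \<Colon> TUniv T" and f1: "\<Gamma> \<turnstile> ?f1 \<Colon> Arr ?P1 ?L"
    using SDom_eq[OF \<Gamma> L P f refl] SVal_eq[OF \<Gamma> L P f refl] .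
  have s: "\<Gamma> \<turnstile> s \<Colon> ?P1" unfolding s_def by (rule SPrj1_eq[OF \<Gamma> X P1 f1 t refl])
  have r: "\<Gamma> \<turnstile> r \<Colon> LDom T X (TApp ?f1 s)" unfolding r_def s_def
    by (rule SPrj2_eq[OF \<Gamma> X P1 f1 t refl])
  have p: "\<Gamma> \<turnstile> ?p \<Colon> P" by (rule SPrj1_eq[OF \<Gamma> L P f s refl])
  have q: "\<Gamma> \<turnstile> ?q \<Colon> LDom T ?L ?h" by (rule SPrj2_eq[OF \<Gamma> L P f s refl])
  have h: "\<Gamma> \<turnstile> ?h \<Colon> Lift T ?L" by (insert f p; (assumption | rule tyS | simp (no_asm))+)
  have D: "\<Gamma> \<turnstile> LDom T ?L ?h \<Colon> TUniv T" and V: "\<Gamma> \<turnstile> LVal T ?L ?h \<Colon> Arr (LDom T ?L ?h) ?L"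
    using LDom_eq[OF \<Gamma> L h refl] LVal_eq[OF \<Gamma> L h refl] .
  have "\<Gamma> \<turnstile> LDom T X (TApp (LVal T ?L ?h) ?q) \<Colon> TUniv T"
    by (insert \<Gamma> X V q; (assumption | rule tyS | simp (no_asm))+)
  then have "\<Gamma> \<turnstile> r \<Colon> LDom T X (TApp (LVal T ?L ?h) ?q)"
    by (rule ty_convert[OF r]) simp
  note qr = SPair[OF \<Gamma> X D V q this]
  have "\<Gamma> \<turnstile> LDom T X (TApp g ?p) \<Colon> TUniv T"
    by (insert \<Gamma> X g p; (assumption | rule tyS | simp (no_asm))+)
  then have "\<Gamma> \<turnstile> TPair ?q r \<Colon> LDom T X (TApp g ?p)"
    by (rule ty_convert[OF qr]) (simp add: g_app m_def LMult_def Let_def)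
  from SPair[OF \<Gamma> X P g p this] show ?thesis .
qed

lemma assoc_backward:
  fixes T :: 'l
  defines "m \<equiv> \<lambda>X. abs_ctm (LMult T X)"
  assumes \<Gamma>: "ctx S \<Gamma>" and X: "\<Gamma> \<turnstile> X \<Colon> TUniv v" and P: "\<Gamma> \<turnstile> P \<Colon> TUniv T"
    and f: "\<Gamma> \<turnstile> f \<Colon> Arr P (Lift T (Lift T X))" and g: "\<Gamma> \<turnstile> g \<Colon> Arr P (Lift T X)"
    and g_app: "\<And>p. capp (abs_ctm g) p = capp (m X) (capp (abs_ctm f) p)"
    and t: "\<Gamma> \<turnstile> t \<Colon> SDom T X P g"
    and p_def: "p = SPrj1 T X P g t" and w_def: "w = SPrj2 T X P g t" and h_def: "h = TApp f p"
    and q_def: "q = SPrj1 T X (LDom T (Lift T X) h) (LVal T (Lift T X) h) w"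
    and r_def: "r = SPrj2 T X (LDom T (Lift T X) h) (LVal T (Lift T X) h) w"
  shows "\<Gamma> \<turnstile> TPair (TPair p q) r \<Colon> SDom T X (SDom T (Lift T X) P f) (SVal T (Lift T X) P f)"
proof -
  let ?L = "Lift T X" and ?P1 = "SDom T (Lift T X) P f" and ?f1 = "SVal T (Lift T X) P f"
  have L: "\<Gamma> \<turnstile> ?L \<Colon> TUniv (next_level T \<squnion> v)" using \<Gamma> X by (rule Lift_eq) simp
  have P1: "\<Gamma> \<turnstile> ?P1 \<Colon> TUniv T" and f1: "\<Gamma> \<turnstile> ?f1 \<Colon> Arr ?P1 ?L"
    using SDom_eq[OF \<Gamma> L P f refl] SVal_eq[OF \<Gamma> L P f refl] .
  have p: "\<Gamma> \<turnstile> p \<Colon> P" unfolding p_def by (rule SPrj1_eq[OF \<Gamma> X P g t refl])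
  have w: "\<Gamma> \<turnstile> w \<Colon> LDom T X (TApp g p)" unfolding p_def w_def by (rule SPrj2_eq[OF \<Gamma> X P g t refl])
  have h: "\<Gamma> \<turnstile> h \<Colon> Lift T ?L" unfolding h_def
    by (insert f p; (assumption | rule tyS | simp (no_asm))+)
  let ?D = "LDom T ?L h" and ?V = "LVal T ?L h"
  have D: "\<Gamma> \<turnstile> ?D \<Colon> TUniv T" and V: "\<Gamma> \<turnstile> ?V \<Colon> Arr ?D ?L"
    using LDom_eq[OF \<Gamma> L h refl] LVal_eq[OF \<Gamma> L h refl] .
  have "\<Gamma> \<turnstile> SDom T X ?D ?V \<Colon> TUniv T" by (rule SDom_eq[OF \<Gamma> X D V refl])
  then have w': "\<Gamma> \<turnstile> w \<Colon> SDom T X ?D ?V"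
    by (rule ty_convert[OF w]) (simp add: g_app m_def h_def LMult_def Let_def)
  have q: "\<Gamma> \<turnstile> q \<Colon> ?D" unfolding q_def by (rule SPrj1_eq[OF \<Gamma> X D V w' refl])
  have r: "\<Gamma> \<turnstile> r \<Colon> LDom T X (TApp ?V q)" unfolding q_def r_def
    by (rule SPrj2_eq[OF \<Gamma> X D V w' refl])
  have s: "\<Gamma> \<turnstile> TPair p q \<Colon> ?P1" using SPair[OF \<Gamma> L P f p, of q] q by (simp only: h_def)
  have "\<Gamma> \<turnstile> LDom T X (TApp ?f1 (TPair p q)) \<Colon> TUniv T"
    by (insert \<Gamma> X f1 s; (assumption | rule tyS | simp (no_asm))+)
  then have "\<Gamma> \<turnstile> r \<Colon> LDom T X (TApp ?f1 (TPair p q))"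
    by (rule ty_convert[OF r]) (simp add: h_def)
  from SPair[OF \<Gamma> X P1 f1 s this] show ?thesis .
qed

end

context univalent_type_theory
begin

lemma mult_assoc:
  assumes \<Gamma>: "ctx S \<Gamma>"
    and X: "\<Gamma> \<turnstile> X \<Colon> TUniv v" and l: "\<Gamma> \<turnstile> l \<Colon> Lift T (Lift T (Lift T X))"
  shows "inh \<Gamma> (TId (Lift T X) (TApp (LMult T X) (TApp (LMult T (Lift T X)) l))
    (TApp (LMult T X) (TApp (LMap T (Lift T (Lift T X)) (LMult T X)) l)))"
proof -
  let ?L = "Lift T X" and ?LL = "Lift T (Lift T X)" and ?m = "LMult T X"
  have L: "\<Gamma> \<turnstile> ?L \<Colon> TUniv (next_level T \<squnion> v)" using \<Gamma> X by (rule Lift_eq) simp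
  have LL: "\<Gamma> \<turnstile> ?LL \<Colon> TUniv (next_level T \<squnion> v)" using \<Gamma> L by (rule Lift_eq) simp
  have m: "\<Gamma> \<turnstile> ?m \<Colon> Arr ?LL ?L" by (rule LMult_eq[OF \<Gamma> X refl])
  define P where "P = LDom T ?LL l"
  define f where "f = LVal T ?LL l"
  define i where "i = LPrf T ?LL l"
  have P: "\<Gamma> \<turnstile> P \<Colon> TUniv T" and f: "\<Gamma> \<turnstile> f \<Colon> Arr P ?LL" and i: "\<Gamma> \<turnstile> i \<Colon> IsProp P"
    using LDom_eq[OF \<Gamma> LL l refl] LVal_eq[OF \<Gamma> LL l refl] LPrf_eq[OF \<Gamma> LL l refl] unfolding P_def
      f_def i_def .
  define g where "g = Comp P ?m f"
  have g: "\<Gamma> \<turnstile> g \<Colon> Arr P ?L" unfolding g_def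
    by (insert P f m; (assumption | rule weaken_eq[OF m] tyS | simp (no_asm) del: LMult_simps)+)
  let ?P1 = "SDom T ?L P f" and ?f1 = "SVal T ?L P f" and ?i1 = "SPrf T ?L P f i"
  have P1: "\<Gamma> \<turnstile> ?P1 \<Colon> TUniv T" and f1: "\<Gamma> \<turnstile> ?f1 \<Colon> Arr ?P1 ?L" and i1: "\<Gamma> \<turnstile> ?i1 \<Colon> IsProp ?P1"
    using SDom_eq[OF \<Gamma> L P f refl] SVal_eq[OF \<Gamma> L P f refl] SPrf_eq[OF \<Gamma> L P f i refl] .
  let ?A = "SDom T X ?P1 ?f1" and ?va = "SVal T X ?P1 ?f1" and ?ia = "SPrf T X ?P1 ?f1 ?i1"
  let ?B = "SDom T X P g" and ?vb = "SVal T X P g" and ?ib = "SPrf T X P g i"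
  have A: "\<Gamma> \<turnstile> ?A \<Colon> TUniv T" and va: "\<Gamma> \<turnstile> ?va \<Colon> Arr ?A X" and ia: "\<Gamma> \<turnstile> ?ia \<Colon> IsProp ?A"
    using SDom_eq[OF \<Gamma> X P1 f1 refl] SVal_eq[OF \<Gamma> X P1 f1 refl] SPrf_eq[OF \<Gamma> X P1 f1 i1 refl] .
  have B: "\<Gamma> \<turnstile> ?B \<Colon> TUniv T" and vb: "\<Gamma> \<turnstile> ?vb \<Colon> Arr ?B X" and ib: "\<Gamma> \<turnstile> ?ib \<Colon> IsProp ?B"
    using SDom_eq[OF \<Gamma> X P g refl] SVal_eq[OF \<Gamma> X P g refl] SPrf_eq[OF \<Gamma> X P g i refl] .
  have A1: "ctx S (?A # \<Gamma>)" using A by (rule ctx_Cons)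
  have B1: "ctx S (?B # \<Gamma>)" using B by (rule ctx_Cons)
  let ?s = "SPrj1 T (\<up>X) (\<up>?P1) (\<up>?f1) v0" and ?r = "SPrj2 T (\<up>X) (\<up>?P1) (\<up>?f1) v0"
  define e where "e = TLam ?A (TPair (SPrj1 T (\<up>?L) (\<up>P) (\<up>f) ?s)
    (TPair (SPrj2 T (\<up>?L) (\<up>P) (\<up>f) ?s) ?r))"
  have g_app: "capp (abs_ctm (\<up>g)) p = capp (abs_ctm (LMult T (\<up>X))) (capp (abs_ctm (\<up>f)) p)" for p
    by (simp add: g_def LMult_def Let_def)
  have "?A # \<Gamma> \<turnstile> TPair (SPrj1 T (\<up>?L) (\<up>P) (\<up>f) ?s) (TPair (SPrj2 T (\<up>?L) (\<up>P) (\<up>f) ?s) ?r) \<Colon> \<up>?B"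
    using assoc_forward[OF A1 _ _ _ _ g_app _ refl refl] weaken[OF X A1] weaken[OF P A1]
      weaken[OF f A1]
      weaken[OF g A1] ty_lookup[OF A1, of 0] by simp
  then have e: "\<Gamma> \<turnstile> e \<Colon> Arr ?A ?B" unfolding e_def by (rule ty_Lam)
  let ?p = "SPrj1 T (\<up>X) (\<up>P) (\<up>g) v0" and ?w = "SPrj2 T (\<up>X) (\<up>P) (\<up>g) v0"
  let ?h = "TApp (\<up>f) ?p"
  define e' where "e' = TLam ?B (TPair (TPair ?p
    (SPrj1 T (\<up>X) (LDom T (\<up>?L) ?h) (LVal T (\<up>?L) ?h) ?w))
    (SPrj2 T (\<up>X) (LDom T (\<up>?L) ?h) (LVal T (\<up>?L) ?h) ?w))"
  have "?B # \<Gamma> \<turnstile> TPair (TPair ?p (SPrj1 T (\<up>X) (LDom T (\<up>?L) ?h) (LVal T (\<up>?L) ?h) ?w))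
    (SPrj2 T (\<up>X) (LDom T (\<up>?L) ?h) (LVal T (\<up>?L) ?h) ?w) \<Colon> \<up>?A"
    using assoc_backward[OF B1 _ _ _ _ g_app _ refl refl refl refl refl] weaken[OF X B1]
      weaken[OF P B1] weaken[OF f B1]
      weaken[OF g B1] ty_lookup[OF B1, of 0] by simp
  then have e': "\<Gamma> \<turnstile> e' \<Colon> Arr ?B ?A" unfolding e'_def by (rule ty_Lam)
  have X1: "?A # \<Gamma> \<turnstile> \<up>X \<Colon> TUniv v" using weaken[OF X A1] by simp
  have t0: "?A # \<Gamma> \<turnstile> v0 \<Colon> \<up>?A" using ty_lookup[OF A1, of 0] by simp
  have a: "?A # \<Gamma> \<turnstile> TApp (\<up>?va) v0 \<Colon> \<up>X"
    using ty_App[OF weaken[OF va A1, unfolded shift.simps] t0] by simp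
  have "?A # \<Gamma> \<turnstile> TApp (\<up>?vb) (TApp (\<up>e) v0) \<Colon> \<up>X"
    using App_eq[OF weaken[OF vb A1, unfolded shift.simps]
      App_eq[OF weaken[OF e A1, unfolded shift.simps] t0]] by simp
  with X1 a have "?A # \<Gamma> \<turnstile> TId (\<up>X) (TApp (\<up>?va) v0) (TApp (\<up>?vb) (TApp (\<up>e) v0)) \<Colon> TUniv v"
    by (rule ty_Id)
  then have "inh (?A # \<Gamma>) (TId (\<up>X) (TApp (\<up>?va) v0) (TApp (\<up>?vb) (TApp (\<up>e) v0)))"
    by (rule inh_convert[OF inh_refl[OF a]]) (simp add: e_def g_def LMult_def Let_def)
  from Lift_ext[OF \<Gamma> X A va ia B vb ib e e' this]
  have 1: "inh \<Gamma> (TId ?L (TPair ?A (TPair ?va ?ia)) (TPair ?B (TPair ?vb ?ib)))" .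
  have "\<Gamma> \<turnstile> LMult T ?L \<Colon> Arr (Lift T ?LL) ?LL" by (rule LMult_eq[OF \<Gamma> L refl])
  from App_eq[OF m App_eq[OF this l]]
  have x: "\<Gamma> \<turnstile> TApp ?m (TApp (LMult T ?L) l) \<Colon> ?L" by simp
  have "\<Gamma> \<turnstile> LMap T ?LL ?m \<Colon> Arr (Lift T ?LL) ?LL" by (rule LMap_eq[OF \<Gamma> LL L m refl])
  from App_eq[OF m App_eq[OF this l]]
  have y: "\<Gamma> \<turnstile> TApp ?m (TApp (LMap T ?LL ?m) l) \<Colon> ?L" by simp
  from ty_Id[OF L x y] show ?thesis
    by (rule inh_convert[OF 1]) (simp add: LMult_def LMap_def Let_def g_def P_def f_def i_def)
qed

end

section \<open>Injective types and algebras\<close>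

definition Fiber :: "'l tm \<Rightarrow> 'l tm \<Rightarrow> 'l tm \<Rightarrow> 'l tm \<Rightarrow> 'l tm" where
  "Fiber X Y j y = TSig X (TId (\<up>Y) (TApp (\<up>j) v0) (\<up>y))"

definition IsEmb :: "'l tm \<Rightarrow> 'l tm \<Rightarrow> 'l tm \<Rightarrow> 'l tm" where
  "IsEmb X Y j = TPi Y (IsProp (Fiber (\<up>X) (\<up>Y) (\<up>j) v0))"

definition Emb :: "'l tm \<Rightarrow> 'l tm \<Rightarrow> 'l tm" where
  "Emb X Y = TSig (Arr X Y) (IsEmb (\<up>X) (\<up>Y) v0)"

definition EmbFun :: "'l tm \<Rightarrow> 'l tm \<Rightarrow> 'l tm \<Rightarrow> 'l tm" where
  "EmbFun X Y j = Prj1 (Arr X Y) (IsEmb (\<up>X) (\<up>Y) v0) j"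

definition Extension :: "'l tm \<Rightarrow> 'l tm \<Rightarrow> 'l tm \<Rightarrow> 'l tm \<Rightarrow> 'l tm \<Rightarrow> 'l tm" where
  "Extension X Y D j f = TSig (Arr Y D) (Htpy (\<up>X) (\<up>D) (Comp (\<up>X) v0 (EmbFun (\<up>X) (\<up>Y) (\<up>j)))
    (\<up>f))"

definition AlgInj :: "'l \<Rightarrow> 'l \<Rightarrow> 'l tm \<Rightarrow> 'l tm" where
  "AlgInj u v D = TPi (TUniv u) (TPi (TUniv v) (TPi (Emb v1 v0)
    (TPi (Arr v2 (\<up>\<up>\<up>D))
      (Extension v3 v2 (\<up>\<up>\<up>\<up>D) v1 v0))))"

definition Ret :: "'l tm \<Rightarrow> 'l tm \<Rightarrow> 'l tm" where
  "Ret A B = TSig (Arr A B) (TSig (Arr (\<up>B) (\<up>A))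
    (Htpy (\<up>\<up>A) (\<up>\<up>A) (Comp (\<up>\<up>A) v0 v1) (IdF (\<up>\<up>A))))"

definition UnitLaw :: "'l \<Rightarrow> 'l tm \<Rightarrow> 'l tm \<Rightarrow> 'l tm" where
  "UnitLaw T X a = Htpy X X (Comp X a (LUnit T X)) (IdF X)"

definition AssocLaw :: "'l \<Rightarrow> 'l tm \<Rightarrow> 'l tm \<Rightarrow> 'l tm" where
  "AssocLaw T X a = Htpy (Lift T (Lift T X)) X (Comp (Lift T (Lift T X)) a (LMult T X))
    (Comp (Lift T (Lift T X)) a (LMap T (Lift T X) a))"

definition Alg :: "'l \<Rightarrow> 'l tm \<Rightarrow> 'l tm" where
  "Alg T X = TSig (Arr (Lift T X) X)
    (TSig (UnitLaw T (\<up>X) v0) (\<up>(AssocLaw T (\<up>X) v0)))"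

definition RetAlg :: "'l \<Rightarrow> 'l \<Rightarrow> 'l tm \<Rightarrow> 'l tm" where
  "RetAlg T v D = TSig (TUniv v) (TSig (Alg T v0) (\<up>(Ret (\<up>D) v0)))"

lemma Fiber_simps [simp]:
  "shift k (Fiber X Y j y) = Fiber (shift k X) (shift k Y) (shift k j) (shift k y)"
  "subst k s (Fiber X Y j y) = Fiber (subst k s X) (subst k s Y) (subst k s j) (subst k s y)"
  "shift k (UnitLaw T X a) = UnitLaw T (shift k X) (shift k a)"
  "subst k s (UnitLaw T X a) = UnitLaw T (subst k s X) (subst k s a)"
  "shift k (AssocLaw T X a) = AssocLaw T (shift k X) (shift k a)"
  "subst k s (AssocLaw T X a) = AssocLaw T (subst k s X) (subst k s a)"
  "shift k (Ret X Y) = Ret (shift k X) (shift k Y)"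
  "subst k s (Ret X Y) = Ret (subst k s X) (subst k s Y)"
  by (simp_all add: Fiber_def UnitLaw_def AssocLaw_def Ret_def)

lemma Emb_simps [simp]:
  "shift k (IsEmb X Y j) = IsEmb (shift k X) (shift k Y) (shift k j)"
  "subst k s (IsEmb X Y j) = IsEmb (subst k s X) (subst k s Y) (subst k s j)"
  "shift k (Alg T X) = Alg T (shift k X)"
  "subst k s (Alg T X) = Alg T (subst k s X)"
  by (simp_all add: IsEmb_def Alg_def)

lemma EmbFun_simps [simp]:
  "shift k (Emb X Y) = Emb (shift k X) (shift k Y)"
  "subst k s (Emb X Y) = Emb (subst k s X) (subst k s Y)"
  "shift k (EmbFun X Y j) = EmbFun (shift k X) (shift k Y) (shift k j)"
  "subst k s (EmbFun X Y j) = EmbFun (subst k s X) (subst k s Y) (subst k s j)"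
  by (simp_all add: Emb_def EmbFun_def)

lemma Extension_simps [simp]:
  "shift k (Extension X Y D j f) = Extension (shift k X) (shift k Y) (shift k D) (shift k j)
    (shift k f)"
  "subst k s (Extension X Y D j f) = Extension (subst k s X) (subst k s Y) (subst k s D)
    (subst k s j) (subst k s f)"
  by (simp_all add: Extension_def)

lemma AlgInj_simps [simp]:
  "shift k (AlgInj u v D) = AlgInj u v (shift k D)"
  "subst k s (AlgInj u v D) = AlgInj u v (subst k s D)"
  "shift k (RetAlg T v D) = RetAlg T v (shift k D)"
  "subst k s (RetAlg T v D) = RetAlg T v (subst k s D)"
  by (simp_all add: AlgInj_def RetAlg_def)

context type_theory
begin

lemma Fiber_eq:
  assumes "\<Gamma> \<turnstile> X \<Colon> TUniv u" "\<Gamma> \<turnstile> Y \<Colon> TUniv v" "\<Gamma> \<turnstile> j \<Colon> Arr X Y" "\<Gamma> \<turnstile> y \<Colon> Y" "TUniv (u \<squnion> v) = C"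
  shows "\<Gamma> \<turnstile> Fiber X Y j y \<Colon> C"
  unfolding Fiber_def assms(5)[symmetric]
  by (insert assms(1-4); (assumption | rule tyL | simp (no_asm))+)

lemma IsEmb_eq:
  assumes "\<Gamma> \<turnstile> X \<Colon> TUniv u" "\<Gamma> \<turnstile> Y \<Colon> TUniv v" "\<Gamma> \<turnstile> j \<Colon> Arr X Y" "TUniv (u \<squnion> v) = C"
  shows "\<Gamma> \<turnstile> IsEmb X Y j \<Colon> C"
  unfolding IsEmb_def assms(4)[symmetric]
  by (insert assms(1-3); (assumption | rule Fiber_eq tyL | simp (no_asm) add: sup_aci)+)

lemma Emb_eq:
  assumes "\<Gamma> \<turnstile> X \<Colon> TUniv u" "\<Gamma> \<turnstile> Y \<Colon> TUniv v" "TUniv (u \<squnion> v) = C"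
  shows "\<Gamma> \<turnstile> Emb X Y \<Colon> C"
  unfolding Emb_def assms(3)[symmetric]
  by (insert assms(1,2); (assumption | rule IsEmb_eq tyL | simp (no_asm))+)

lemma EmbFun_eq:
  assumes "\<Gamma> \<turnstile> X \<Colon> TUniv u" "\<Gamma> \<turnstile> Y \<Colon> TUniv v" "\<Gamma> \<turnstile> j \<Colon> Emb X Y" "Arr X Y = C"
  shows "\<Gamma> \<turnstile> EmbFun X Y j \<Colon> C"
  unfolding EmbFun_def assms(4)[symmetric]
  by (insert assms(1,2) assms(3)[unfolded Emb_def];
    (assumption | rule IsEmb_eq tyL | simp (no_asm))+)

lemma inh_EmbFun:
  assumes "ctx S \<Gamma>" "\<Gamma> \<turnstile> X \<Colon> TUniv u" "\<Gamma> \<turnstile> Y \<Colon> TUniv v" "\<Gamma> \<turnstile> j \<Colon> Emb X Y"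
  shows "inh \<Gamma> (IsEmb X Y (EmbFun X Y j))"
proof (rule inhI, rule Prj2_eq[OF assms(1) _ _ assms(4)[unfolded Emb_def]])
  show 1: "\<Gamma> \<turnstile> Arr X Y \<Colon> TUniv (u \<squnion> v)"
    by (insert assms; (assumption | rule tyL | simp (no_asm))+)
  show "Arr X Y # \<Gamma> \<turnstile> IsEmb (\<up>X) (\<up>Y) v0 \<Colon> TUniv (u \<squnion> v)" if "ctx S (Arr X Y # \<Gamma>)"
    by (insert assms that; (assumption | rule IsEmb_eq tyL | simp (no_asm))+)
qed (simp add: EmbFun_def)

lemma Extension_eq:
  assumes "\<Gamma> \<turnstile> X \<Colon> TUniv u" "\<Gamma> \<turnstile> Y \<Colon> TUniv v" "\<Gamma> \<turnstile> D \<Colon> TUniv w" "\<Gamma> \<turnstile> j \<Colon> Emb X Y" "\<Gamma> \<turnstile> f \<Colon> Arr X D"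
    "TUniv (u \<squnion> (v \<squnion> w)) = C"
  shows "\<Gamma> \<turnstile> Extension X Y D j f \<Colon> C"
  unfolding Extension_def assms(6)[symmetric]
  by (insert assms(1-5); (simp (no_asm))?; (assumption | rule EmbFun_eq tyL | simp (no_asm) add:
    sup_aci)+)

lemma Ret_eq:
  assumes "\<Gamma> \<turnstile> X \<Colon> TUniv u" "\<Gamma> \<turnstile> Y \<Colon> TUniv v" "TUniv (u \<squnion> v) = C"
  shows "\<Gamma> \<turnstile> Ret X Y \<Colon> C"
  unfolding Ret_def assms(3)[symmetric]
  by (insert assms(1,2); (simp (no_asm))?; (assumption | rule tyL | simp (no_asm) add: sup_aci)+)

lemma UnitLaw_eq:
  assumes "ctx S \<Gamma>" "\<Gamma> \<turnstile> X \<Colon> TUniv v" "\<Gamma> \<turnstile> a \<Colon> Arr (Lift T X) X" "TUniv v = C"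
  shows "\<Gamma> \<turnstile> UnitLaw T X a \<Colon> C"
  unfolding UnitLaw_def assms(4)[symmetric]
  by (insert assms(1-3); (simp (no_asm))?; (assumption | rule LUnit_eq tyS | simp (no_asm) add:
    sup_aci)+)

lemma LMap_alg_eq:
  assumes "ctx S \<Gamma>" "\<Gamma> \<turnstile> X \<Colon> TUniv v" "\<Gamma> \<turnstile> a \<Colon> Arr (Lift T X) X"
    "Arr (Lift T (Lift T X)) (Lift T X) = C"
  shows "\<Gamma> \<turnstile> LMap T (Lift T X) a \<Colon> C"
  by (rule LMap_eq[OF assms(1) Lift_eq[OF assms(1,2) refl] assms(2,3,4)])

lemma AssocLaw_eq:
  assumes "ctx S \<Gamma>" "\<Gamma> \<turnstile> X \<Colon> TUniv v" "\<Gamma> \<turnstile> a \<Colon> Arr (Lift T X) X" "TUniv (next_level T \<squnion> v) = C"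
  shows "\<Gamma> \<turnstile> AssocLaw T X a \<Colon> C"
  unfolding AssocLaw_def assms(4)[symmetric]
  by (insert assms(1-3); (simp (no_asm))?; (assumption | rule LUnit_eq LMult_eq LMap_alg_eq tyS |
    simp (no_asm) add: sup_aci)+)

lemma Alg_eq:
  assumes "ctx S \<Gamma>" "\<Gamma> \<turnstile> X \<Colon> TUniv v" "TUniv (next_level T \<squnion> v) = C"
  shows "\<Gamma> \<turnstile> Alg T X \<Colon> C"
  unfolding Alg_def assms(3)[symmetric]
  by (insert assms(1,2); (simp (no_asm))?; (assumption | rule UnitLaw_eq AssocLaw_eq tyS | simp
    (no_asm) add: sup_aci)+)

lemmas tyA = Fiber_eq IsEmb_eq Emb_eq EmbFun_eq Extension_eq Ret_eq UnitLaw_eq AssocLaw_eq Alg_eq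
  LUnit_eq LMult_eq tyS

lemma Ret_pair:
  assumes "\<Gamma> \<turnstile> X \<Colon> TUniv u" "\<Gamma> \<turnstile> Y \<Colon> TUniv v" "\<Gamma> \<turnstile> s \<Colon> Arr X Y" "\<Gamma> \<turnstile> r \<Colon> Arr Y X"
    and "\<Gamma> \<turnstile> k \<Colon> Htpy X X (Comp X r s) (IdF X)"
  shows "\<Gamma> \<turnstile> TPair s (TPair r k) \<Colon> Ret X Y"
  unfolding Ret_def
  by (insert assms(1-4) assms(5)[simplified]; (simp (no_asm))?;
    (assumption | rule tyA | simp (no_asm))+)

lemma Alg_pair:
  assumes "ctx S \<Gamma>" "\<Gamma> \<turnstile> X \<Colon> TUniv v" "\<Gamma> \<turnstile> a \<Colon> Arr (Lift T X) X" "\<Gamma> \<turnstile> p \<Colon> UnitLaw T X a"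
    "\<Gamma> \<turnstile> q \<Colon> AssocLaw T X a"
  shows "\<Gamma> \<turnstile> TPair a (TPair p q) \<Colon> Alg T X"
  unfolding Alg_def
  by (insert assms; (simp (no_asm))?; (assumption | rule tyA | simp (no_asm))+)

lemma RetAlg_pair:
  assumes "ctx S \<Gamma>" "\<Gamma> \<turnstile> D \<Colon> TUniv T" "\<Gamma> \<turnstile> X \<Colon> TUniv v" "\<Gamma> \<turnstile> p \<Colon> Alg T X" "\<Gamma> \<turnstile> q \<Colon> Ret D X"
  shows "\<Gamma> \<turnstile> TPair X (TPair p q) \<Colon> RetAlg T v D"
  unfolding RetAlg_def
  by (insert assms; (simp (no_asm))?; (assumption | rule tyA | simp (no_asm))+)

end

context type_theory
begin

lemma inh_SigE:
  assumes \<Gamma>: "ctx S \<Gamma>" and A: "\<Gamma> \<turnstile> A \<Colon> TUniv u" and B: "A # \<Gamma> \<turnstile> B \<Colon> TUniv v"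
    and p: "inh \<Gamma> (TSig A B)"
  obtains a where "\<Gamma> \<turnstile> a \<Colon> A" and "inh \<Gamma> (subst 0 a B)"
proof -
  from p obtain p where p: "\<Gamma> \<turnstile> p \<Colon> TSig A B" by (auto simp: inh_def)
  show ?thesis
    by (rule that[OF Prj1_eq[OF A B p refl] inhI[OF Prj2_eq[OF \<Gamma> A B p refl]]])
qed

lemma Prod_is_prop:
  assumes \<Gamma>: "ctx S \<Gamma>" and A: "\<Gamma> \<turnstile> A \<Colon> TUniv u" and B: "\<Gamma> \<turnstile> B \<Colon> TUniv v"
    and i: "inh \<Gamma> (IsProp A)" and j: "inh \<Gamma> (IsProp B)"
    and s: "\<Gamma> \<turnstile> s \<Colon> TSig A (\<up>B)" and t: "\<Gamma> \<turnstile> t \<Colon> TSig A (\<up>B)"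
  shows "inh \<Gamma> (TId (TSig A (\<up>B)) s t)"
proof -
  let ?Z = "TSig A (\<up>B)" and ?a = "\<lambda>x. Prj1 A (\<up>B) x" and ?b = "\<lambda>x. Prj2 A (\<up>B) x"
  have A1: "ctx S (A # \<Gamma>)" using A by (rule ctx_Cons)
  have B1: "ctx S (B # \<Gamma>)" using B by (rule ctx_Cons)
  have B': "A # \<Gamma> \<turnstile> \<up>B \<Colon> TUniv v" using weaken[OF B A1] by simp
  have Z: "\<Gamma> \<turnstile> ?Z \<Colon> TUniv (u \<squnion> v)" using A B' by (rule ty_Sig)
  have a: "\<Gamma> \<turnstile> ?a x \<Colon> A" and b: "\<Gamma> \<turnstile> ?b x \<Colon> B" if "\<Gamma> \<turnstile> x \<Colon> ?Z" for x
    using Prj1_eq[OF A B' that refl] Prj2_eq[OF \<Gamma> A B' that refl] by simp_all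
  note as = a[OF s] and bs = b[OF s] and at = a[OF t] and bt = b[OF t]
  have pr: "\<Gamma> \<turnstile> TPair x y \<Colon> ?Z" if "\<Gamma> \<turnstile> x \<Colon> A" "\<Gamma> \<turnstile> y \<Colon> B" for x y
    using ty_Pair[OF that(1) B'] that(2) by simp
  have t1: "A # \<Gamma> \<turnstile> TPair v0 (\<up>(?b s)) \<Colon> \<up>?Z"
    by (insert A A1 B s; (simp (no_asm))?; (assumption | rule tyL | simp (no_asm))+)
  have t2: "B # \<Gamma> \<turnstile> TPair (\<up>(?a t)) v0 \<Colon> \<up>?Z"
    by (insert A B1 B t; (simp (no_asm))?; (assumption | rule tyL | simp (no_asm))+)
  note 1 = inh_Id_sym[OF \<Gamma> Z pr[OF as bs] s Sig_eta[OF \<Gamma> A B' s]]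
  have 2: "inh \<Gamma> (TId ?Z (TPair (?a s) (?b s)) (TPair (?a t) (?b s)))"
    by (rule inh_Id_cong[OF \<Gamma> A Z t1 as at inh_IsProp_app[OF i as at]]) simp_all
  have 3: "inh \<Gamma> (TId ?Z (TPair (?a t) (?b s)) (TPair (?a t) (?b t)))"
    by (rule inh_Id_cong[OF \<Gamma> B Z t2 bs bt inh_IsProp_app[OF j bs bt]]) simp_all
  show ?thesis
    by (rule inh_Id_trans[OF \<Gamma> Z s pr[OF at bs] t
      inh_Id_trans[OF \<Gamma> Z s pr[OF as bs] pr[OF at bs] 1 2]
      inh_Id_trans[OF \<Gamma> Z pr[OF at bs] pr[OF at bt] t 3 Sig_eta[OF \<Gamma> A B' t]]])
qed

lemma terminal_embedding:
  assumes \<Gamma>: "ctx S \<Gamma>" and P: "\<Gamma> \<turnstile> P \<Colon> TUniv T" and i: "inh \<Gamma> (IsProp P)"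
  shows "inh \<Gamma> (IsEmb P (TUnit T) (TLam P (TStar T)))"
proof -
  let ?I = "TUnit T"
  let ?\<Delta> = "?I # \<Gamma>"
  let ?E = "TId ?I (TStar T) v0"
  have I1: "ctx S ?\<Delta>" by (rule ctx_Cons[OF ty_Unit[OF \<Gamma>]])
  have P1: "?\<Delta> \<turnstile> \<up>P \<Colon> TUniv T" using weaken[OF P I1] by simp
  have i1: "inh ?\<Delta> (IsProp (\<up>P))" using i I1 by (rule inh_weaken) simp
  have E: "?\<Delta> \<turnstile> ?E \<Colon> TUniv T"
    by (insert I1; (assumption | rule tyS | simp (no_asm))+)
  have E1: "ctx S (?E # ?\<Delta>)" using E by (rule ctx_Cons)
  have E1': "?E # ?\<Delta> \<turnstile> \<up>?E \<Colon> TUniv T" using weaken[OF E E1] by simp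
  have E2: "ctx S (\<up>?E # ?E # ?\<Delta>)" using E1' by (rule ctx_Cons)
  have set: "inh (\<up>?E # ?E # ?\<Delta>) (TId (\<up>\<up>?E) v1 v0)"
    using prop_is_set[OF E2 ty_Unit[OF E2] inhI[OF ty_UnitPrf[OF E2]] ty_Star[OF E2],
        where b = "v2" and p = "v1" and q = "v0"]
      ty_lookup[OF E2, of 0] ty_lookup[OF E2, of "Suc 0"] ty_lookup[OF E2, of "Suc (Suc 0)"] by simp
  have e1: "inh ?\<Delta> (IsProp ?E)" unfolding IsProp_def using set by (intro inh_Pi)
  let ?Z = "TSig (\<up>P) (\<up>?E)"
  have Z: "?\<Delta> \<turnstile> ?Z \<Colon> TUniv T"
    by (insert I1 P1; (assumption | rule tyS | simp (no_asm))+)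
  have Z1: "ctx S (?Z # ?\<Delta>)" using Z by (rule ctx_Cons)
  have "?Z # ?\<Delta> \<turnstile> \<up>?Z \<Colon> TUniv T" using weaken[OF Z Z1] by simp
  then have Z2: "ctx S (\<up>?Z # ?Z # ?\<Delta>)" by (rule ctx_Cons)
  have P2: "\<up>?Z # ?Z # ?\<Delta> \<turnstile> \<up>\<up>\<up>P \<Colon> TUniv T" and E3: "\<up>?Z # ?Z # ?\<Delta> \<turnstile> \<up>\<up>?E \<Colon> TUniv T"
    using weaken[OF weaken[OF P1 Z1] Z2] weaken[OF weaken[OF E Z1] Z2] by simp_all
  have i2: "inh (\<up>?Z # ?Z # ?\<Delta>) (IsProp (\<up>\<up>\<up>P))" and e2: "inh (\<up>?Z # ?Z # ?\<Delta>) (IsProp (\<up>\<up>?E))"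
    using inh_weaken[OF inh_weaken[OF i1 Z1 refl] Z2] inh_weaken[OF inh_weaken[OF e1 Z1 refl] Z2]
      by simp_all
  have "inh (\<up>?Z # ?Z # ?\<Delta>) (TId (\<up>\<up>?Z) v1 v0)"
    using Prod_is_prop[OF Z2 P2 E3 i2 e2, where s = "v1" and t = "v0"]
      ty_lookup[OF Z2, of 0] ty_lookup[OF Z2, of "Suc 0"] by simp
  then have z: "inh ?\<Delta> (IsProp ?Z)" unfolding IsProp_def by (intro inh_Pi)
  have "?\<Delta> \<turnstile> IsProp (Fiber (\<up>P) ?I (\<up>(TLam P (TStar T))) v0) \<Colon> TUniv T"
    by (insert I1 P P1; (assumption | rule tyA | simp (no_asm))+)
  then have "inh ?\<Delta> (IsProp (Fiber (\<up>P) ?I (\<up>(TLam P (TStar T))) v0))"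
    by (rule inh_convert[OF z]) (simp add: Fiber_def)
  then show ?thesis unfolding IsEmb_def by (intro inh_Pi) simp
qed

lemma flabby:
  assumes \<Gamma>: "ctx S \<Gamma>" and D: "\<Gamma> \<turnstile> D \<Colon> TUniv v" and w: "\<Gamma> \<turnstile> w \<Colon> AlgInj T T D"
    and P: "\<Gamma> \<turnstile> P \<Colon> TUniv T" and i: "inh \<Gamma> (IsProp P)" and f: "\<Gamma> \<turnstile> f \<Colon> Arr P D"
  obtains d where "\<Gamma> \<turnstile> d \<Colon> D" and "inh (P # \<Gamma>) (TId (\<up>D) (\<up>d) (TApp (\<up>f) v0))"
proof -
  let ?I = "TUnit T" and ?j = "TLam P (TStar T)"
  have I: "\<Gamma> \<turnstile> ?I \<Colon> TUniv T" using \<Gamma> by (rule ty_Unit)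
  have P1: "ctx S (P # \<Gamma>)" using P by (rule ctx_Cons)
  from terminal_embedding[OF \<Gamma> P i] obtain k where k: "\<Gamma> \<turnstile> k \<Colon> IsEmb P ?I ?j"
    by (auto simp: inh_def)
  define m where "m = TPair ?j k"
  have m: "\<Gamma> \<turnstile> m \<Colon> Emb P ?I" unfolding m_def Emb_def
    by (rule Pair_eq, insert \<Gamma> P I k, (assumption | rule tyA | simp (no_asm))+)
  have x: "\<Gamma> \<turnstile> TApp (TApp (TApp (TApp w P) ?I) m) f \<Colon> Extension P ?I D m f"
    by (insert I P m f w[unfolded AlgInj_def];
      (assumption | rule ty_Unit[OF \<Gamma>] tyE | simp (no_asm))+)
  have A: "\<Gamma> \<turnstile> Arr ?I D \<Colon> TUniv (T \<squnion> v)" by (insert I D; (assumption | rule tyA | simp (no_asm))+)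
  then have A1: "ctx S (Arr ?I D # \<Gamma>)" by (rule ctx_Cons)
  have B: "Arr ?I D # \<Gamma> \<turnstile> Htpy (\<up>P) (\<up>D) (Comp (\<up>P) v0 (EmbFun (\<up>P) (\<up>?I) (\<up>m))) (\<up>f)
    \<Colon> TUniv (T \<squnion> v)"
    by (insert A1 P D m f; (simp (no_asm))?; (assumption | rule tyA | simp (no_asm) add: sup_aci)+)
  from inh_SigE[OF \<Gamma> A B inhI[OF x[unfolded Extension_def]]] obtain g where g: "\<Gamma> \<turnstile> g \<Colon> Arr ?I D"
    and h: "inh \<Gamma> (subst 0 g (Htpy (\<up>P) (\<up>D) (Comp (\<up>P) v0 (EmbFun (\<up>P) (\<up>?I) (\<up>m))) (\<up>f)))" .
  let ?d = "TApp g (TStar T)"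
  have d: "\<Gamma> \<turnstile> ?d \<Colon> D" by (insert \<Gamma> g; (assumption | rule tyA | simp (no_asm))+)
  have "P # \<Gamma> \<turnstile> TId (\<up>D) (\<up>?d) (TApp (\<up>f) v0) \<Colon> TUniv v"
    by (insert P1 D g f; (simp (no_asm))?; (assumption | rule tyA | simp (no_asm))+)
  then have "inh (P # \<Gamma>) (TId (\<up>D) (\<up>?d) (TApp (\<up>f) v0))"
    by (rule inh_convert[OF inh_Pi_open[OF h[simplified] P1]])
      (simp add: EmbFun_def m_def)
  with d show ?thesis by (rule that)
qed

end

section \<open>Injective types are retracts of free algebras\<close>

lemma UnitPrf_class_closed [simp]:
  "cshift k (abs_ctm (UnitPrf T)) = abs_ctm (UnitPrf T)"
  "csubst k s (abs_ctm (UnitPrf T)) = abs_ctm (UnitPrf T)"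
  by (simp_all add: UnitPrf_def)

context univalent_type_theory
begin

lemma free_algebra:
  assumes \<Gamma>: "ctx S \<Gamma>" and X: "\<Gamma> \<turnstile> X \<Colon> TUniv v"
  shows "inh \<Gamma> (Alg T (Lift T X))"
proof -
  let ?L = "Lift T X" and ?LL = "Lift T (Lift T X)" and ?m = "LMult T X"
  have L: "\<Gamma> \<turnstile> ?L \<Colon> TUniv (next_level T \<squnion> v)" using \<Gamma> X by (rule Lift_eq) simp
  have m: "\<Gamma> \<turnstile> ?m \<Colon> Arr ?LL ?L" by (rule LMult_eq[OF \<Gamma> X refl])
  have L1: "ctx S (?L # \<Gamma>)" using L by (rule ctx_Cons)
  have X1: "?L # \<Gamma> \<turnstile> \<up>X \<Colon> TUniv v" using weaken[OF X L1] by simp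
  have v1: "?L # \<Gamma> \<turnstile> v0 \<Colon> Lift T (\<up>X)" using ty_lookup[OF L1, of 0] by simp
  have "\<Gamma> \<turnstile> UnitLaw T ?L ?m \<Colon> TUniv (next_level T \<squnion> v)" by (rule UnitLaw_eq[OF \<Gamma> L m refl])
  then have unit: "inh \<Gamma> (UnitLaw T ?L ?m)"
    by (rule inh_convert[OF inh_Pi[OF mult_unit[OF L1 X1 v1]]])
      (simp add: UnitLaw_def LMult_def LUnit_def Let_def)
  have "\<Gamma> \<turnstile> Lift T ?LL \<Colon> TUniv (next_level T \<squnion> v)"
    by (insert \<Gamma> X; (assumption | rule tyA | simp (no_asm))+)
  then have L3: "ctx S (Lift T ?LL # \<Gamma>)" by (rule ctx_Cons)
  have X3: "Lift T ?LL # \<Gamma> \<turnstile> \<up>X \<Colon> TUniv v" using weaken[OF X L3] by simp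
  have v3: "Lift T ?LL # \<Gamma> \<turnstile> v0 \<Colon> Lift T (Lift T (Lift T (\<up>X)))" using ty_lookup[OF L3, of 0]
    by simp
  have "\<Gamma> \<turnstile> AssocLaw T ?L ?m \<Colon> TUniv (next_level T \<squnion> v)" by (rule AssocLaw_eq[OF \<Gamma> L m]) simp
  then have assoc: "inh \<Gamma> (AssocLaw T ?L ?m)"
    by (rule inh_convert[OF inh_Pi[OF mult_assoc[OF L3 X3 v3]]])
      (simp add: AssocLaw_def LMult_def LMap_def Let_def)
  from unit obtain p where p: "\<Gamma> \<turnstile> p \<Colon> UnitLaw T ?L ?m" by (auto simp: inh_def)
  from assoc obtain q where q: "\<Gamma> \<turnstile> q \<Colon> AssocLaw T ?L ?m" by (auto simp: inh_def)
  show ?thesis by (rule inhI[OF Alg_pair[OF \<Gamma> L m p q]])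
qed

end

context type_theory
begin

lemma injective_retract_of_lifting:
  assumes \<Gamma>: "ctx S \<Gamma>" and D: "\<Gamma> \<turnstile> D \<Colon> TUniv v" and w: "\<Gamma> \<turnstile> w \<Colon> AlgInj T T D"
  shows "inh \<Gamma> (Ret D (Lift T D))"
proof -
  let ?L = "Lift T D"
  have L: "\<Gamma> \<turnstile> ?L \<Colon> TUniv (next_level T \<squnion> v)" using \<Gamma> D by (rule Lift_eq) simp
  then have L1: "ctx S (?L # \<Gamma>)" by (rule ctx_Cons)
  have D1: "?L # \<Gamma> \<turnstile> \<up>D \<Colon> TUniv v" and w1: "?L # \<Gamma> \<turnstile> \<up>w \<Colon> AlgInj T T (\<up>D)"
    and l: "?L # \<Gamma> \<turnstile> v0 \<Colon> Lift T (\<up>D)"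
    using weaken[OF D L1] weaken[OF w L1] ty_lookup[OF L1, of 0] by simp_all
  let ?P = "LDom T (\<up>D) v0"
  have P: "?L # \<Gamma> \<turnstile> ?P \<Colon> TUniv T" by (rule LDom_eq[OF L1 D1 l refl])
  from flabby[OF L1 D1 w1 P inhI[OF LPrf_eq[OF L1 D1 l refl]] LVal_eq[OF L1 D1 l refl]]
  obtain d where d: "?L # \<Gamma> \<turnstile> d \<Colon> \<up>D"
    and h: "inh (?P # ?L # \<Gamma>) (TId (\<up>\<up>D) (\<up>d) (TApp (\<up>(LVal T (\<up>D) v0)) v0))" by blast
  have P1: "ctx S (?P # ?L # \<Gamma>)" using P by (rule ctx_Cons)
  define r where "r = TLam ?L d"
  have r: "\<Gamma> \<turnstile> r \<Colon> Arr ?L D" unfolding r_def using d by (rule ty_Lam)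
  have "?P # ?L # \<Gamma> \<turnstile> TId (\<up>\<up>D) (TApp (\<up>\<up>r) v1) (TApp (LVal T (\<up>\<up>D) v1) v0) \<Colon> TUniv v"
    by (insert D L1 P1 r; (assumption | rule tyA | simp (no_asm))+)
  then have "inh (?P # ?L # \<Gamma>) (TId (\<up>\<up>D) (TApp (\<up>\<up>r) v1) (TApp (LVal T (\<up>\<up>D) v1) v0))"
    by (rule inh_convert[OF h]) (simp add: r_def)
  then have H: "inh \<Gamma> (TPi ?L (TPi ?P (TId (\<up>\<up>D) (TApp (\<up>\<up>r) v1) (TApp (LVal T (\<up>\<up>D) v1) v0))))"
    by (intro inh_Pi)
  have C1: "ctx S (D # \<Gamma>)" using D by (rule ctx_Cons)
  have D1: "D # \<Gamma> \<turnstile> \<up>D \<Colon> TUniv v" using weaken[OF D C1] by simp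
  let ?l = "TApp (LUnit T (\<up>D)) v0"
  have l: "D # \<Gamma> \<turnstile> ?l \<Colon> Lift T (\<up>D)"
    by (insert D C1; (assumption | rule tyA | simp (no_asm))+)
  have H1: "inh (D # \<Gamma>) (TPi (Lift T (\<up>D)) (TPi (LDom T (\<up>\<up>D) v0)
      (TId (\<up>\<up>\<up>D) (TApp (\<up>\<up>\<up>r) v1) (TApp (LVal T (\<up>\<up>\<up>D) v1) v0))))"
    by (rule inh_weaken[OF H C1]) simp
  have H2: "inh (D # \<Gamma>) (TPi (LDom T (\<up>D) ?l)
    (TId (\<up>\<up>D) (TApp (\<up>\<up>r) (\<up>?l)) (TApp (LVal T (\<up>\<up>D) (\<up>?l)) v0)))"
    by (rule inh_Pi_elim[OF H1 l]) simp
  have "D # \<Gamma> \<turnstile> LDom T (\<up>D) ?l \<Colon> TUniv T" by (rule LDom_eq[OF C1 D1 l refl])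
  then have "D # \<Gamma> \<turnstile> TStar T \<Colon> LDom T (\<up>D) ?l"
    by (rule ty_convert[OF ty_Star[OF C1]]) (simp add: LUnit_def)
  note H3 = inh_Pi_elim[OF H2 this refl]
  define s where "s = LUnit T D"
  have s: "\<Gamma> \<turnstile> s \<Colon> Arr D ?L" unfolding s_def by (rule LUnit_eq[OF \<Gamma> D refl])
  have "D # \<Gamma> \<turnstile> TId (\<up>D) (TApp (\<up>(Comp D r s)) v0) (TApp (\<up>(IdF D)) v0) \<Colon> TUniv v"
    by (insert C1 D r s; (simp (no_asm))?; (assumption | rule tyA | simp (no_asm))+)
  then have "inh (D # \<Gamma>) (TId (\<up>D) (TApp (\<up>(Comp D r s)) v0) (TApp (\<up>(IdF D)) v0))"
    by (rule inh_convert[OF H3]) (simp add: LUnit_def s_def)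
  then have "inh \<Gamma> (Htpy D D (Comp D r s) (IdF D))" by (rule inh_Pi)
  then obtain k where k: "\<Gamma> \<turnstile> k \<Colon> Htpy D D (Comp D r s) (IdF D)" by (auto simp: inh_def)
  show ?thesis by (rule inhI[OF Ret_pair[OF D L s r k]])
qed

end

context univalent_type_theory
begin

theorem injective_retract_of_algebra:
  assumes \<Gamma>: "ctx S \<Gamma>" and D: "\<Gamma> \<turnstile> D \<Colon> TUniv T" and w: "\<Gamma> \<turnstile> w \<Colon> AlgInj T T D"
  shows "inh \<Gamma> (RetAlg T (next_level T) D)"
proof -
  have L: "\<Gamma> \<turnstile> Lift T D \<Colon> TUniv (next_level T)" using \<Gamma> D by (rule Lift_eq) simp
  from free_algebra[OF \<Gamma> D, of T] obtain p where p: "\<Gamma> \<turnstile> p \<Colon> Alg T (Lift T D)"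
    by (auto simp: inh_def)
  from injective_retract_of_lifting[OF \<Gamma> D w] obtain q where q: "\<Gamma> \<turnstile> q \<Colon> Ret D (Lift T D)"
    by (auto simp: inh_def)
  show ?thesis by (rule inhI[OF RetAlg_pair[OF \<Gamma> D L p q]])
qed

section \<open>Retracts of algebras are injective\<close>

lemma algebra_join_inhabited:
  assumes \<Gamma>: "ctx S \<Gamma>" and X: "\<Gamma> \<turnstile> X \<Colon> TUniv v"
    and a: "\<Gamma> \<turnstile> a \<Colon> Arr (Lift T X) X" and unit: "inh \<Gamma> (UnitLaw T X a)"
    and P: "\<Gamma> \<turnstile> P \<Colon> TUniv T" and f: "\<Gamma> \<turnstile> f \<Colon> Arr P X" and i: "\<Gamma> \<turnstile> i \<Colon> IsProp P"
    and u: "\<Gamma> \<turnstile> u \<Colon> P"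
  shows "inh \<Gamma> (TId X (TApp a (TPair P (TPair f i))) (TApp f u))"
proof -
  let ?I = "TUnit T" and ?x = "TApp f u"
  have I: "\<Gamma> \<turnstile> ?I \<Colon> TUniv T" using \<Gamma> by (rule ty_Unit)
  have I1: "ctx S (?I # \<Gamma>)" using I by (rule ctx_Cons)
  have P1: "ctx S (P # \<Gamma>)" using P by (rule ctx_Cons)
  have L: "\<Gamma> \<turnstile> Lift T X \<Colon> TUniv (next_level T \<squnion> v)" using \<Gamma> X by (rule Lift_eq) simp
  have L1: "ctx S (Lift T X # \<Gamma>)" using L by (rule ctx_Cons)
  have x: "\<Gamma> \<turnstile> ?x \<Colon> X" by (insert f u; (assumption | rule tyA | simp (no_asm))+)
  define g where "g = TLam ?I (\<up>?x)"
  define e where "e = TLam P (TStar T)"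
  define e' where "e' = TLam ?I (\<up>u)"
  have g: "\<Gamma> \<turnstile> g \<Colon> Arr ?I X" unfolding g_def using weaken[OF x I1] by (rule ty_Lam)
  have e: "\<Gamma> \<turnstile> e \<Colon> Arr P ?I" unfolding e_def using ty_Lam[OF ty_Star[OF P1]] by simp
  have e': "\<Gamma> \<turnstile> e' \<Colon> Arr ?I P" unfolding e'_def using weaken[OF u I1] by (rule ty_Lam)
  have u1: "P # \<Gamma> \<turnstile> \<up>u \<Colon> \<up>P" and i1: "P # \<Gamma> \<turnstile> \<up>i \<Colon> IsProp (\<up>P)" and X1: "P # \<Gamma> \<turnstile> \<up>X \<Colon> TUniv v"
    and PP: "P # \<Gamma> \<turnstile> \<up>P \<Colon> TUniv T" and p0: "P # \<Gamma> \<turnstile> v0 \<Colon> \<up>P" and f1: "P # \<Gamma> \<turnstile> \<up>f \<Colon> Arr (\<up>P) (\<up>X)"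
    using weaken[OF u P1] weaken[OF i P1] weaken[OF X P1] weaken[OF P P1] ty_lookup[OF P1, of 0]
      weaken[OF f P1] by simp_all
  have PP1: "ctx S (\<up>P # P # \<Gamma>)" using PP by (rule ctx_Cons)
  have t: "\<up>P # P # \<Gamma> \<turnstile> TApp (\<up>\<up>f) v0 \<Colon> \<up>\<up>X"
    by (insert PP1 f1; (assumption | rule tyA | simp (no_asm))+)
  have 1: "inh (P # \<Gamma>) (TId (\<up>X) (TApp (\<up>f) v0) (TApp (\<up>f) (\<up>u)))"
    by (rule inh_Id_cong[OF P1 PP X1 t p0 u1 inhI[OF IsProp_app[OF i1 p0 u1]]]) simp_all
  have "P # \<Gamma> \<turnstile> TId (\<up>X) (TApp (\<up>f) v0) (TApp (\<up>g) (TApp (\<up>e) v0)) \<Colon> TUniv v"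
    by (insert P1 X f g e; (assumption | rule tyA | simp (no_asm))+)
  then have "inh (P # \<Gamma>) (TId (\<up>X) (TApp (\<up>f) v0) (TApp (\<up>g) (TApp (\<up>e) v0)))"
    by (rule inh_convert[OF 1]) (simp add: g_def e_def)
  note 2 = Lift_ext[OF \<Gamma> X P f i I g ty_UnitPrf[OF \<Gamma>] e e' this]
  have t': "Lift T X # \<Gamma> \<turnstile> TApp (\<up>a) v0 \<Colon> \<up>X"
    by (insert L1 a; (assumption | rule tyA | simp (no_asm))+)
  let ?y = "TPair P (TPair f i)" and ?z = "TPair ?I (TPair g (UnitPrf T))"
  have y: "\<Gamma> \<turnstile> ?y \<Colon> Lift T X" by (rule Lift_pair[OF \<Gamma> X P f i])
  have z: "\<Gamma> \<turnstile> ?z \<Colon> Lift T X" by (rule Lift_pair[OF \<Gamma> X I g ty_UnitPrf[OF \<Gamma>]])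
  have 3: "inh \<Gamma> (TId X (TApp a ?y) (TApp a ?z))"
    by (rule inh_Id_cong[OF \<Gamma> L X t' y z 2]) simp_all
  have ay: "\<Gamma> \<turnstile> TApp a ?y \<Colon> X" and az: "\<Gamma> \<turnstile> TApp a ?z \<Colon> X"
    using ty_App[OF a y] ty_App[OF a z] by simp_all
  have "inh \<Gamma> (TId X (TApp (Comp X a (LUnit T X)) ?x) (TApp (IdF X) ?x))"
    by (rule inh_Pi_elim[OF unit[unfolded UnitLaw_def] x]) simp
  moreover have "\<Gamma> \<turnstile> TId X (TApp a ?z) ?x \<Colon> TUniv v" using X az x by (rule ty_Id)
  ultimately have 4: "inh \<Gamma> (TId X (TApp a ?z) ?x)"
    by (rule inh_convert) (simp add: LUnit_def g_def UnitPrf_def)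
  show ?thesis by (rule inh_Id_trans[OF \<Gamma> X ay az x 3 4])
qed

end

context type_theory
begin

definition FiberElem :: "'l tm \<Rightarrow> 'l tm \<Rightarrow> 'l tm \<Rightarrow> 'l tm \<Rightarrow> 'l tm \<Rightarrow> 'l tm \<Rightarrow> 'l tm" where
  "FiberElem A B j k h b = TPair (Fiber A B j b) (TPair
    (TLam (Fiber A B j b) (TApp (\<up>h) (Prj1 (\<up>A) (TId (\<up>\<up>B) (TApp (\<up>\<up>j) v0) (\<up>\<up>b)) v0))) (TApp k b))"

lemma FiberElem_simps [simp]:
  "shift n (FiberElem A B j k h b) =
    FiberElem (shift n A) (shift n B) (shift n j) (shift n k) (shift n h) (shift n b)"
  "subst n s (FiberElem A B j k h b) =
    FiberElem (subst n s A) (subst n s B) (subst n s j) (subst n s k) (subst n s h) (subst n s b)"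
  by (simp_all add: FiberElem_def)

lemma ty_fiber_fun:
  assumes \<Gamma>: "ctx S \<Gamma>" and A: "\<Gamma> \<turnstile> A \<Colon> TUniv T" and B: "\<Gamma> \<turnstile> B \<Colon> TUniv T" and X: "\<Gamma> \<turnstile> X \<Colon> TUniv v"
    and j: "\<Gamma> \<turnstile> j \<Colon> Arr A B" and h: "\<Gamma> \<turnstile> h \<Colon> Arr A X" and b: "\<Gamma> \<turnstile> b \<Colon> B"
  shows "\<Gamma> \<turnstile> TLam (Fiber A B j b) (TApp (\<up>h) (Prj1 (\<up>A) (TId (\<up>\<up>B) (TApp (\<up>\<up>j) v0) (\<up>\<up>b)) v0))
    \<Colon> Arr (Fiber A B j b) X"
  unfolding Fiber_def
  by (insert assms; (simp (no_asm))?; (assumption | rule tyL | simp (no_asm))+)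

lemma FiberElem_eq:
  assumes "ctx S \<Gamma>" "\<Gamma> \<turnstile> A \<Colon> TUniv T" "\<Gamma> \<turnstile> B \<Colon> TUniv T" "\<Gamma> \<turnstile> X \<Colon> TUniv v"
    and "\<Gamma> \<turnstile> j \<Colon> Arr A B" "\<Gamma> \<turnstile> h \<Colon> Arr A X" "\<Gamma> \<turnstile> b \<Colon> B" "\<Gamma> \<turnstile> k \<Colon> IsEmb A B j"
  shows "\<Gamma> \<turnstile> FiberElem A B j k h b \<Colon> Lift T X"
    and "\<Gamma> \<turnstile> TApp k b \<Colon> IsProp (Fiber A B j b)" and "\<Gamma> \<turnstile> Fiber A B j b \<Colon> TUniv T"
proof -
  show F: "\<Gamma> \<turnstile> Fiber A B j b \<Colon> TUniv T" using assms(2,3,5,7) by (rule Fiber_eq) simp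
  show k: "\<Gamma> \<turnstile> TApp k b \<Colon> IsProp (Fiber A B j b)"
    using ty_App[OF assms(8)[unfolded IsEmb_def] assms(7)] by simp
  show "\<Gamma> \<turnstile> FiberElem A B j k h b \<Colon> Lift T X"
    unfolding FiberElem_def by (rule Lift_pair[OF assms(1,4) F ty_fiber_fun[OF assms(1-7)] k])
qed

end

context univalent_type_theory
begin

lemma algebra_retract_extension:
  assumes \<Gamma>: "ctx S \<Gamma>" and D: "\<Gamma> \<turnstile> D \<Colon> TUniv w" and X: "\<Gamma> \<turnstile> X \<Colon> TUniv v"
    and a: "\<Gamma> \<turnstile> a \<Colon> Arr (Lift T X) X" and unit: "inh \<Gamma> (UnitLaw T X a)"
    and s: "\<Gamma> \<turnstile> s \<Colon> Arr D X" and r: "\<Gamma> \<turnstile> r \<Colon> Arr X D"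
    and rs: "inh \<Gamma> (Htpy D D (Comp D r s) (IdF D))"
    and A: "\<Gamma> \<turnstile> A \<Colon> TUniv T" and B: "\<Gamma> \<turnstile> B \<Colon> TUniv T" and m: "\<Gamma> \<turnstile> m \<Colon> Emb A B"
    and f: "\<Gamma> \<turnstile> f \<Colon> Arr A D"
  shows "inh \<Gamma> (Extension A B D m f)"
proof -
  define j where "j = EmbFun A B m"
  have j: "\<Gamma> \<turnstile> j \<Colon> Arr A B" unfolding j_def by (rule EmbFun_eq[OF A B m refl])
  from inh_EmbFun[OF \<Gamma> A B m] obtain k where k: "\<Gamma> \<turnstile> k \<Colon> IsEmb A B j" by (auto simp: inh_def j_def)
  define h where "h = Comp A s f"
  have h: "\<Gamma> \<turnstile> h \<Colon> Arr A X" unfolding h_def by (insert A s f;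
    (assumption | rule tyA | simp (no_asm))+)
  have A1: "ctx S (A # \<Gamma>)" using A by (rule ctx_Cons)
  have B1: "ctx S (B # \<Gamma>)" using B by (rule ctx_Cons)
  have X1: "ctx S (X # \<Gamma>)" using X by (rule ctx_Cons)
  define g where "g = TLam B (TApp (\<up>r) (TApp (\<up>a) (FiberElem (\<up>A) (\<up>B) (\<up>j) (\<up>k) (\<up>h) v0)))"
  have "B # \<Gamma> \<turnstile> FiberElem (\<up>A) (\<up>B) (\<up>j) (\<up>k) (\<up>h) v0 \<Colon> Lift T (\<up>X)"
    using weaken[OF A B1] weaken[OF B B1] weaken[OF X B1] weaken[OF j B1] weaken[OF k B1]
      weaken[OF h B1] ty_lookup[OF B1, of 0]
    by (intro FiberElem_eq(1)[OF B1]) simp_all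
  then have g: "\<Gamma> \<turnstile> g \<Colon> Arr B D" unfolding g_def
    by - (insert B B1 r a; (assumption | rule tyA | simp (no_asm))+)
  let ?b = "TApp (\<up>j) v0"
  let ?F = "Fiber (\<up>A) (\<up>B) (\<up>j) ?b" and ?E = "FiberElem (\<up>A) (\<up>B) (\<up>j) (\<up>k) (\<up>h) ?b"
  have b: "A # \<Gamma> \<turnstile> ?b \<Colon> \<up>B" by (insert A1 j; (assumption | rule tyA | simp (no_asm))+)
  have A': "A # \<Gamma> \<turnstile> \<up>A \<Colon> TUniv T" and B': "A # \<Gamma> \<turnstile> \<up>B \<Colon> TUniv T" and X': "A # \<Gamma> \<turnstile> \<up>X \<Colon> TUniv v"
    and D': "A # \<Gamma> \<turnstile> \<up>D \<Colon> TUniv w"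
    and j': "A # \<Gamma> \<turnstile> \<up>j \<Colon> Arr (\<up>A) (\<up>B)" and h': "A # \<Gamma> \<turnstile> \<up>h \<Colon> Arr (\<up>A) (\<up>X)"
    and k': "A # \<Gamma> \<turnstile> \<up>k \<Colon> IsEmb (\<up>A) (\<up>B) (\<up>j)"
    and a': "A # \<Gamma> \<turnstile> \<up>a \<Colon> Arr (Lift T (\<up>X)) (\<up>X)" and u': "inh (A # \<Gamma>) (UnitLaw T (\<up>X) (\<up>a))"
    and r': "A # \<Gamma> \<turnstile> \<up>r \<Colon> Arr (\<up>X) (\<up>D)" and s': "A # \<Gamma> \<turnstile> \<up>s \<Colon> Arr (\<up>D) (\<up>X)"
    using weaken[OF A A1] weaken[OF B A1] weaken[OF X A1] weaken[OF D A1] weaken[OF j A1]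
      weaken[OF h A1] weaken[OF k A1]
      weaken[OF a A1] inh_weaken[OF unit A1 refl] weaken[OF r A1] weaken[OF s A1]
    by simp_all
  have v0: "A # \<Gamma> \<turnstile> v0 \<Colon> \<up>A" using ty_lookup[OF A1, of 0] by simp
  have u: "A # \<Gamma> \<turnstile> TPair v0 (TRefl ?b) \<Colon> ?F" unfolding Fiber_def
    by (insert A1 A' B' j' v0 b; (assumption | rule tyA | simp (no_asm))+)
  let ?\<phi> = "TLam ?F (TApp (\<up>\<up>h) (Prj1 (\<up>\<up>A) (TId (\<up>\<up>\<up>B) (TApp (\<up>\<up>\<up>j) v0) (\<up>\<up>?b)) v0))"
  let ?u = "TPair v0 (TRefl ?b)" and ?fx = "TApp (\<up>f) v0"
  note E = FiberElem_eq[OF A1 A' B' X' j' h' b k']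
  note \<phi> = ty_fiber_fun[OF A1 A' B' X' j' h' b]
  from algebra_join_inhabited[OF A1 X' a' u' E(3) \<phi> E(2) u]
  have 1: "inh (A # \<Gamma>) (TId (\<up>X) (TApp (\<up>a) ?E) (TApp ?\<phi> ?u))" by (simp only: FiberElem_def)
  have fx: "A # \<Gamma> \<turnstile> ?fx \<Colon> \<up>D" by (insert A1 f; (assumption | rule tyA | simp (no_asm))+)
  have sfx: "A # \<Gamma> \<turnstile> TApp (\<up>s) ?fx \<Colon> \<up>X" using App_eq[OF s' fx] by simp
  have aE: "A # \<Gamma> \<turnstile> TApp (\<up>a) ?E \<Colon> \<up>X" using App_eq[OF a' E(1)] by simp
  from ty_Id[OF X' aE sfx] have 2: "inh (A # \<Gamma>) (TId (\<up>X) (TApp (\<up>a) ?E) (TApp (\<up>s) ?fx))"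
    by (rule inh_convert[OF 1]) (simp add: h_def)
  have XX: "ctx S (\<up>X # A # \<Gamma>)" using X' by (rule ctx_Cons)
  have t: "\<up>X # A # \<Gamma> \<turnstile> TApp (\<up>\<up>r) v0 \<Colon> \<up>\<up>D"
    by (insert XX r'; (assumption | rule tyA | simp (no_asm))+)
  have 3: "inh (A # \<Gamma>) (TId (\<up>D) (TApp (\<up>r) (TApp (\<up>a) ?E)) (TApp (\<up>r) (TApp (\<up>s) ?fx)))"
    by (rule inh_Id_cong[OF A1 X' D' t aE sfx 2]) simp_all
  have x: "A # \<Gamma> \<turnstile> TApp (\<up>r) (TApp (\<up>a) ?E) \<Colon> \<up>D" and y: "A # \<Gamma> \<turnstile> TApp (\<up>r) (TApp (\<up>s) ?fx) \<Colon> \<up>D"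
    using App_eq[OF r' aE] App_eq[OF r' sfx] by simp_all
  have "inh (A # \<Gamma>) (TId (\<up>D) (TApp (Comp (\<up>D) (\<up>r) (\<up>s)) ?fx) (TApp (IdF (\<up>D)) ?fx))"
    by (rule inh_Pi_elim[OF inh_weaken[OF rs A1 refl, unfolded shift.simps] fx]) simp
  then have 4: "inh (A # \<Gamma>) (TId (\<up>D) (TApp (\<up>r) (TApp (\<up>s) ?fx)) ?fx)"
    by (rule inh_convert[OF _ ty_Id[OF D' y fx]]) simp
  note 5 = inh_Id_trans[OF A1 D' x y fx 3 4]
  have "A # \<Gamma> \<turnstile> TId (\<up>D) (TApp (\<up>(Comp A g j)) v0) (TApp (\<up>f) v0) \<Colon> TUniv w"
    by (insert A A1 D' g j f; (simp (no_asm))?; (assumption | rule tyA | simp (no_asm))+)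
  then have "inh (A # \<Gamma>) (TId (\<up>D) (TApp (\<up>(Comp A g j)) v0) (TApp (\<up>f) v0))"
    by (rule inh_convert[OF 5]) (simp add: g_def FiberElem_def Fiber_def)
  from inh_Pi[OF this] obtain p where p: "\<Gamma> \<turnstile> p \<Colon> Htpy A D (Comp A g (EmbFun A B m)) f"
    by (auto simp: inh_def j_def)
  note p = p[simplified]
  show ?thesis unfolding Extension_def
    by (rule inhI[where t = "TPair g p"])
      (insert A B D m f g p; (simp (no_asm))?; (assumption | rule tyA | simp (no_asm))+)
qed

end

context type_theory
begin

lemma AlgInj_eq:
  assumes \<Gamma>: "ctx S \<Gamma>" and D: "\<Gamma> \<turnstile> D \<Colon> TUniv w"
  shows "\<exists>l. \<Gamma> \<turnstile> AlgInj u v D \<Colon> TUniv l"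
  unfolding AlgInj_def
  by (rule exI) (insert \<Gamma> D; (simp (no_asm))?; (assumption | rule tyA | simp (no_asm))+)

lemma RetAlg_eq:
  assumes \<Gamma>: "ctx S \<Gamma>" and D: "\<Gamma> \<turnstile> D \<Colon> TUniv w"
  shows "\<exists>l. \<Gamma> \<turnstile> RetAlg T v D \<Colon> TUniv l"
  unfolding RetAlg_def
  by (rule exI) (insert \<Gamma> D; (simp (no_asm))?; (assumption | rule tyA | simp (no_asm))+)

end

context univalent_type_theory
begin

theorem algebra_retract_injective:
  assumes \<Gamma>: "ctx S \<Gamma>" and D: "\<Gamma> \<turnstile> D \<Colon> TUniv T" and w: "\<Gamma> \<turnstile> w \<Colon> RetAlg T v D"
  shows "inh \<Gamma> (AlgInj T T D)"
proof -
  have U1: "ctx S (TUniv v # \<Gamma>)" by (rule ctx_Cons[OF ty_Univ[OF \<Gamma>]])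
  have 1: "TUniv v # \<Gamma> \<turnstile> TSig (Alg T v0) (\<up>(Ret (\<up>D) v0)) \<Colon> TUniv ((next_level T \<squnion> v) \<squnion> (T \<squnion> v))"
    by (insert U1 D; (simp (no_asm))?; (assumption | rule tyA | simp (no_asm))+)
  from inh_SigE[OF \<Gamma> ty_Univ[OF \<Gamma>] 1 inhI[OF w[unfolded RetAlg_def]]]
  obtain X where X: "\<Gamma> \<turnstile> X \<Colon> TUniv v" and X2:
    "inh \<Gamma> (subst 0 X (TSig (Alg T v0) (\<up>(Ret (\<up>D) v0))))" .
  have X2: "inh \<Gamma> (TSig (Alg T X) (\<up>(Ret D X)))" using X2 by simp
  have A: "\<Gamma> \<turnstile> Alg T X \<Colon> TUniv (next_level T \<squnion> v)" by (rule Alg_eq[OF \<Gamma> X refl])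
  have R: "\<Gamma> \<turnstile> Ret D X \<Colon> TUniv (T \<squnion> v)" by (rule Ret_eq[OF D X refl])
  from inh_SigE[OF \<Gamma> A weaken[OF R ctx_Cons[OF A], unfolded shift.simps] X2[unfolded shift.simps]]
  have alg: "inh \<Gamma> (Alg T X)" and ret: "inh \<Gamma> (Ret D X)" by (auto intro: inhI)
  have F: "\<Gamma> \<turnstile> Arr (Lift T X) X \<Colon> TUniv (next_level T \<squnion> v)"
    by (insert \<Gamma> X; (assumption | rule tyA | simp (no_asm) add: sup_aci)+)
  then have F1: "ctx S (Arr (Lift T X) X # \<Gamma>)" by (rule ctx_Cons)
  have 2: "Arr (Lift T X) X # \<Gamma> \<turnstile> TSig (UnitLaw T (\<up>X) v0) (\<up>(AssocLaw T (\<up>X) v0))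
    \<Colon> TUniv (v \<squnion> (next_level T \<squnion> v))"
    by (insert F1[simplified] X; (simp (no_asm))?; (assumption | rule tyA | simp (no_asm))+)
  from inh_SigE[OF \<Gamma> F 2 alg[unfolded Alg_def]]
  obtain a where a: "\<Gamma> \<turnstile> a \<Colon> Arr (Lift T X) X"
  and a2: "inh \<Gamma> (TSig (UnitLaw T X a) (\<up>(AssocLaw T X a)))"
    by auto
  have L: "\<Gamma> \<turnstile> UnitLaw T X a \<Colon> TUniv v" by (rule UnitLaw_eq[OF \<Gamma> X a refl])
  have "\<Gamma> \<turnstile> AssocLaw T X a \<Colon> TUniv (next_level T \<squnion> v)" by (rule AssocLaw_eq[OF \<Gamma> X a refl])
  from inh_SigE[OF \<Gamma> L weaken[OF this ctx_Cons[OF L], unfolded shift.simps]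
    a2[unfolded shift.simps]]
  have unit: "inh \<Gamma> (UnitLaw T X a)" by (auto intro: inhI)
  have G: "\<Gamma> \<turnstile> Arr D X \<Colon> TUniv (T \<squnion> v)" by (insert D X; (assumption | rule tyA | simp (no_asm))+)
  then have G1: "ctx S (Arr D X # \<Gamma>)" by (rule ctx_Cons)
  have 3: "Arr D X # \<Gamma> \<turnstile> TSig (Arr (\<up>X) (\<up>D)) (Htpy (\<up>\<up>D) (\<up>\<up>D) (Comp (\<up>\<up>D) v0 v1) (IdF (\<up>\<up>D)))
    \<Colon> TUniv (v \<squnion> T)"
    by (insert D G1 X; (simp (no_asm))?; (assumption | rule tyA | simp (no_asm) add: sup_aci)+)
  from inh_SigE[OF \<Gamma> G 3 ret[unfolded Ret_def]]
  obtain s where s: "\<Gamma> \<turnstile> s \<Colon> Arr D X" and s2: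
    "inh \<Gamma> (TSig (Arr X D) (Htpy (\<up>D) (\<up>D) (Comp (\<up>D) v0 (\<up>s)) (IdF (\<up>D))))"
    by auto
  have H: "\<Gamma> \<turnstile> Arr X D \<Colon> TUniv (v \<squnion> T)" by (insert D X; (assumption | rule tyA | simp (no_asm))+)
  then have H1: "ctx S (Arr X D # \<Gamma>)" by (rule ctx_Cons)
  have 4: "Arr X D # \<Gamma> \<turnstile> Htpy (\<up>D) (\<up>D) (Comp (\<up>D) v0 (\<up>s)) (IdF (\<up>D)) \<Colon> TUniv T"
    by (insert D H1 X s; (simp (no_asm))?; (assumption | rule tyA | simp (no_asm) add: sup_aci)+)
  from inh_SigE[OF \<Gamma> H 4 s2]
  obtain r where r: "\<Gamma> \<turnstile> r \<Colon> Arr X D" and rs: "inh \<Gamma> (Htpy D D (Comp D r s) (IdF D))"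
    by auto
  have C1: "ctx S (TUniv T # \<Gamma>)" by (rule ctx_Cons[OF ty_Univ[OF \<Gamma>]])
  have C2: "ctx S (TUniv T # TUniv T # \<Gamma>)" by (rule ctx_Cons[OF ty_Univ[OF C1]])
  have "TUniv T # TUniv T # \<Gamma> \<turnstile> Emb v1 v0 \<Colon> TUniv T"
    by (insert C1 C2; (assumption | rule tyA | simp (no_asm))+)
  then have C3: "ctx S (Emb v1 v0 # TUniv T # TUniv T # \<Gamma>)" by (rule ctx_Cons)
  let ?F = "Arr v2 (\<up>\<up>\<up>D)"
  have "Emb v1 v0 # TUniv T # TUniv T # \<Gamma> \<turnstile> ?F \<Colon> TUniv T"
    by (insert C1 C2 C3 D; (assumption | rule tyA | simp (no_asm))+)
  then have C4: "ctx S (?F # Emb v1 v0 # TUniv T # TUniv T # \<Gamma>)" by (rule ctx_Cons)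
  let ?\<Delta> = "?F # Emb v1 v0 # TUniv T # TUniv T # \<Gamma>"
  have wk: "?\<Delta> \<turnstile> \<up>\<up>\<up>\<up>t \<Colon> \<up>\<up>\<up>\<up>A" if "\<Gamma> \<turnstile> t \<Colon> A" for t A
    by (rule weaken[OF weaken[OF weaken[OF weaken[OF that C1] C2] C3] C4])
  have inh_wk: "inh ?\<Delta> (\<up>\<up>\<up>\<up>A)" if "inh \<Gamma> A" for A
    using that wk by (auto simp: inh_def)
  have D4: "?\<Delta> \<turnstile> \<up>\<up>\<up>\<up>D \<Colon> TUniv T" and X4: "?\<Delta> \<turnstile> \<up>\<up>\<up>\<up>X \<Colon> TUniv v"
    and a4: "?\<Delta> \<turnstile> \<up>\<up>\<up>\<up>a \<Colon> Arr (Lift T (\<up>\<up>\<up>\<up>X)) (\<up>\<up>\<up>\<up>X)"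
    and unit4: "inh ?\<Delta> (UnitLaw T (\<up>\<up>\<up>\<up>X) (\<up>\<up>\<up>\<up>a))"
    and s4: "?\<Delta> \<turnstile> \<up>\<up>\<up>\<up>s \<Colon> Arr (\<up>\<up>\<up>\<up>D) (\<up>\<up>\<up>\<up>X)" and r4: "?\<Delta> \<turnstile> \<up>\<up>\<up>\<up>r \<Colon> Arr (\<up>\<up>\<up>\<up>X) (\<up>\<up>\<up>\<up>D)"
    and rs4: "inh ?\<Delta> (Htpy (\<up>\<up>\<up>\<up>D) (\<up>\<up>\<up>\<up>D) (Comp (\<up>\<up>\<up>\<up>D) (\<up>\<up>\<up>\<up>r) (\<up>\<up>\<up>\<up>s)) (IdF (\<up>\<up>\<up>\<up>D)))"
    using wk[OF D] wk[OF X] wk[OF a] inh_wk[OF unit] wk[OF s] wk[OF r] inh_wk[OF rs] by simp_all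
  have v: "?\<Delta> \<turnstile> v3 \<Colon> TUniv T" "?\<Delta> \<turnstile> v2 \<Colon> TUniv T" "?\<Delta> \<turnstile> v1 \<Colon> Emb v3 v2"
    "?\<Delta> \<turnstile> v0 \<Colon> Arr v3 (\<up>\<up>\<up>\<up>D)"
    using ty_lookup[OF C4, of "Suc (Suc (Suc 0))"] ty_lookup[OF C4, of "Suc (Suc 0)"]
      ty_lookup[OF C4, of "Suc 0"]
      ty_lookup[OF C4, of 0] by simp_all
  from algebra_retract_extension[OF C4 D4 X4 a4 unit4 s4 r4 rs4 v]
  show ?thesis unfolding AlgInj_def by (intro inh_Pi)
qed

end

lemma stable_from_bound_var: "stable_from (Suc k) (bound_var k)"
  by (auto simp: stable_from_def bound_var_def Suc_diff_Suc)

lemma stable_from_lifting: "stable_from n X \<Longrightarrow> stable_from n (lifting T X)"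
  by (auto simp: stable_from_def lifting_raw)

lemma alg_injective_raw:
  assumes "stable_from n D"
  shows "alg_injective u v D n = AlgInj u v (D n)"
  by (simp add: alg_injective_def embedding_def emb_fun_def is_embedding_def fiber_def expr_defs
      stable_fromD[OF assms] AlgInj_def Emb_def EmbFun_def Extension_def IsEmb_def Fiber_def
        IsProp_def Prj1_def)

lemma lift_unit_raw:
  assumes "stable_from n X"
  shows "lift_unit T X n = LUnit T (X n)"
  by (simp add: lift_unit_def LUnit_def unit_is_prop_def UnitPrf_def expr_defs
    stable_fromD[OF assms])

lemma lift_map_raw:
  assumes X: "stable_from n X" and f: "stable_from n f"
  shows "lift_map T X f n = LMap T (X n) (f n)"
proof -
  let ?l = "bound_var n"
  have s: "stable_from (Suc n) X" "stable_from (Suc n) ?l"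
    using X stable_from_bound_var by (auto intro: stable_from_mono)
  have d: "lift_dom T X ?l (Suc n) = LDom T (X (Suc n)) v0"
    "lift_dom T X ?l (Suc (Suc n)) = LDom T (X (Suc (Suc n))) v1"
    "lift_val T X ?l (Suc (Suc n)) = LVal T (X (Suc (Suc n))) v1"
    "lift_dom_is_prop T X ?l (Suc n) = LPrf T (X (Suc n)) v0"
    using lift_dom_raw[OF s(1)] lift_dom_raw[OF stable_from_mono[OF s(1)], of "Suc (Suc n)"]
      lift_val_raw[OF stable_from_mono[OF s(1)] stable_from_mono[OF s(2)], of "Suc (Suc n)"]
      lift_dom_is_prop_raw[OF s]
    by (simp_all add: bound_var_def)
  show ?thesis
    by (simp add: lift_map_def LMap_def lam_def pair_of_def fun_comp_def app_def d lifting_raw[OF X]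
        stable_fromD[OF X] stable_fromD[OF f]) (simp add: bound_var_def)
qed

lemma sum_components_raw:
  fixes T :: 'l
  assumes X: "stable_from n X" and P: "stable_from n P" and f: "stable_from n f"
  defines "Q \<equiv> \<lambda>p. lift_dom T X (f \<cdot> p)"
  shows "sig_type P Q n = SDom T (X n) (P n) (f n)"
    and "(\<Lambda> s \<Colon> sig_type P Q. lift_val T X (f \<cdot> proj1 P Q s) \<cdot> proj2 P Q s) n = SVal T (X n) (P n)
      (f n)"
proof -
  note s = stable_fromD[OF X] stable_fromD[OF P] stable_fromD[OF f]
  have Q: "Q x m = LDom T (X m) (TApp (f m) (x m))" if "n \<le> m" for x m
    using lift_dom_raw[OF stable_from_mono[OF X that]] by (simp add: Q_def app_def)
  have 1: "proj1 P Q x m = SPrj1 T (X m) (P m) (f m) (x m)" if "n \<le> m" for x m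
    using that by (simp add: SPrj1_def Prj1_def proj1_def sig_ind_def sig_type_def lam_def Q s)
      (simp add: bound_var_def)
  have 2: "proj2 P Q x m = SPrj2 T (X m) (P m) (f m) (x m)" if "n \<le> m" for x m
    using that by (simp add: SPrj2_def Prj2_def proj2_def sig_ind_def sig_type_def lam_def Q 1 s)
      (simp add: bound_var_def SPrj1_def)
  show 3: "sig_type P Q n = SDom T (X n) (P n) (f n)"
    by (simp add: sig_type_def SDom_def Q s bound_var_def)
  let ?s = "bound_var n"
  have "stable_from (Suc n) (f \<cdot> proj1 P Q ?s)"
    by (simp add: stable_from_def app_def 1 s stable_fromD[OF stable_from_bound_var])
  from lift_val_raw[OF stable_from_mono[OF X] this]
  show "(\<Lambda> s \<Colon> sig_type P Q. lift_val T X (f \<cdot> proj1 P Q s) \<cdot> proj2 P Q s) n = SVal T (X n) (P n)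
    (f n)"
    unfolding lam_def app_def by (simp add: 1 2 3 SVal_def s) (simp add: bound_var_def)
qed

lemma lift_mult_raw:
  assumes X: "stable_from n X"
  shows "lift_mult T X n = LMult T (X n)"
proof -
  let ?l = "bound_var n" and ?L = "lifting T X"
  note L = stable_from_lifting[OF X]
  have X': "stable_from (Suc n) X" and L': "stable_from (Suc n) ?L" and l: "stable_from (Suc n) ?l"
    using stable_from_mono[OF X, of "Suc n"] stable_from_mono[OF L, of "Suc n"]
      stable_from_bound_var by simp_all
  let ?P = "lift_dom T ?L ?l" and ?f = "lift_val T ?L ?l" and ?i = "lift_dom_is_prop T ?L ?l"
  have raw: "?L m = Lift T (X m)" "?P m = LDom T (Lift T (X m)) (TVar (m - Suc n))"
    "?f m = LVal T (Lift T (X m)) (TVar (m - Suc n))"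
      "?i m = LPrf T (Lift T (X m)) (TVar (m - Suc n))"
    if "Suc n \<le> m" for m
    using lifting_raw[OF stable_from_mono[OF X' that]] lift_dom_raw[OF stable_from_mono[OF L' that]]
      lift_val_raw[OF stable_from_mono[OF L' that] stable_from_mono[OF l that]]
      lift_dom_is_prop_raw[OF stable_from_mono[OF L' that] stable_from_mono[OF l that]]
    by (simp_all add: bound_var_def)
  have S: "stable_from (Suc n) ?P" "stable_from (Suc n) ?f" "stable_from (Suc n) ?i"
    using stable_fromD[OF X] by (auto simp: stable_from_def raw Suc_diff_le Suc_diff_Suc)
  show ?thesis
    unfolding lift_mult_def Let_def lam_def[of "lifting T ?L"] pair_of_def
      sum_components_raw[OF X' S(1,2)]
      sum_is_prop_raw[OF X' S]
    by (simp add: LMult_def Let_def raw lifting_raw[OF L] lifting_raw[OF X] stable_fromD[OF X])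
qed

lemma lift_algebra_raw:
  assumes X: "stable_from n X"
  shows "lift_algebra T X n = Alg T (X n)"
proof -
  note L = stable_from_lifting[OF X]
  note LL = stable_from_lifting[OF L]
  have m: "\<And>m. n \<le> m \<Longrightarrow> stable_from m X" "\<And>m. n \<le> m \<Longrightarrow> stable_from m (lifting T X)"
    "\<And>m. n \<le> m \<Longrightarrow> stable_from m (lifting T (lifting T X))"
    "\<And>m. Suc n \<le> m \<Longrightarrow> stable_from m (bound_var n)"
    using stable_from_mono[OF X] stable_from_mono[OF L] stable_from_mono[OF LL]
      stable_from_mono[OF stable_from_bound_var] by auto
  show ?thesis
    by (simp add: lift_algebra_def Alg_def UnitLaw_def AssocLaw_def sig_type_def prod_type_def
      arr_def pi_type_def
        homotopy_def ident_def app_def fun_comp_def id_fun_def lam_def m lifting_raw lift_unit_raw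
          lift_map_raw
        lift_mult_raw stable_fromD[OF X]) (simp add: bound_var_def eval_nat_numeral)
qed

lemma retract_of_algebra_raw:
  assumes D: "stable_from n D"
  shows "retract_of_algebra T v D n = RetAlg T v (D n)"
  by (simp add: retract_of_algebra_def RetAlg_def sig_type_def prod_type_def universe_def
      lift_algebra_raw[OF stable_from_bound_var])
    (simp add: retract_of_def Ret_def expr_defs stable_fromD[OF D])

theorem theorem51:
  fixes T :: "'l::universe_level"
  shows "(\<exists>v. foundation_axioms \<union> resizing_axioms \<tturnstile>
           (\<Prod> D \<Colon> universe T. alg_injective T T D \<leadsto> retract_of_algebra T v D)) \<and>
         (\<forall>v. foundation_axioms \<union> resizing_axioms \<tturnstile>
           (\<Prod> D \<Colon> universe T. retract_of_algebra T v D \<leadsto> alg_injective T T D))"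
proof -
  let ?S = "foundation_axioms \<union> resizing_axioms :: 'l axiom_name set"
  interpret univalent_type_theory ?S by unfold_locales (simp add: foundation_axioms_def)
  have C: "ctx ?S [TUniv T]" by (rule ctx_Cons[OF ty_Univ[OF ctx_Nil]])
  have D: "?S \<parallel> [TUniv T] \<turnstile> v0 \<Colon> TUniv T" using ty_lookup[OF C, of 0] by simp
  have stable: "stable_from (Suc 0) (bound_var 0 :: 'l expr)"
    "stable_from (Suc (Suc 0)) (bound_var 0 :: 'l expr)"
    using stable_from_bound_var[of 0] by (auto intro: stable_from_mono)
  note raw = pi_type_def arr_def universe_def alg_injective_raw[OF stable(1)]
    alg_injective_raw[OF stable(2)]
    retract_of_algebra_raw[OF stable(1)] retract_of_algebra_raw[OF stable(2)]
  have "?S \<tturnstile> (\<Prod> D \<Colon> universe T. alg_injective T T D \<leadsto> retract_of_algebra T (next_level T) D)"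
  proof -
    obtain u where "?S \<parallel> [TUniv T] \<turnstile> AlgInj T T v0 \<Colon> TUniv u"
      using AlgInj_eq[OF C D] by blast
    then have A: "ctx ?S [AlgInj T T v0, TUniv T]" by (rule ctx_Cons)
    have "?S \<parallel> [AlgInj T T v0, TUniv T] \<turnstile> v1 \<Colon> TUniv T"
      "?S \<parallel> [AlgInj T T v0, TUniv T] \<turnstile> v0 \<Colon> AlgInj T T v1"
      using ty_lookup[OF A, of 0] ty_lookup[OF A, of "Suc 0"] by simp_all
    from inh_Pi[OF inh_Pi[OF injective_retract_of_algebra[OF A this]]] show ?thesis
      unfolding holds_def inh_def by (simp add: raw) (simp add: bound_var_def)
  qed
  moreover have "?S \<tturnstile> (\<Prod> D \<Colon> universe T. retract_of_algebra T v D \<leadsto> alg_injective T T D)" for v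
  proof -
    obtain u where "?S \<parallel> [TUniv T] \<turnstile> RetAlg T v v0 \<Colon> TUniv u"
      using RetAlg_eq[OF C D] by blast
    then have A: "ctx ?S [RetAlg T v v0, TUniv T]" by (rule ctx_Cons)
    have "?S \<parallel> [RetAlg T v v0, TUniv T] \<turnstile> v1 \<Colon> TUniv T"
      "?S \<parallel> [RetAlg T v v0, TUniv T] \<turnstile> v0 \<Colon> RetAlg T v v1"
      using ty_lookup[OF A, of 0] ty_lookup[OF A, of "Suc 0"] by simp_all
    from inh_Pi[OF inh_Pi[OF algebra_retract_injective[OF A this]]] show ?thesis
      unfolding holds_def inh_def by (simp add: raw) (simp add: bound_var_def)
  qed
  ultimately show ?thesis by blast
qed

end
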